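(* There exists a constant $\delta_0>0$ such that the following holds. Assume $\|\mathcal T-\mathcal S\|_{\mathrm{op}}\le\delta_0$. Then for Lebesgue-almost every initial point $x_0^+\in\mathbb R^{2n}$ there exists $\bar\alpha>0$ such that for any step sizes $(\alpha_k)_{k\in\mathbb N}$ with $\alpha_k\in(0,\bar\alpha]$ for all $k$ and $\sum_{k=0}^\infty\alpha_k=\infty$, the gradient descent iterates $x^+_{k+1}=x^+_k-\alpha_k\nabla f(x^+_k)$ converge to a global minimizer of $f$.
   Context: Let $n,m\ge 1$, $a_1,\dots,a_m\in\mathbb C^n$ and $x^\natural\in\mathbb C^n$. For $a,b\in\mathbb C^n$ write $\langle a,b\rangle=\sum_{j}a_j\overline{b_j}$ and let $\|\cdot\|$ be the Euclidean norm. Let $y_i=|\langle a_i,x^\natural\rangle|^2$. For $v\in\mathbb C^n$ put $v^+=(\mathrm{Re}\,v,\mathrm{Im}\,v)\in\mathbb R^{2n}$ and $v^-=Mv^+=(-\mathrm{Im}\,v,\mathrm{Re}\,v)$, where $M=\begin{bmatrix}0&-I_n\\ I_n&0\end{bmatrix}$. The map $x\mapsto x^+$ identifies $\mathbb C^n$ with $\mathbb R^{2n}$, and $x$ and $x^+$ always correspond to each other. Define $f:\mathbb R^{2n}\to\mathbb R$ by $f(x^+)=\sum_{i=1}^m\big(|\langle a_i,x\rangle|^2-y_i\big)^2=\sum_{i=1}^m\big(\langle A_ix^+,x^+\rangle-y_i\big)^2$ with $A_i=a_i^+(a_i^+)^{T}+a_i^-(a_i^-)^{T}$; gradients are taken with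 respect to $x^+\in\mathbb R^{2n}$. Fix $\sigma>0$ (in the paper, $\sigma^2=\mathrm{Var}((a_i^+)_1)$ for random measurement vectors) and set $c=m\sigma^4$. Define the order-4 tensors on $\mathbb R^{2n}$: $\mathcal T=\frac1c\sum_{i=1}^m(a_i^+)^{\otimes 4}$ and $\mathcal S_{i_1i_2i_3i_4}=\mathbf 1_{i_1=i_2,\,i_3=i_4}+\mathbf 1_{i_1=i_3,\,i_2=i_4}+\mathbf 1_{i_1=i_4,\,i_2=i_3}$. The inner product of tensors is the sum of entrywise products, and $\|\mathcal R\|_{\mathrm{op}}=\sup\{\langle \mathcal R,u_1\otimes u_2\otimes u_3\otimes u_4\rangle:\ u_j\in\mathbb R^{2n},\ \|u_1\|\|u_2\|\|u_3\|\|u_4\|=1\}$. *)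

theory Defs
  imports "HOL-Analysis.Analysis"
begin

text \<open>Explicit-dimension encoding. A complex vector in C^n is a function
  nat => complex read at indices j < n; a real vector in R^(2n) is a function
  nat => real read at indices j < 2n. Measurement vectors: a i for i < m.\<close>

definition cinner :: "nat \<Rightarrow> (nat \<Rightarrow> complex) \<Rightarrow> (nat \<Rightarrow> complex) \<Rightarrow> complex" where
  "cinner n a b = (\<Sum>j<n. a j * cnj (b j))"

definition plus_vec :: "nat \<Rightarrow> (nat \<Rightarrow> complex) \<Rightarrow> nat \<Rightarrow> real" where
  "plus_vec n v = (\<lambda>j. if j < n then Re (v j) else Im (v (j - n)))"

definition to_cplx :: "nat \<Rightarrow> (nat \<Rightarrow> real) \<Rightarrow> nat \<Rightarrow> complex" where
  "to_cplx n u = (\<lambda>j. Complex (u j) (u (n + j)))"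

definition pr_loss :: "nat \<Rightarrow> nat \<Rightarrow> (nat \<Rightarrow> nat \<Rightarrow> complex) \<Rightarrow> (nat \<Rightarrow> complex)
    \<Rightarrow> (nat \<Rightarrow> real) \<Rightarrow> real" where
  "pr_loss n m a xnat u =
     (\<Sum>i<m. ((cmod (cinner n (a i) (to_cplx n u)))\<^sup>2 - (cmod (cinner n (a i) xnat))\<^sup>2)\<^sup>2)"

definition rgrad :: "((nat \<Rightarrow> real) \<Rightarrow> real) \<Rightarrow> (nat \<Rightarrow> real) \<Rightarrow> nat \<Rightarrow> real" where
  "rgrad F u = (\<lambda>j. deriv (\<lambda>t. F (u(j := u j + t))) 0)"

primrec gd_iter :: "((nat \<Rightarrow> real) \<Rightarrow> real) \<Rightarrow> (nat \<Rightarrow> real) \<Rightarrow> (nat \<Rightarrow> real)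
    \<Rightarrow> nat \<Rightarrow> nat \<Rightarrow> real" where
  "gd_iter F \<alpha> x0 0 = x0"
| "gd_iter F \<alpha> x0 (Suc k) = (\<lambda>j. gd_iter F \<alpha> x0 k j - \<alpha> k * rgrad F (gd_iter F \<alpha> x0 k) j)"

text \<open>Order-4 tensors on R^(2n) as functions of four indices < 2n.\<close>
type_synonym tensor4 = "nat \<Rightarrow> nat \<Rightarrow> nat \<Rightarrow> nat \<Rightarrow> real"

definition tensT :: "nat \<Rightarrow> nat \<Rightarrow> (nat \<Rightarrow> nat \<Rightarrow> complex) \<Rightarrow> real \<Rightarrow> tensor4" where
  "tensT n m a \<sigma> = (\<lambda>i1 i2 i3 i4. (1 / (real m * \<sigma> ^ 4)) *
      (\<Sum>i<m. plus_vec n (a i) i1 * plus_vec n (a i) i2 * plus_vec n (a i) i3 * plus_vec n (a i) i4))"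

definition tensS :: tensor4 where
  "tensS = (\<lambda>i1 i2 i3 i4.
      (if i1 = i2 \<and> i3 = i4 then 1 else 0) + (if i1 = i3 \<and> i2 = i4 then 1 else 0)
    + (if i1 = i4 \<and> i2 = i3 then 1 else 0))"

definition rnorm :: "nat \<Rightarrow> (nat \<Rightarrow> real) \<Rightarrow> real" where
  "rnorm d u = sqrt (\<Sum>j<d. (u j)\<^sup>2)"

definition tens_apply :: "nat \<Rightarrow> tensor4 \<Rightarrow> (nat \<Rightarrow> real) \<Rightarrow> (nat \<Rightarrow> real)
    \<Rightarrow> (nat \<Rightarrow> real) \<Rightarrow> (nat \<Rightarrow> real) \<Rightarrow> real" where
  "tens_apply d R u1 u2 u3 u4 =
     (\<Sum>i1<d. \<Sum>i2<d. \<Sum>i3<d. \<Sum>i4<d. R i1 i2 i3 i4 * u1 i1 * u2 i2 * u3 i3 * u4 i4)"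

definition tens_opnorm :: "nat \<Rightarrow> tensor4 \<Rightarrow> real" where
  "tens_opnorm d R = Sup {tens_apply d R u1 u2 u3 u4 | u1 u2 u3 u4.
      rnorm d u1 * rnorm d u2 * rnorm d u3 * rnorm d u4 = 1}"

end

theory Submission
  imports Defs
begin

text \<open>
  Normalise the signal to a unit vector \<open>e\<close>. For \<open>T = S\<close> the loss is, up to a factor,
  \<open>F0 x = (|x|^4 - |x|^2 + 1 - |<x,e>|^2) / 2\<close>; its critical points are the origin, the circle of
  minimisers and the saddles with \<open><x,e> = 0\<close> and \<open>|x|^2 = 1/2\<close>, where \<open>F0 = 3/8\<close>. An operator norm
  bound on \<open>T - S\<close> perturbs loss, gradient and Lipschitz constants by relatively small amounts.
  Once an iterate has loss below \<open>3/8 - 1/2000\<close>, it is driven to the circle, and the distance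
  to the circle contracts there. Otherwise the iterates enter, within a time depending only on
  the initial norm, a neighbourhood of the saddles and stay there.

  The step sizes may depend on the initial point, so the exceptional set is not the stable set
  of a single map. However, iterates with small variable steps track those with a
  constant small step \<open>h\<close> on bounded time intervals. Hence all bad points of an annulus are
  carried by one map into the saddle region and remain there for as long as we like. In this
  region the cone around the complex line of \<open>e\<close> is invariant and expanded, so two images are either
  outside the cone of each other or arbitrarily close. An \<open>r\<close>-separated set of \<open>N\<close> bad points thus has
  images whose translates by about \<open>1/r\<close> multiples of \<open>e\<close> are still separated at scale \<open>r\<close>. Comparing
  with the packing bound \<open>r^(-d)\<close> gives \<open>N = O(r^(1-d))\<close>, and the bad set is null.
\<close>

section \<open>Step sequences with divergent sum\<close>

text \<open>Preimages of a stable manifold describe the bad points of a single map, but here an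
  adversary chooses among uncountably many step sequences. The way out is that a bad point is bad
  for every bound on the steps (\<open>stuck\<close>): for any prescribed h it has a bad sequence
  with steps at most h, and all these sequences are shadowed by one map, constant steps h. The
  shadowing error grows exponentially with time and the stay near the saddles must last for a time
  of order 1/r^2, so h is exponentially small in 1/r^2. This is harmless because points are compared
  at the entrance to the region, at a time of order R^2: the factor by which distances may have
  shrunk until then depends on R only, never on r. Counting separated points also avoids
  measurability of the bad set and smoothness of its image. With the tolerance 1/10000 the loss near
  the saddles moves by much less than the gap 1/2000 below 3/8. A zero signal has no direction e and
  a minimiser with vanishing Hessian; it is treated separately, and there every initial point
  converges.\<close>

lemma partial_sums_unbounded:
  fixes \<alpha> :: "nat \<Rightarrow> real"
  assumes "\<And>k. 0 < \<alpha> k" "\<not> summable \<alpha>"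
  shows "\<exists>k. B < sum \<alpha> {..<k}"
proof (rule ccontr)
  assume "\<not> ?thesis"
  then have "\<And>k. sum \<alpha> {..<k} \<le> B" by (simp add: not_less)
  then have "summable \<alpha>"
    using assms(1) by (intro summableI_nonneg_bounded[of \<alpha> B]) (auto simp: less_imp_le)
  with assms(2) show False by simp
qed

text \<open>A quantity bounded below has only finitely much to lose, while the loss is proportional
  to the elapsed time, which is infinite. This replaces convergence rates throughout: it is applied
  to the loss, to the distance from the circle and to the squared norm.\<close>

lemma no_perpetual_drift:
  fixes a \<alpha> :: "nat \<Rightarrow> real"
  assumes "\<And>k. 0 < \<alpha> k" "\<not> summable \<alpha>" and "0 < \<mu>"
    and drift: "\<And>k. k0 \<le> k \<Longrightarrow> a (Suc k) \<le> a k - \<mu> * \<alpha> k" and "\<And>k. b \<le> a k"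
  shows False
proof -
  have *: "a (k0 + k) \<le> a k0 - \<mu> * (sum \<alpha> {..<k0 + k} - sum \<alpha> {..<k0})" for k
  proof (induction k)
    case (Suc k)
    then show ?case using drift[of "k0 + k"] by (simp add: algebra_simps)
  qed simp
  obtain k where k: "(a k0 - b) / \<mu> + sum \<alpha> {..<k0} < sum \<alpha> {..<k}"
    using partial_sums_unbounded[OF assms(1,2)] by blast
  have "sum \<alpha> {..<k} \<le> sum \<alpha> {..<k0 + k}"
    by (rule sum_mono2) (use assms(1) in \<open>auto simp: less_imp_le\<close>)
  with k have "(a k0 - b) / \<mu> < sum \<alpha> {..<k0 + k} - sum \<alpha> {..<k0}" by linarith
  then have "a k0 - b < \<mu> * (sum \<alpha> {..<k0 + k} - sum \<alpha> {..<k0})"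
    using \<open>0 < \<mu>\<close> by (simp add: field_simps)
  with *[of k] assms(5)[of "k0 + k"] show False by linarith
qed

text \<open>In the applications \<open>c'\<close> lies a little above \<open>c\<close>, because a
  step from below \<open>c\<close> may overshoot. Once at most \<open>c'\<close>, the sequence stays
  there; before that it descends from \<open>M\<close> at speed at least \<mu>, so time (M - c') /
  \<mu> suffices.\<close>

lemma drift_into:
  fixes a \<alpha> :: "nat \<Rightarrow> real"
  assumes "\<And>k. 0 < \<alpha> k" and "0 < \<mu>" "a 0 \<le> M"
    and drift: "\<And>k. c \<le> a k \<Longrightarrow> a (Suc k) \<le> a k - \<mu> * \<alpha> k"
    and small: "\<And>k. a k < c \<Longrightarrow> a (Suc k) \<le> c'"
    and "(M - c') / \<mu> \<le> sum \<alpha> {..<k}"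
  shows "a k \<le> c'"
proof -
  have "a k \<le> c' \<or> a k \<le> M - \<mu> * sum \<alpha> {..<k}" for k
  proof (induction k)
    case 0
    then show ?case using assms(3) by simp
  next
    case (Suc k)
    have "0 < \<mu> * \<alpha> k" using assms(1,2) by simp
    then show ?case using Suc drift[of k] small[of k]
      by (cases "c \<le> a k") (auto simp: algebra_simps)
  qed
  moreover have "M - c' \<le> \<mu> * sum \<alpha> {..<k}"
    using assms(6) \<open>0 < \<mu>\<close> by (simp add: field_simps)
  ultimately show ?thesis by (smt (verit))
qed

primrec grad_steps :: "('a::real_vector \<Rightarrow> 'a) \<Rightarrow> (nat \<Rightarrow> real) \<Rightarrow> 'a \<Rightarrow> nat \<Rightarrow> 'a" where
  "grad_steps g \<alpha> x 0 = x"
| "grad_steps g \<alpha> x (Suc k) = grad_steps g \<alpha> x k - \<alpha> k *\<^sub>R g (grad_steps g \<alpha> x k)"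

text \<open>The proof merges the two time grids, always advancing the iteration that lags behind.\<close>

lemma tracking:
  fixes g :: "'a::real_normed_vector \<Rightarrow> 'a" and x :: "nat \<Rightarrow> 'a"
  assumes \<alpha>: "\<And>k. 0 < \<alpha> k" "\<And>k. \<alpha> k \<le> h" "\<not> summable \<alpha>" and "0 < h" "0 \<le> L" "0 \<le> B"
    and x: "\<And>k. x k \<in> K" "\<And>k. x (Suc k) = x k - \<alpha> k *\<^sub>R g (x k)"
    and y: "\<And>k. y k \<in> K" "\<And>k. y (Suc k) = y k - h *\<^sub>R g (y k)"
    and "x 0 = y 0"
    and lip: "\<And>u v. u \<in> K \<Longrightarrow> v \<in> K \<Longrightarrow> norm (g u - g v) \<le> L * norm (u - v)"
    and bnd: "\<And>u. u \<in> K \<Longrightarrow> norm (g u) \<le> B"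
  shows "\<exists>k. real l * h \<le> sum \<alpha> {..<k} \<and> norm (x k - y l) \<le> h * B * exp (3 * L * h * real l)"
proof -
  define t where "t k = sum \<alpha> {..<k}" for k
  define s where "s l = real l * h" for l
  \<comment> \<open>The vector compares \<open>x k\<close> with the Euler polygon of
    \<open>y\<close>, extrapolated from \<open>y l\<close> to time \<open>t k\<close>. The extra
    \<open>h * B\<close> dominates both the distance from polygon to vertex and the discretisation
    error, so every advance just multiplies \<open>E\<close> by a factor.\<close>
  define E where "E k l = norm (x k - y l + (t k - s l) *\<^sub>R g (y l)) + h * B" for k l
  have tS: "t (Suc k) = t k + \<alpha> k" for k by (simp add: t_def)
  have sS: "s (Suc k) = s k + h" for k by (simp add: s_def algebra_simps)
  have t_mono: "k \<le> k' \<Longrightarrow> t k \<le> t k'" for k k'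
    unfolding t_def by (rule sum_mono2) (use \<alpha>(1) in \<open>auto simp: less_imp_le\<close>)
  have hB: "0 \<le> h * B" using \<open>0 < h\<close> \<open>0 \<le> B\<close> by simp
  have dist_le: "norm (x k - y l) \<le> E k l" if "\<bar>t k - s l\<bar> \<le> h" for k l
  proof -
    have "norm ((t k - s l) *\<^sub>R g (y l)) \<le> h * B"
      using that bnd[OF y(1)[of l]] by (auto intro: mult_mono)
    then show ?thesis unfolding E_def
      using norm_triangle_ineq4[of "x k - y l + (t k - s l) *\<^sub>R g (y l)" "(t k - s l) *\<^sub>R g (y l)"]
      by simp
  qed
  have adv_y: "E k (Suc l) \<le> exp (h * L) * E k l" if "s l \<le> t k" "t k \<le> s l + h" for k l
  proof -
    have eq: "x k - y (Suc l) + (t k - s (Suc l)) *\<^sub>R g (y (Suc l))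
       = (x k - y l + (t k - s l) *\<^sub>R g (y l)) + (t k - s l - h) *\<^sub>R (g (y (Suc l)) - g (y l))"
      by (simp add: y(2) sS algebra_simps)
    have "norm (y (Suc l) - y l) \<le> h * B"
      using bnd[OF y(1)[of l]] \<open>0 < h\<close> by (simp add: y(2) mult_left_mono)
    then have "norm (g (y (Suc l)) - g (y l)) \<le> L * (h * B)"
      using lip[OF y(1) y(1), of "Suc l" l] \<open>0 \<le> L\<close> by (meson mult_left_mono order_trans)
    moreover have "\<bar>t k - s l - h\<bar> \<le> h" using that by linarith
    ultimately have "norm ((t k - s l - h) *\<^sub>R (g (y (Suc l)) - g (y l))) \<le> h * (L * (h * B))"
      by (auto intro: mult_mono)
    then have "E k (Suc l) \<le> E k l + h * (L * (h * B))"
      unfolding E_def eq by (smt (verit) norm_triangle_ineq)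
    also have "\<dots> \<le> E k l + h * L * E k l"
      using \<open>0 < h\<close> \<open>0 \<le> L\<close> by (auto simp: E_def algebra_simps intro!: mult_left_mono)
    also have "\<dots> = (1 + h * L) * E k l" by (simp add: algebra_simps)
    also have "\<dots> \<le> exp (h * L) * E k l"
      using exp_ge_add_one_self[of "h * L"] hB by (intro mult_right_mono) (auto simp: E_def)
    finally show ?thesis .
  qed
  have adv_x: "E (Suc k) l \<le> exp (L * \<alpha> k) * E k l" if "\<bar>t k - s l\<bar> \<le> h" for k l
  proof -
    have eq: "x (Suc k) - y l + (t (Suc k) - s l) *\<^sub>R g (y l)
       = (x k - y l + (t k - s l) *\<^sub>R g (y l)) - \<alpha> k *\<^sub>R (g (x k) - g (y l))"
      by (simp add: x(2) tS algebra_simps)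
    have "norm (g (x k) - g (y l)) \<le> L * E k l"
      using lip[OF x(1) y(1), of k l] dist_le[OF that] \<open>0 \<le> L\<close> by (meson mult_left_mono order_trans)
    then have "norm (\<alpha> k *\<^sub>R (g (x k) - g (y l))) \<le> \<alpha> k * (L * E k l)"
      using \<alpha>(1)[of k] by (auto intro: mult_left_mono)
    then have "E (Suc k) l \<le> E k l + \<alpha> k * (L * E k l)"
      unfolding E_def eq by (smt (verit) norm_triangle_ineq4)
    also have "\<dots> = (1 + L * \<alpha> k) * E k l" by (simp add: algebra_simps)
    also have "\<dots> \<le> exp (L * \<alpha> k) * E k l"
      using exp_ge_add_one_self[of "L * \<alpha> k"] hB by (intro mult_right_mono) (auto simp: E_def)
    finally show ?thesis .
  qed
  have run_x: "E (k + j) l \<le> exp (L * (t (k + j) - t k)) * E k l"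
    if "s l - h \<le> t k" "\<And>i. i < j \<Longrightarrow> t (k + i) < s l" for k j l
    using that(2)
  proof (induction j)
    case (Suc j)
    have "\<bar>t (k + j) - s l\<bar> \<le> h"
      using Suc.prems[of j] that(1) t_mono[of k "k + j"] \<open>0 < h\<close> by simp
    then have "E (k + Suc j) l \<le> exp (L * \<alpha> (k + j)) * E (k + j) l"
      using adv_x[of "k + j" l] by simp
    also have "\<dots> \<le> exp (L * \<alpha> (k + j)) * (exp (L * (t (k + j) - t k)) * E k l)"
      using Suc by (intro mult_left_mono) auto
    also have "\<dots> = exp (L * (t (k + Suc j) - t k)) * E k l"
    proof -
      have e: "L * \<alpha> (k + j) + L * (t (k + j) - t k) = L * (t (k + Suc j) - t k)"
        by (simp add: tS algebra_simps)
      show ?thesis unfolding e[symmetric] exp_add by (simp add: mult_ac)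
    qed
    finally show ?case .
  qed simp
  have "\<exists>k. s l \<le> t k \<and> t k \<le> s l + h \<and> E k l \<le> h * B * exp (3 * L * h * real l)"
  proof (induction l)
    case 0
    then show ?case using \<open>x 0 = y 0\<close> \<open>0 < h\<close>
      by (intro exI[of _ 0]) (simp add: E_def t_def s_def)
  next
    case (Suc l)
    then obtain k where k: "s l \<le> t k" "t k \<le> s l + h" "E k l \<le> h * B * exp (3 * L * h * real l)"
      by blast
    have ex: "\<exists>j. s (Suc l) \<le> t (k + j)"
    proof -
      obtain i where "s (Suc l) < t i"
        using partial_sums_unbounded[OF \<alpha>(1,3)] unfolding t_def by blast
      then show ?thesis using t_mono[of i "k + i"] by (intro exI[of _ i]) simp
    qed
    define j where "j = (LEAST j. s (Suc l) \<le> t (k + j))"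
    have j: "s (Suc l) \<le> t (k + j)" unfolding j_def using ex by (rule LeastI_ex)
    have jmin: "t (k + i) < s (Suc l)" if "i < j" for i
      using not_less_Least[of i "\<lambda>j. s (Suc l) \<le> t (k + j)"] that by (simp add: j_def)
    have upper: "t (k + j) \<le> s (Suc l) + h"
    proof (cases j)
      case 0
      then show ?thesis using k(2) \<open>0 < h\<close> by (simp add: sS)
    next
      case (Suc i)
      then show ?thesis using jmin[of i] \<alpha>(2)[of "k + i"] by (simp add: tS)
    qed
    have "E (k + j) (Suc l) \<le> exp (L * (t (k + j) - t k)) * E k (Suc l)"
      by (rule run_x) (use k jmin in \<open>auto simp: sS\<close>)
    \<comment> \<open>While \<open>y\<close> makes one step, the time of \<open>x\<close> moves from
      at least \<open>s l\<close> to at most \<open>s (Suc l) + h\<close>, hence by at most 2 h.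
      Together with the factor exp (h L) for \<open>y\<close> this is the 3 in the exponent.\<close>
    also have "\<dots> \<le> exp (L * (2 * h)) * E k (Suc l)"
      using upper k(1) \<open>0 \<le> L\<close> hB
      by (intro mult_right_mono) (auto simp: sS E_def intro!: mult_left_mono)
    also have "\<dots> \<le> exp (L * (2 * h)) * (exp (h * L) * (h * B * exp (3 * L * h * real l)))"
      using adv_y[OF k(1,2)] k(3)
      by (intro mult_left_mono) (auto intro: order_trans mult_left_mono)
    also have "\<dots> = h * B * exp (3 * L * h * real (Suc l))"
    proof -
      have e: "L * (2 * h) + (h * L + 3 * L * h * real l) = 3 * L * h * real (Suc l)"
        by (simp add: algebra_simps)
      show ?thesis unfolding e[symmetric] exp_add by (simp add: mult_ac)
    qed
    finally show ?case using j upper by blast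
  qed
  then obtain k where "s l \<le> t k" "t k \<le> s l + h" "E k l \<le> h * B * exp (3 * L * h * real l)"
    by blast
  then show ?thesis using dist_le[of k l] by (intro exI[of _ k]) (auto simp: t_def s_def)
qed

section \<open>Perturbations of the population loss\<close>

locale orthonormal_pair =
  fixes V :: "'a::real_inner set" and e e' :: 'a
  assumes subV: "subspace V" and eV: "e \<in> V" "e' \<in> V"
    and e1: "e \<bullet> e = 1" and e'1: "e' \<bullet> e' = 1" and ee': "e \<bullet> e' = 0"
begin

text \<open>In the application \<open>e\<close> is the normalised signal and \<open>e'\<close> is \<open>i e\<close>, so \<open>pl\<close> and \<open>ql\<close>
  are the projections onto the complex line of the signal and its complement. For
  \<open>T = S\<close> the loss divided by \<open>16 c\<close> and its gradient are \<open>F0\<close> and \<open>g0\<close>.\<close>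

definition pl :: "'a \<Rightarrow> 'a" where "pl x = (x \<bullet> e) *\<^sub>R e + (x \<bullet> e') *\<^sub>R e'"
definition ql :: "'a \<Rightarrow> 'a" where "ql x = x - pl x"
definition m2 :: "'a \<Rightarrow> real" where "m2 x = (x \<bullet> e)\<^sup>2 + (x \<bullet> e')\<^sup>2"
definition w2 :: "'a \<Rightarrow> real" where "w2 x = x \<bullet> x - m2 x"
definition g0 :: "'a \<Rightarrow> 'a" where "g0 x = (2 * (x \<bullet> x) - 1) *\<^sub>R x - pl x"
definition F0 :: "'a \<Rightarrow> real" where "F0 x = ((x \<bullet> x)\<^sup>2 - x \<bullet> x + 1 - m2 x) / 2"

lemma e'e: "e' \<bullet> e = 0"
  using ee' by (simp add: inner_commute)

lemma pl_pl: "pl x \<bullet> pl y = (x \<bullet> e) * (y \<bullet> e) + (x \<bullet> e') * (y \<bullet> e')"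
  by (simp add: pl_def inner_simps e1 e'1 ee' e'e)

lemma inner_pl: "x \<bullet> pl y = pl x \<bullet> pl y" "pl x \<bullet> y = pl x \<bullet> pl y"
  unfolding pl_pl by (simp_all add: pl_def inner_simps inner_commute)

lemma m2_pl: "m2 x = pl x \<bullet> pl x"
  by (simp add: m2_def pl_pl power2_eq_square)

lemma ql_ql: "ql x \<bullet> ql y = x \<bullet> y - pl x \<bullet> pl y"
  by (simp add: ql_def inner_simps inner_pl(1)[of x y] inner_pl(2)[of x y])

lemma inner_ql: "x \<bullet> ql y = ql x \<bullet> ql y" "ql x \<bullet> y = ql x \<bullet> ql y"
  unfolding ql_ql by (simp_all add: ql_def inner_simps inner_pl(1)[of x y] inner_pl(2)[of x y])

lemma w2_ql: "w2 x = ql x \<bullet> ql x"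
  by (simp add: w2_def ql_ql m2_pl)

lemma m2_nonneg: "0 \<le> m2 x" by (simp add: m2_def)
lemma w2_nonneg: "0 \<le> w2 x" by (simp add: w2_ql)
lemma m2_le: "m2 x \<le> x \<bullet> x" using w2_nonneg[of x] by (simp add: w2_def)

lemma pl_simps: "pl (x + y) = pl x + pl y" "pl (x - y) = pl x - pl y" "pl (a *\<^sub>R x) = a *\<^sub>R pl x"
  "pl 0 = 0"
  by (simp_all add: pl_def algebra_simps inner_simps)

lemma pl_idem: "pl (pl x) = pl x"
  by (simp add: pl_def inner_simps e1 e'1 ee' e'e)

lemma ql_simps: "ql (x + y) = ql x + ql y" "ql (x - y) = ql x - ql y" "ql (a *\<^sub>R x) = a *\<^sub>R ql x"
  by (simp_all add: ql_def pl_simps algebra_simps)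

lemma norm_pl_le: "norm (pl x) \<le> norm x"
  using m2_le[of x] by (simp add: m2_pl norm_le)

lemma norm_ql_le: "norm (ql x) \<le> norm x"
  using m2_nonneg[of x] w2_def[of x] by (simp add: w2_ql norm_le)

lemma pl_V: "pl x \<in> V"
  unfolding pl_def using subV eV by (intro subspace_add subspace_scale)

lemma inner_g0: "x \<bullet> g0 x = (2 * (x \<bullet> x) - 1) * (x \<bullet> x) - m2 x"
  by (simp add: g0_def inner_simps inner_pl(1)[of x x] m2_pl)

lemma norm_g0_diff:
  assumes "norm x \<le> R" "norm y \<le> R"
  shows "norm (g0 x - g0 y) \<le> (6 * R\<^sup>2 + 2) * norm (x - y)"
proof -
  have R: "0 \<le> R" using assms(1) norm_ge_zero[of x] by linarith
  have eq: "g0 x - g0 y = (2 * (x \<bullet> x) - 1) *\<^sub>R (x - y) + (2 * ((x + y) \<bullet> (x - y))) *\<^sub>R y - pl (x - y)"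
    by (simp add: g0_def pl_simps algebra_simps inner_simps inner_commute)
  have xx: "x \<bullet> x \<le> R\<^sup>2" using assms(1) by (simp add: dot_square_norm power_mono)
  have 1: "norm ((2 * (x \<bullet> x) - 1) *\<^sub>R (x - y)) \<le> (2 * R\<^sup>2 + 1) * norm (x - y)"
    using xx by (auto intro!: mult_right_mono simp: abs_le_iff)
      (smt (verit) inner_ge_zero zero_le_power2)
  have "norm (x + y) \<le> 2 * R" using norm_triangle_ineq[of x y] assms by linarith
  then have "\<bar>(x + y) \<bullet> (x - y)\<bar> \<le> 2 * R * norm (x - y)"
    using Cauchy_Schwarz_ineq2[of "x + y" "x - y"] mult_right_mono[of "norm (x + y)" "2 * R" "norm (x - y)"]
    by simp
  then have "\<bar>2 * ((x + y) \<bullet> (x - y))\<bar> * norm y \<le> (4 * R * norm (x - y)) * R"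
    using assms(2) R by (intro mult_mono) auto
  then have 2: "norm ((2 * ((x + y) \<bullet> (x - y))) *\<^sub>R y) \<le> 4 * R\<^sup>2 * norm (x - y)"
    unfolding norm_scaleR by (simp only: power2_eq_square mult_ac)
  have "norm (g0 x - g0 y) \<le> norm ((2 * (x \<bullet> x) - 1) *\<^sub>R (x - y))
      + norm ((2 * ((x + y) \<bullet> (x - y))) *\<^sub>R y) + norm (pl (x - y))"
    unfolding eq by (smt (verit) norm_triangle_ineq norm_triangle_ineq4)
  also have "\<dots> \<le> (6 * R\<^sup>2 + 2) * norm (x - y)"
    using 1 2 norm_pl_le[of "x - y"] by (simp add: algebra_simps)
  finally show ?thesis .
qed

end

text \<open>The numerical bounds are what an error of 1/10000 in operator norm produces. In
  \<open>pert_g\<close> the cubic terms give 3 R^2, one R^2 for each varied argument, and the linear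
  terms give 1; in \<open>pert_F\<close> the quartic, quadratic and constant terms combine to a
  square. Bounding differences of \<open>g - g0\<close> keeps the error relative to the distance
  from any common zero. On the circle nothing is perturbed: these points reproduce the measurements
  exactly.\<close>

locale perturbed_landscape = orthonormal_pair V e e' for V :: "'a::real_inner set" and e e' +
  fixes F :: "'a \<Rightarrow> real" and g :: "'a \<Rightarrow> 'a"
  assumes complV: "complete V"
    and gV: "x \<in> V \<Longrightarrow> g x \<in> V"
    and g_zero: "g 0 = 0"
    and pert_g: "\<lbrakk>x \<in> V; y \<in> V; norm x \<le> R; norm y \<le> R\<rbrakk>
      \<Longrightarrow> norm ((g x - g0 x) - (g y - g0 y)) \<le> (3 * R\<^sup>2 + 1) / 10000 * norm (x - y)"
    and pert_F: "x \<in> V \<Longrightarrow> \<bar>F x - F0 x\<bar> \<le> (x \<bullet> x + 1)\<^sup>2 / 40000"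
    and deriv_F: "\<lbrakk>x \<in> V; v \<in> V\<rbrakk>
      \<Longrightarrow> ((\<lambda>t. F (x + t *\<^sub>R v)) has_real_derivative (g (x + t *\<^sub>R v) \<bullet> v)) (at t)"
    and F_nonneg: "0 \<le> F x"
    and circle: "c\<^sup>2 + s\<^sup>2 = 1 \<Longrightarrow> F (c *\<^sub>R e + s *\<^sub>R e') = 0"
      "c\<^sup>2 + s\<^sup>2 = 1 \<Longrightarrow> g (c *\<^sub>R e + s *\<^sub>R e') = 0"
begin

text \<open>A rounded-up Lipschitz constant of \<open>g\<close> on the ball of radius R in
  \<open>V\<close>; \<open>bndc\<close> then bounds \<open>g\<close> on that ball because
  \<open>g 0 = 0\<close>.\<close>

definition lipc :: "real \<Rightarrow> real" where "lipc R = 10 * (R\<^sup>2 + 1)"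
definition bndc :: "real \<Rightarrow> real" where "bndc R = 10 * (R\<^sup>2 + 1) * R"

lemma lip_g:
  assumes "x \<in> V" "y \<in> V" "norm x \<le> R" "norm y \<le> R"
  shows "norm (g x - g y) \<le> lipc R * norm (x - y)"
proof -
  have "norm (g x - g y) \<le> norm ((g x - g0 x) - (g y - g0 y)) + norm (g0 x - g0 y)"
    using norm_triangle_ineq[of "(g x - g0 x) - (g y - g0 y)" "g0 x - g0 y"] by simp
  also have "\<dots> \<le> ((3 * R\<^sup>2 + 1) / 10000 + (6 * R\<^sup>2 + 2)) * norm (x - y)"
    using add_mono[OF pert_g[OF assms] norm_g0_diff[OF assms(3,4)]] by (simp only: distrib_right)
  also have "\<dots> \<le> lipc R * norm (x - y)"
    unfolding lipc_def by (intro mult_right_mono) (auto simp: field_simps add_nonneg_nonneg)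
  finally show ?thesis .
qed

lemma bnd_g:
  assumes "x \<in> V" "norm x \<le> R"
  shows "norm (g x) \<le> bndc R"
proof -
  have "norm (g x) \<le> lipc R * norm x"
    using lip_g[OF assms(1) subspace_0[OF subV] assms(2)] assms(2) norm_ge_zero[of x]
    by (simp add: g_zero del: norm_ge_zero)
  also have "\<dots> \<le> bndc R"
    unfolding lipc_def bndc_def using assms(2) by (intro mult_left_mono) auto
  finally show ?thesis .
qed

lemma pert_g_norm:
  assumes "x \<in> V"
  shows "norm (g x - g0 x) \<le> (3 * (x \<bullet> x) + 1) / 10000 * norm x"
  using pert_g[OF assms subspace_0[OF subV], of "norm x"]
  by (simp add: g_zero g0_def pl_simps dot_square_norm)

lemma inner_g:
  assumes "x \<in> V"
  shows "\<bar>x \<bullet> g x - ((2 * (x \<bullet> x) - 1) * (x \<bullet> x) - m2 x)\<bar> \<le> (3 * (x \<bullet> x) + 1) / 10000 * (x \<bullet> x)"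
proof -
  have "\<bar>x \<bullet> (g x - g0 x)\<bar> \<le> norm x * norm (g x - g0 x)"
    by (rule Cauchy_Schwarz_ineq2)
  also have "\<dots> \<le> norm x * ((3 * (x \<bullet> x) + 1) / 10000 * norm x)"
    using pert_g_norm[OF assms] by (intro mult_left_mono) auto
  also have "\<dots> = (3 * (x \<bullet> x) + 1) / 10000 * (x \<bullet> x)"
    by (simp add: dot_square_norm power2_eq_square)
  finally show ?thesis by (simp add: inner_diff_right inner_g0)
qed

lemma step_V: "x \<in> V \<Longrightarrow> x - a *\<^sub>R g x \<in> V"
  using subV gV by (intro subspace_diff subspace_scale)

lemma grad_steps_V: "x \<in> V \<Longrightarrow> grad_steps g \<alpha> x k \<in> V"
  by (induction k) (auto intro: step_V)

section \<open>Invariant balls and descent of the loss\<close>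

lemma inner_step:
  "(x - a *\<^sub>R g x) \<bullet> (x - a *\<^sub>R g x) = x \<bullet> x - 2 * a * (x \<bullet> g x) + a\<^sup>2 * (norm (g x))\<^sup>2"
  unfolding power2_norm_eq_inner by (simp add: inner_simps algebra_simps inner_commute power2_eq_square)

lemma quad_small:
  assumes "x \<in> V" "norm x \<le> R" "0 \<le> a" "a * (bndc R)\<^sup>2 \<le> \<epsilon>"
  shows "a\<^sup>2 * (norm (g x))\<^sup>2 \<le> a * \<epsilon>"
proof -
  have "(norm (g x))\<^sup>2 \<le> (bndc R)\<^sup>2" using bnd_g[OF assms(1,2)] by (intro power_mono) auto
  then have "a * (norm (g x))\<^sup>2 \<le> \<epsilon>"
    using mult_left_mono[of "(norm (g x))\<^sup>2" "(bndc R)\<^sup>2" a] assms(3,4) by linarith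
  then have "a * (a * (norm (g x))\<^sup>2) \<le> a * \<epsilon>" using assms(3) by (rule mult_left_mono)
  then show ?thesis by (simp add: power2_eq_square mult.assoc)
qed

lemma bndc_ge: "2 \<le> R \<Longrightarrow> 100 \<le> bndc R" "2 \<le> R \<Longrightarrow> lipc R \<le> bndc R" "2 \<le> R \<Longrightarrow> R \<le> bndc R"
proof -
  assume R: "2 \<le> R"
  have R2: "4 \<le> R\<^sup>2" using power_mono[OF R, of 2] by simp
  have "10 * (R\<^sup>2 + 1) * 2 \<le> bndc R" unfolding bndc_def using R by (intro mult_left_mono) auto
  then show "100 \<le> bndc R" "lipc R \<le> bndc R" using R2 by (auto simp: lipc_def)
  have "1 * R \<le> bndc R" unfolding bndc_def using R R2 by (intro mult_right_mono) auto
  then show "R \<le> bndc R" by simp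
qed

text \<open>A single step condition, on the step times the square of \<open>bndc R\<close>, serves
  all estimates; the others follow from it since \<open>bndc R\<close> is at least 100 and dominates
  both \<open>lipc R\<close> and R.\<close>

lemma step_small:
  assumes "2 \<le> R" "0 \<le> a" "a * (bndc R)\<^sup>2 \<le> 1 / 1000"
  shows "a * bndc R \<le> 1 / 100000" "a * lipc R \<le> 1 / 100000" "a \<le> 1 / 10000000" "a * (R * bndc R) \<le> 1 / 1000"
proof -
  note B = bndc_ge[OF assms(1)]
  have "a * bndc R * 100 \<le> a * bndc R * bndc R" using B assms(2) by (intro mult_left_mono) auto
  then show 1: "a * bndc R \<le> 1 / 100000" using assms(3) by (simp add: power2_eq_square algebra_simps)
  have "a * lipc R \<le> a * bndc R" using B assms(2) by (intro mult_left_mono) auto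
  then show "a * lipc R \<le> 1 / 100000" using 1 by linarith
  have "a * 100 \<le> a * bndc R" using B assms(2) by (intro mult_left_mono) auto
  then show "a \<le> 1 / 10000000" using 1 by linarith
  have "a * (R * bndc R) \<le> a * (bndc R * bndc R)"
    using B assms(2) by (intro mult_left_mono mult_right_mono) auto
  then show "a * (R * bndc R) \<le> 1 / 1000" using assms(3) by (simp add: power2_eq_square)
qed

text \<open>Beyond radius 3/2 the cubic part of the gradient makes \<open>x \<bullet> g x\<close> at
  least 1, which beats the quadratic term of the step. Within radius 3/2 a step of length at most
  1/100000 cannot leave a ball of radius at least 2.\<close>

lemma ball_invariant:
  assumes "2 \<le> R" "0 \<le> a" "a * (bndc R)\<^sup>2 \<le> 1 / 1000" "x \<in> V" "norm x \<le> R"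
  shows "norm (x - a *\<^sub>R g x) \<le> R"
proof (cases "norm x \<le> 3 / 2")
  case True
  have "norm (a *\<^sub>R g x) \<le> a * bndc R"
    using bnd_g[OF assms(4,5)] assms(2) by (auto intro: mult_left_mono)
  then show ?thesis using norm_triangle_ineq4[of x "a *\<^sub>R g x"] True step_small(1)[OF assms(1-3)] assms(1)
    by linarith
next
  case False
  define r where "r = x \<bullet> x"
  have r: "9 / 4 < r"
    using False power_strict_mono[of "3/2" "norm x" 2] by (simp add: r_def dot_square_norm power2_eq_square)
  have "x \<bullet> g x \<ge> (2 * r - 1) * r - m2 x - (3 * r + 1) / 10000 * r"
    using inner_g[OF assms(4)] unfolding r_def by linarith
  moreover have "m2 x \<le> r" using m2_le r_def by simp
  moreover have "(2 * r - 1) * r - r - (3 * r + 1) / 10000 * r = (2 * r - 2 - (3 * r + 1) / 10000) * r"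
    by (simp add: algebra_simps)
  moreover have "1 * 1 \<le> (2 * r - 2 - (3 * r + 1) / 10000) * r"
    using r by (intro mult_mono) (auto simp: field_simps)
  ultimately have "1 \<le> x \<bullet> g x" by linarith
  then have "a * 1 \<le> a * (x \<bullet> g x)" using assms(2) by (rule mult_left_mono)
  then have "(x - a *\<^sub>R g x) \<bullet> (x - a *\<^sub>R g x) \<le> x \<bullet> x"
    using quad_small[OF assms(4,5,2,3)] assms(2) unfolding inner_step by simp
  then have "norm (x - a *\<^sub>R g x) \<le> norm x" by (simp add: norm_le)
  with assms(5) show ?thesis by linarith
qed

text \<open>The usual descent estimate for a Lipschitz gradient. Both ends of the step lie in the
  ball, hence so does the segment between them, and \<open>lipc R\<close> applies along it.\<close>

lemma descent:
  assumes "2 \<le> R" "0 \<le> a" "a * (bndc R)\<^sup>2 \<le> 1 / 1000" "x \<in> V" "norm x \<le> R"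
  shows "F (x - a *\<^sub>R g x) \<le> F x - a / 2 * (norm (g x))\<^sup>2"
proof -
  define v where "v = - a *\<^sub>R g x"
  have vV: "v \<in> V" unfolding v_def using gV[OF assms(4)] subV by (intro subspace_scale)
  obtain s where s: "0 < s" "s < 1" "F (x + 1 *\<^sub>R v) - F (x + 0 *\<^sub>R v) = (1 - 0) * (g (x + s *\<^sub>R v) \<bullet> v)"
    using MVT2[of 0 1 "\<lambda>t. F (x + t *\<^sub>R v)" "\<lambda>t. g (x + t *\<^sub>R v) \<bullet> v"] deriv_F[OF assms(4) vV] by auto
  have xv: "norm (x + v) \<le> R" using ball_invariant[OF assms] by (simp add: v_def)
  have "x + s *\<^sub>R v = (1 - s) *\<^sub>R x + s *\<^sub>R (x + v)" by (simp add: algebra_simps)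
  then have "norm (x + s *\<^sub>R v) \<le> (1 - s) * norm x + s * norm (x + v)"
    using norm_triangle_ineq[of "(1 - s) *\<^sub>R x" "s *\<^sub>R (x + v)"] s by simp
  also have "\<dots> \<le> (1 - s) * R + s * R"
    using xv assms(5) s by (intro add_mono mult_left_mono) auto
  finally have xs: "norm (x + s *\<^sub>R v) \<le> R" by (simp add: algebra_simps)
  have xsV: "x + s *\<^sub>R v \<in> V" using assms(4) vV subV by (intro subspace_add subspace_scale)
  have nv: "norm v = a * norm (g x)" using assms(2) by (simp add: v_def)
  have "norm (g (x + s *\<^sub>R v) - g x) \<le> lipc R * norm (s *\<^sub>R v)"
    using lip_g[OF xsV assms(4) xs assms(5)] by simp
  also have "\<dots> \<le> lipc R * norm v"
    using s by (intro mult_left_mono) (auto simp: lipc_def mult_left_le_one_le)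
  finally have "norm (g (x + s *\<^sub>R v) - g x) \<le> (a * lipc R) * norm (g x)" by (simp add: nv algebra_simps)
  also have "\<dots> \<le> 1 / 2 * norm (g x)"
    using step_small(2)[OF assms(1-3)] by (intro mult_right_mono) auto
  finally have "norm (g (x + s *\<^sub>R v) - g x) * norm v \<le> (1 / 2 * norm (g x)) * norm v"
    by (rule mult_right_mono) auto
  then have "(g (x + s *\<^sub>R v) - g x) \<bullet> v \<le> a / 2 * (norm (g x))\<^sup>2"
    using norm_cauchy_schwarz[of "g (x + s *\<^sub>R v) - g x" v] by (simp add: nv power2_eq_square algebra_simps)
  moreover have "g x \<bullet> v = - a * (norm (g x))\<^sup>2" by (simp add: v_def power2_norm_eq_inner)
  ultimately have "g (x + s *\<^sub>R v) \<bullet> v \<le> - (a / 2) * (norm (g x))\<^sup>2" by (simp add: inner_diff_left)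
  then show ?thesis using s(3) by (simp add: v_def)
qed

end

section \<open>Convergence to the circle of minimisers\<close>

context orthonormal_pair
begin

text \<open>The squared distance to the circle spanned by \<^term>\<open>e\<close> and \<^term>\<open>e'\<close>.\<close>

definition cdist2 :: "'a \<Rightarrow> real" where "cdist2 x = x \<bullet> x + 1 - 2 * sqrt (m2 x)"

lemma cdist2_alt: "cdist2 x = w2 x + (sqrt (m2 x) - 1)\<^sup>2"
  using m2_nonneg[of x] by (simp add: cdist2_def w2_def power2_diff)

lemma cdist2_nonneg: "0 \<le> cdist2 x"
  by (simp add: cdist2_alt w2_nonneg)

lemma cdist2_le:
  assumes "c\<^sup>2 + s\<^sup>2 = 1"
  shows "cdist2 x \<le> (x - (c *\<^sub>R e + s *\<^sub>R e')) \<bullet> (x - (c *\<^sub>R e + s *\<^sub>R e'))"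
proof -
  have "(x - (c *\<^sub>R e + s *\<^sub>R e')) \<bullet> (x - (c *\<^sub>R e + s *\<^sub>R e'))
     = x \<bullet> x - 2 * (c * (x \<bullet> e) + s * (x \<bullet> e')) + (c\<^sup>2 + s\<^sup>2)"
    by (simp add: inner_simps e1 e'1 ee' e'e inner_commute power2_eq_square algebra_simps)
  moreover have "c * (x \<bullet> e) + s * (x \<bullet> e') \<le> sqrt (m2 x)"
  proof (rule real_le_rsqrt)
    \<comment> \<open>Lagrange's identity, which gives Cauchy-Schwarz in the plane against the unit
      vector (c, s).\<close>
    have "(c * (x \<bullet> e) + s * (x \<bullet> e'))\<^sup>2 + (c * (x \<bullet> e') - s * (x \<bullet> e))\<^sup>2 = (c\<^sup>2 + s\<^sup>2) * m2 x"
      by (simp add: m2_def power2_eq_square algebra_simps)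
    moreover have "0 \<le> (c * (x \<bullet> e') - s * (x \<bullet> e))\<^sup>2" by simp
    ultimately show "(c * (x \<bullet> e) + s * (x \<bullet> e'))\<^sup>2 \<le> m2 x" unfolding assms by linarith
  qed
  ultimately show ?thesis using assms by (simp add: cdist2_def)
qed

lemma cdist2_attained:
  assumes "0 < m2 x"
  obtains c s where "c\<^sup>2 + s\<^sup>2 = 1" "x \<bullet> e = sqrt (m2 x) * c" "x \<bullet> e' = sqrt (m2 x) * s"
    "(x - (c *\<^sub>R e + s *\<^sub>R e')) \<bullet> (x - (c *\<^sub>R e + s *\<^sub>R e')) = cdist2 x"
proof -
  define n where "n = sqrt (m2 x)"
  have n: "0 < n" "n\<^sup>2 = m2 x" using assms by (auto simp: n_def)
  define c s where "c = (x \<bullet> e) / n" and "s = (x \<bullet> e') / n"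
  have pq: "x \<bullet> e = n * c" "x \<bullet> e' = n * s" using n by (auto simp: c_def s_def)
  have cs: "c\<^sup>2 + s\<^sup>2 = 1"
    unfolding c_def s_def power_divide add_divide_distrib[symmetric] m2_def[symmetric] n(2)[symmetric]
    using n(1) by simp
  have "(x - (c *\<^sub>R e + s *\<^sub>R e')) \<bullet> (x - (c *\<^sub>R e + s *\<^sub>R e'))
     = x \<bullet> x - 2 * n * (c\<^sup>2 + s\<^sup>2) + (c\<^sup>2 + s\<^sup>2)"
    using pq by (simp add: inner_simps e1 e'1 ee' e'e inner_commute power2_eq_square algebra_simps)
  then show thesis using that[of c s] cs pq by (simp add: n_def cdist2_def)
qed

text \<open>\<open>g0\<close> multiplies the component in the complex line of the signal by 2|x|^2 -
  2 and the orthogonal component by 2|x|^2 - 1, so the two squares add without a cross term.\<close>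

lemma inner_g0_g0: "g0 x \<bullet> g0 x = (2 * (x \<bullet> x) - 2)\<^sup>2 * m2 x + (2 * (x \<bullet> x) - 1)\<^sup>2 * w2 x"
proof -
  define a where "a = 2 * (x \<bullet> x) - 1"
  have "g0 x \<bullet> g0 x = a\<^sup>2 * (x \<bullet> x) - 2 * a * (x \<bullet> pl x) + pl x \<bullet> pl x"
    unfolding g0_def a_def[symmetric] by (simp add: inner_simps inner_commute power2_eq_square algebra_simps)
  also have "x \<bullet> pl x = m2 x" using inner_pl(1)[of x x] m2_pl by simp
  also have "pl x \<bullet> pl x = m2 x" by (simp add: m2_pl)
  finally show ?thesis unfolding w2_def a_def by (simp add: power2_eq_square algebra_simps)
qed

end

context perturbed_landscape
begin

text \<open>\<open>F0\<close> takes the value 3/8 at its saddles; the threshold below is 3/8 - 1/2000.\<close>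

lemma small_gradient_near_circle:
  assumes x: "x \<in> V" and F: "F x < 749 / 2000" and g: "norm (g x) \<le> 1 / 2000"
  shows "cdist2 x \<le> 1 / 400"
proof -
  define r m w where "r = x \<bullet> x" and "m = m2 x" and "w = w2 x"
  have rmw: "r = m + w" "0 \<le> m" "0 \<le> w" "0 \<le> r"
    using m2_nonneg[of x] w2_nonneg[of x] by (auto simp: r_def m_def w_def w2_def)
  have F0: "r\<^sup>2 - r + 1 - m \<le> 749 / 1000 + (r + 1)\<^sup>2 / 20000"
    using pert_F[OF x] F unfolding F0_def abs_le_iff r_def[symmetric] m_def[symmetric]
    by (simp add: field_simps)
  have r2: "r \<le> 2"
  proof -
    have "0 \<le> (r - 2)\<^sup>2" by simp
    then have "4 * r - 4 \<le> r * r" by (simp add: power2_eq_square algebra_simps)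
    moreover have "r * r - 2 * r + 1 \<le> 749 / 1000 + (r * r + 2 * r + 1) / 20000"
      using F0 rmw by (simp add: power2_eq_square algebra_simps)
    ultimately show ?thesis by (simp add: field_simps)
  qed
  \<comment> \<open>Here the gap below the saddle value pays off: r^2 - r >= -1/4 leaves 1/1000 for
    m, from which the perturbation takes at most 9/20000. This excludes the origin and the
    saddles.\<close>
  have m: "55 / 100000 \<le> m"
  proof -
    have "(r + 1)\<^sup>2 \<le> 3\<^sup>2" using r2 rmw(4) by (intro power_mono) auto
    moreover have "0 \<le> (r - 1/2)\<^sup>2" by simp
    then have "r - 1 / 4 \<le> r\<^sup>2" by (simp add: power2_eq_square algebra_simps)
    ultimately show ?thesis using F0 by simp
  qed
  have "(norm x)\<^sup>2 \<le> (3 / 2)\<^sup>2"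
    using r2 unfolding power2_norm_eq_inner r_def[symmetric] by (simp add: power_divide)
  then have nx: "norm x \<le> 3 / 2" by (rule power2_le_imp_le) simp
  have "(3 * r + 1) / 10000 * norm x \<le> 7 / 10000 * (3 / 2)"
    using r2 rmw(4) nx by (intro mult_mono) auto
  then have "norm (g0 x) \<le> 16 / 10000"
    using pert_g_norm[OF x] g norm_triangle_sub[of "g0 x" "g x"] norm_minus_commute[of "g x" "g0 x"]
    unfolding r_def[symmetric] by linarith
  then have "(norm (g0 x))\<^sup>2 \<le> (16 / 10000)\<^sup>2" by (intro power_mono) auto
  then have G: "(2 * r - 2)\<^sup>2 * m + (2 * r - 1)\<^sup>2 * w \<le> 256 / 100000000"
    unfolding power2_norm_eq_inner inner_g0_g0 r_def[symmetric] m_def[symmetric] w_def[symmetric]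
    by (simp add: power_divide)
  \<comment> \<open>With m bounded below, a tiny gradient forces r close to 1; then 2 r - 1 is close
    to 1 too, and the remaining summand makes w tiny.\<close>
  have "(2 * r - 2)\<^sup>2 * (55 / 100000) \<le> (2 * r - 2)\<^sup>2 * m" using m by (intro mult_left_mono) auto
  moreover have "0 \<le> (2 * r - 1)\<^sup>2 * w" using rmw by simp
  ultimately have "(2 * r - 2)\<^sup>2 \<le> 256 / 55000" using G by simp
  then have "\<bar>2 * r - 2\<bar>\<^sup>2 \<le> (7 / 100)\<^sup>2" by (simp add: power2_eq_square)
  then have "\<bar>2 * r - 2\<bar> \<le> 7 / 100" by (rule power2_le_imp_le) auto
  then have rr: "965 / 1000 \<le> r" "r \<le> 1035 / 1000" unfolding abs_le_iff by linarith+
  have "(93 / 100)\<^sup>2 \<le> (2 * r - 1)\<^sup>2" using rr by (intro power_mono) auto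
  then have "(93 / 100)\<^sup>2 * w \<le> (2 * r - 1)\<^sup>2 * w" using rmw by (intro mult_right_mono) auto
  moreover have "0 \<le> (2 * r - 2)\<^sup>2 * m" using rmw by simp
  ultimately have "(93 / 100)\<^sup>2 * w \<le> 256 / 100000000" using G by linarith
  then have w: "w \<le> 1 / 100000" by (simp add: power2_eq_square)
  have "\<bar>sqrt m - 1\<bar> \<le> \<bar>m - 1\<bar>"
  proof -
    have eq: "m - 1 = (sqrt m - 1) * (sqrt m + 1)" using rmw(2) by (simp add: algebra_simps)
    have "\<bar>sqrt m - 1\<bar> * 1 \<le> \<bar>sqrt m - 1\<bar> * (sqrt m + 1)" using rmw(2) by (intro mult_left_mono) auto
    then show ?thesis unfolding eq abs_mult using rmw(2) by simp
  qed
  also have "\<dots> \<le> 4 / 100" using rmw w rr by linarith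
  finally have "(sqrt m - 1)\<^sup>2 \<le> (4 / 100)\<^sup>2" by (metis abs_ge_zero power2_abs power_mono)
  then show "cdist2 x \<le> 1 / 400"
    using w unfolding cdist2_alt m_def w_def by (simp add: power2_eq_square)
qed

text \<open>At the nearest point of the circle both \<open>g\<close> and \<open>g0\<close> vanish,
  so the perturbation at x is at most a small multiple of the distance to the circle. The inner
  product of \<open>g0\<close> with the displacement is at least 7/10 of the squared distance, which
  leaves room for this error and for the quadratic term of the step.\<close>

lemma circle_contraction:
  assumes x: "x \<in> V" and D: "cdist2 x \<le> 1 / 400" and a: "0 \<le> a" "a \<le> 1 / 10000"
  shows "cdist2 (x - a *\<^sub>R g x) \<le> (1 - a) * cdist2 x" "norm (g x) \<le> 25 * sqrt (cdist2 x)"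
proof -
  define n w where "n = sqrt (m2 x)" and "w = w2 x"
  have n0: "0 \<le> n" "n\<^sup>2 = m2 x" using m2_nonneg by (auto simp: n_def)
  have w0: "0 \<le> w" by (simp add: w_def w2_nonneg)
  have r: "x \<bullet> x = w + n\<^sup>2" by (simp add: w_def w2_def n0)
  have Deq: "cdist2 x = w + (n - 1)\<^sup>2" by (simp add: cdist2_alt n_def w_def)
  have w1: "w \<le> 1 / 400" using D zero_le_power2[of "n - 1"] unfolding Deq by linarith
  have "\<bar>n - 1\<bar>\<^sup>2 \<le> (1 / 20)\<^sup>2" using D w0 unfolding Deq by (simp add: power2_eq_square)
  then have n_near: "\<bar>n - 1\<bar> \<le> 1 / 20" by (rule power2_le_imp_le) auto
  then have n1: "95 / 100 \<le> n" "n \<le> 105 / 100" unfolding abs_le_iff by linarith+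
  have "0 < n\<^sup>2" using n1 by simp
  then have "0 < m2 x" using n0 by simp
  then obtain c s where cs: "c\<^sup>2 + s\<^sup>2 = 1" "x \<bullet> e = n * c" "x \<bullet> e' = n * s"
    and d2: "(x - (c *\<^sub>R e + s *\<^sub>R e')) \<bullet> (x - (c *\<^sub>R e + s *\<^sub>R e')) = cdist2 x"
    using cdist2_attained unfolding n_def by blast
  define z where "z = c *\<^sub>R e + s *\<^sub>R e'"
  define d where "d = x - z"
  have nd: "norm d = sqrt (cdist2 x)" using d2 by (simp add: d_def z_def norm_eq_sqrt_inner)
  have zV: "z \<in> V" unfolding z_def using subV eV by (intro subspace_add subspace_scale)
  have zz: "z \<bullet> z = 1" unfolding z_def
    using cs(1) by (simp add: inner_simps e1 e'1 ee' e'e power2_eq_square)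
  have plz: "pl z = z" unfolding z_def pl_def by (simp add: inner_simps e1 e'1 ee' e'e)
  have g0z: "g0 z = 0" by (simp add: g0_def zz plz)
  have gz: "g z = 0" unfolding z_def by (rule circle(2)[OF cs(1)])
  have nn: "n\<^sup>2 \<le> (105 / 100)\<^sup>2" "(95 / 100)\<^sup>2 \<le> n\<^sup>2" 
    using power_mono[of n "105 / 100" 2] power_mono[of "95 / 100" n 2] n0(1) n1 by auto
  have "(norm x)\<^sup>2 \<le> (11 / 10)\<^sup>2"
    using nn w1 unfolding power2_norm_eq_inner r by (simp add: power_divide)
  then have nx: "norm x \<le> 11 / 10" by (rule power2_le_imp_le) simp
  have nz: "norm z \<le> 11 / 10" using zz by (simp add: norm_eq_sqrt_inner)
  show ng: "norm (g x) \<le> 25 * sqrt (cdist2 x)"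
  proof -
    have "norm (g x) \<le> lipc (11 / 10) * norm d"
      using lip_g[OF x zV nx nz] by (simp add: gz d_def)
    also have "\<dots> \<le> 25 * norm d" by (intro mult_right_mono) (auto simp: lipc_def power2_eq_square)
    finally show ?thesis by (simp add: nd)
  qed
  have herr: "norm (g x - g0 x) \<le> 5 / 10000 * norm d"
  proof -
    have "norm (g x - g0 x) \<le> (3 * (11 / 10)\<^sup>2 + 1) / 10000 * norm d"
      using pert_g[OF x zV nx nz] by (simp add: gz g0z d_def)
    also have "\<dots> \<le> 5 / 10000 * norm d" by (intro mult_right_mono) (auto simp: power2_eq_square)
    finally show ?thesis .
  qed
  have "\<bar>d \<bullet> (g x - g0 x)\<bar> \<le> norm d * (5 / 10000 * norm d)"
    using Cauchy_Schwarz_ineq2[of d "g x - g0 x"] mult_left_mono[OF herr norm_ge_zero[of d]] by linarith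
  also have "\<dots> = 5 / 10000 * cdist2 x"
    using cdist2_nonneg[of x] by (simp add: nd)
  finally have err: "\<bar>d \<bullet> (g x - g0 x)\<bar> \<le> 5 / 10000 * cdist2 x" .
  have ex: "e \<bullet> x = n * c" "e' \<bullet> x = n * s" using cs(2,3) by (simp_all add: inner_commute)
  have "d \<bullet> g0 x = (2 * (x \<bullet> x) - 1) * (x \<bullet> x - n * (c\<^sup>2 + s\<^sup>2)) - (n\<^sup>2 - n) * (c\<^sup>2 + s\<^sup>2)"
    by (simp add: d_def z_def g0_def pl_def inner_simps cs(2,3) ex e1 e'1 ee' e'e
        power2_eq_square algebra_simps)
  \<comment> \<open>The summands belong to the displacement out of the complex line (w) and to the
    radial one inside it; near the circle each coefficient is at least 7/10.\<close>
  then have dg0: "d \<bullet> g0 x = w * (2 * (w + n\<^sup>2) - 1 + 2 * (n * (n - 1))) + 2 * (n * (n + 1)) * (n - 1)\<^sup>2"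
    unfolding cs(1) r by (simp add: power2_eq_square algebra_simps)
  have "\<bar>n * (n - 1)\<bar> \<le> 105 / 100 * (1 / 20)"
    unfolding abs_mult using n0(1) n1 n_near by (intro mult_mono) auto
  then have "7 / 10 \<le> 2 * (w + n\<^sup>2) - 1 + 2 * (n * (n - 1))"
    using nn w0 by (simp add: power2_eq_square)
  then have t1: "w * (7 / 10) \<le> w * (2 * (w + n\<^sup>2) - 1 + 2 * (n * (n - 1)))"
    using w0 by (rule mult_left_mono)
  have "95 / 100 * (195 / 100) \<le> n * (n + 1)" using n1 by (intro mult_mono) auto
  then have t2: "7 / 10 * (n - 1)\<^sup>2 \<le> 2 * (n * (n + 1)) * (n - 1)\<^sup>2"
    by (intro mult_right_mono) auto
  have "7 / 10 * cdist2 x \<le> d \<bullet> g0 x" using t1 t2 unfolding dg0 Deq by simp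
  then have dg: "69 / 100 * cdist2 x \<le> d \<bullet> g x"
    using err cdist2_nonneg[of x] unfolding inner_diff_right by linarith
  have "a * a \<le> a * (1 / 10000)" using a by (intro mult_left_mono) auto
  moreover have "(norm (g x))\<^sup>2 \<le> 625 * cdist2 x"
    using power_mono[OF ng, of 2] cdist2_nonneg[of x] by (simp add: power_mult_distrib)
  ultimately have gg: "(a * a) * (norm (g x))\<^sup>2 \<le> (a * (1 / 10000)) * (625 * cdist2 x)"
    using a by (intro mult_mono) auto
  have ad: "a * (69 / 100 * cdist2 x) \<le> a * (d \<bullet> g x)" using dg a by (intro mult_left_mono) auto
  have aD: "0 \<le> a * cdist2 x" using a cdist2_nonneg by simp
  have "cdist2 (x - a *\<^sub>R g x) \<le> (d - a *\<^sub>R g x) \<bullet> (d - a *\<^sub>R g x)"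
    using cdist2_le[OF cs(1), of "x - a *\<^sub>R g x"] by (simp add: d_def z_def algebra_simps)
  also have "\<dots> = cdist2 x - 2 * (a * (d \<bullet> g x)) + (a * a) * (norm (g x))\<^sup>2"
    unfolding power2_norm_eq_inner d2[folded z_def d_def, symmetric]
    by (simp add: inner_simps inner_commute algebra_simps)
  also have "\<dots> \<le> (1 - a) * cdist2 x" using gg ad aD by (simp add: algebra_simps)
  finally show "cdist2 (x - a *\<^sub>R g x) \<le> (1 - a) * cdist2 x" .
qed

text \<open>Contraction towards a circle does not by itself exclude drifting along it. But a step
  has length at most 25 times the step size times the distance, and the distance drops by at least
  half the step size times itself, so the path length telescopes into 50 times the initial distance.
  The path is therefore Cauchy.\<close>

lemma converges_near_circle:
  assumes x: "\<And>k. x k \<in> V" "\<And>k. x (Suc k) = x k - \<alpha> k *\<^sub>R g (x k)"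
    and \<alpha>: "\<And>k. 0 < \<alpha> k" "\<And>k. \<alpha> k \<le> 1 / 10000" "\<not> summable \<alpha>"
    and near: "cdist2 (x 0) \<le> 1 / 400"
  shows "\<exists>z\<in>V. F z = 0 \<and> x \<longlonglongrightarrow> z"
proof -
  define u where "u k = sqrt (cdist2 (x k))" for k
  have u0: "0 \<le> u k" for k by (simp add: u_def cdist2_nonneg)
  have u2: "(u k)\<^sup>2 = cdist2 (x k)" for k by (simp add: u_def cdist2_nonneg)
  have D: "cdist2 (x k) \<le> 1 / 400" for k
  proof (induction k)
    case (Suc k)
    have "(1 - \<alpha> k) * cdist2 (x k) \<le> 1 * cdist2 (x k)"
      using \<alpha>(1)[of k] cdist2_nonneg by (intro mult_right_mono) auto
    then show ?case using circle_contraction(1)[OF x(1)[of k] Suc, of "\<alpha> k"] \<alpha>(1,2)[of k] Suc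
      by (simp add: x(2))
  qed (rule near)
  have uS: "u (Suc k) \<le> u k - \<alpha> k / 2 * u k" for k
  proof (rule power2_le_imp_le)
    have "1 - \<alpha> k \<le> (1 - \<alpha> k / 2)\<^sup>2" by (simp add: power2_eq_square algebra_simps)
    then have "(1 - \<alpha> k) * cdist2 (x k) \<le> (1 - \<alpha> k / 2)\<^sup>2 * cdist2 (x k)"
      using cdist2_nonneg by (intro mult_right_mono) auto
    also have "\<dots> = (u k - \<alpha> k / 2 * u k)\<^sup>2"
      unfolding u2[symmetric] by (simp add: power2_eq_square algebra_simps)
    finally show "(u (Suc k))\<^sup>2 \<le> (u k - \<alpha> k / 2 * u k)\<^sup>2"
      using circle_contraction(1)[OF x(1)[of k] D[of k], of "\<alpha> k"] \<alpha>(1,2)[of k] by (simp add: x(2) u2)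
    have "\<alpha> k / 2 * u k \<le> 1 * u k" using \<alpha>(2)[of k] u0 by (intro mult_right_mono) auto
    then show "0 \<le> u k - \<alpha> k / 2 * u k" by simp
  qed
  have "u (Suc k) \<le> u k" for k
    using uS[of k] mult_nonneg_nonneg[of "\<alpha> k / 2" "u k"] \<alpha>(1)[of k] u0[of k] by linarith
  then have udec: "k \<le> l \<Longrightarrow> u l \<le> u k" for k l by (rule lift_Suc_antimono_le)
  have small: "\<exists>k. u k < \<epsilon>" if "0 < \<epsilon>" for \<epsilon>
  proof (rule ccontr)
    assume "\<not> ?thesis"
    then have "\<epsilon> \<le> u k" for k by (simp add: not_less)
    then have "\<epsilon> / 2 * \<alpha> k \<le> \<alpha> k / 2 * u k" for k
      using mult_left_mono[of \<epsilon> "u k" "\<alpha> k / 2"] \<alpha>(1)[of k] by (simp add: mult.commute)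
    then have "u (Suc k) \<le> u k - \<epsilon> / 2 * \<alpha> k" for k using uS[of k] by (smt (verit))
    then show False
      using no_perpetual_drift[OF \<alpha>(1,3), of "\<epsilon> / 2" 0 u 0] that u0 by auto
  qed
  have step: "norm (x (Suc k) - x k) \<le> 50 * (u k - u (Suc k))" for k
  proof -
    have "norm (x (Suc k) - x k) = \<alpha> k * norm (g (x k))" using \<alpha>(1)[of k] by (simp add: x(2))
    also have "\<dots> \<le> \<alpha> k * (25 * u k)"
      using circle_contraction(2)[OF x(1)[of k] D[of k], of "\<alpha> k"] \<alpha>(1,2)[of k] unfolding u_def
      by (intro mult_left_mono) auto
    finally show ?thesis using uS[of k] by (simp add: algebra_simps)
  qed
  have dist: "norm (x (k + j) - x k) \<le> 50 * (u k - u (k + j))" for k j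
  proof (induction j)
    case (Suc j)
    then show ?case using step[of "k + j"] norm_triangle_ineq[of "x (k + Suc j) - x (k + j)" "x (k + j) - x k"]
      by simp
  qed simp
  have "Cauchy x"
    unfolding Cauchy_altdef2
  proof (intro allI impI)
    fix \<epsilon> :: real assume "0 < \<epsilon>"
    then obtain N where N: "u N < \<epsilon> / 50" using small[of "\<epsilon> / 50"] by auto
    show "\<exists>N. \<forall>n\<ge>N. dist (x n) (x N) < \<epsilon>"
    proof (intro exI allI impI)
      fix n assume "N \<le> n"
      then have "norm (x n - x N) \<le> 50 * (u N - u n)" using dist[of N "n - N"] by simp
      then show "dist (x n) (x N) < \<epsilon>" using N u0[of n] by (simp add: dist_norm)
    qed
  qed
  then obtain z where z: "z \<in> V" "x \<longlonglongrightarrow> z"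
    using complV x(1) unfolding complete_def by blast
  have "(\<lambda>k. cdist2 (x k)) \<longlonglongrightarrow> cdist2 z"
    unfolding cdist2_def m2_def by (intro tendsto_intros z(2))
  moreover have "(\<lambda>k. cdist2 (x k)) \<longlonglongrightarrow> 0"
  proof -
    have "u \<longlonglongrightarrow> 0"
    proof (rule LIMSEQ_I)
      fix \<epsilon> :: real assume "0 < \<epsilon>"
      then obtain N where "u N < \<epsilon>" using small by blast
      then show "\<exists>N. \<forall>n\<ge>N. norm (u n - 0) < \<epsilon>" using udec u0
        by (intro exI[of _ N]) (auto intro: le_less_trans)
    qed
    then have "(\<lambda>k. (u k)\<^sup>2) \<longlonglongrightarrow> 0\<^sup>2" by (rule tendsto_power)
    then show ?thesis by (simp add: u2)
  qed
  ultimately have "cdist2 z = 0" by (rule LIMSEQ_unique)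
  then have "w2 z = 0" "(sqrt (m2 z) - 1)\<^sup>2 = 0"
    using w2_nonneg[of z] zero_le_power2[of "sqrt (m2 z) - 1"] unfolding cdist2_alt by linarith+
  then have "ql z = 0" "m2 z = 1" by (auto simp: w2_ql)
  then have "z = (z \<bullet> e) *\<^sub>R e + (z \<bullet> e') *\<^sub>R e'" "(z \<bullet> e)\<^sup>2 + (z \<bullet> e')\<^sup>2 = 1"
    by (auto simp: ql_def pl_def m2_def)
  then have "F z = 0" using circle(1) by metis
  then show ?thesis using z by blast
qed

lemma grad_steps_ball:
  assumes "2 \<le> R" "\<And>k. 0 < \<alpha> k" "\<And>k. \<alpha> k * (bndc R)\<^sup>2 \<le> 1 / 1000" "x \<in> V" "norm x \<le> R"
  shows "norm (grad_steps g \<alpha> x k) \<le> R"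
proof (induction k)
  case (Suc k)
  then show ?case
    using ball_invariant[OF assms(1) _ assms(3) grad_steps_V[OF assms(4)] Suc] assms(2)[of k]
    by simp
qed (use assms in simp)

text \<open>The loss never rises again, and gradients bounded away from zero would push it below 0.
  So some later gradient is small, and a small gradient at low loss occurs only near the circle.
  Used in contrapositive form: a run without such a limit keeps its loss at or above the threshold
  forever.\<close>

lemma converges_from_low_value:
  assumes "2 \<le> R" "\<And>k. 0 < \<alpha> k" "\<And>k. \<alpha> k * (bndc R)\<^sup>2 \<le> 1 / 1000" "\<not> summable \<alpha>" "x \<in> V" "norm x \<le> R"
    and low: "F (grad_steps g \<alpha> x K) < 749 / 2000"
  shows "\<exists>z\<in>V. F z = 0 \<and> grad_steps g \<alpha> x \<longlonglongrightarrow> z"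
proof -
  define y where "y = grad_steps g \<alpha> x"
  have yV: "y k \<in> V" for k unfolding y_def by (rule grad_steps_V[OF assms(5)])
  have yS: "y (Suc k) = y k - \<alpha> k *\<^sub>R g (y k)" for k by (simp add: y_def)
  have yR: "norm (y k) \<le> R" for k unfolding y_def by (rule grad_steps_ball[OF assms(1-3,5,6)])
  have desc: "F (y (Suc k)) \<le> F (y k) - \<alpha> k / 2 * (norm (g (y k)))\<^sup>2" for k
    unfolding yS using descent[OF assms(1) _ assms(3) yV yR] assms(2)[of k] by simp
  have lowk: "F (y (K + k)) < 749 / 2000" for k
  proof (induction k)
    case (Suc k)
    have "0 \<le> \<alpha> (K + k) / 2 * (norm (g (y (K + k))))\<^sup>2" using assms(2)[of "K + k"] by simp
    then show ?case using desc[of "K + k"] Suc by simp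
  qed (use low in \<open>simp add: y_def\<close>)
  have "\<exists>k\<ge>K. norm (g (y k)) \<le> 1 / 2000"
  proof (rule ccontr)
    assume "\<not> ?thesis"
    then have big: "K \<le> k \<Longrightarrow> 1 / 2000 \<le> norm (g (y k))" for k by force
    have "F (y (Suc k)) \<le> F (y k) - (1 / 2000)\<^sup>2 / 2 * \<alpha> k" if "K \<le> k" for k
    proof -
      have "\<alpha> k / 2 * (1 / 2000)\<^sup>2 \<le> \<alpha> k / 2 * (norm (g (y k)))\<^sup>2"
        using big[OF that] assms(2)[of k] by (intro mult_left_mono power_mono) auto
      then show ?thesis using desc[of k] by (simp add: mult.commute)
    qed
    then show False
      using no_perpetual_drift[OF assms(2,4), of "(1 / 2000)\<^sup>2 / 2" K "\<lambda>k. F (y k)" 0] F_nonneg by simp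
  qed
  then obtain k where k: "K \<le> k" "norm (g (y k)) \<le> 1 / 2000" by blast
  have near: "cdist2 (y k) \<le> 1 / 400"
    using small_gradient_near_circle[OF yV _ k(2)] lowk[of "k - K"] k(1) by simp
  have "\<exists>z\<in>V. F z = 0 \<and> (\<lambda>j. y (j + k)) \<longlonglongrightarrow> z"
  proof (rule converges_near_circle[where \<alpha> = "\<lambda>j. \<alpha> (j + k)"])
    show "\<alpha> (j + k) \<le> 1 / 10000" for j
      using step_small(3)[OF assms(1) _ assms(3)[of "j + k"]] assms(2)[of "j + k"] by simp
    show "\<not> summable (\<lambda>j. \<alpha> (j + k))" using assms(4) by (simp add: summable_iff_shift)
  qed (use yV yS assms(2) near in auto)
  then show ?thesis using LIMSEQ_offset[of y k] unfolding y_def by blast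
qed

section \<open>Runs of persistently high loss\<close>

lemma high_value_m2:
  assumes x: "x \<in> V" and "749 / 2000 \<le> F x"
  shows "m2 x \<le> (x \<bullet> x - 1 / 2)\<^sup>2 + 1 / 1000 + (x \<bullet> x + 1)\<^sup>2 / 20000"
proof -
  \<comment> \<open>Twice \<open>F0\<close> is (r - 1/2)^2 + 3/4 - m2 with r = |x|^2, so a value
    near or above 3/8 confines \<open>m2\<close> to (r - 1/2)^2 plus the slack.\<close>
  have "749 / 1000 \<le> (x \<bullet> x)\<^sup>2 - x \<bullet> x + 1 - m2 x + (x \<bullet> x + 1)\<^sup>2 / 20000"
    using pert_F[OF x] assms(2) unfolding F0_def abs_le_iff by (simp add: field_simps)
  then show ?thesis by (simp add: power2_eq_square algebra_simps)
qed

text \<open>Inserting the bound on \<open>m2\<close> turns \<open>x \<bullet> g x\<close> into r^2 -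
  1/4 up to small errors, which is positive beyond r = 1/2. The proof replaces r^2 by its tangent at
  51/100 to obtain a linear inequality.\<close>

lemma radius_shrinks:
  assumes x: "x \<in> V" and F: "749 / 2000 \<le> F x" and r: "51 / 100 \<le> x \<bullet> x"
  shows "1 / 200 \<le> x \<bullet> g x"
proof -
  define r where "r = x \<bullet> x"
  have "0 \<le> (r - 51/100)\<^sup>2" by simp
  then have rr: "102 / 100 * r - 2601 / 10000 \<le> r * r" by (simp add: power2_eq_square algebra_simps)
  have "m2 x \<le> (r * r - r + 1 / 4) + 1 / 1000 + (r * r + 2 * r + 1) / 20000"
    using high_value_m2[OF x F] unfolding r_def[symmetric] by (simp add: power2_eq_square algebra_simps)
  moreover have "(2 * r * r - r) - m2 x - (3 * r * r + r) / 10000 \<le> x \<bullet> g x"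
    using inner_g[OF x] unfolding r_def[symmetric] abs_le_iff by (simp add: field_simps)
  ultimately show ?thesis using rr r unfolding r_def[symmetric] by (simp add: field_simps)
qed

lemma radius_grows:
  assumes x: "x \<in> V" and r: "x \<bullet> x \<le> 49 / 100"
  shows "x \<bullet> g x \<le> - (x \<bullet> x) / 100"
proof -
  define r where "r = x \<bullet> x"
  have r0: "0 \<le> r" by (simp add: r_def)
  have "x \<bullet> g x \<le> (2 * r - 1 + (3 * r + 1) / 10000) * r"
    using inner_g[OF x] m2_nonneg[of x] unfolding r_def[symmetric] abs_le_iff by (simp add: field_simps)
  also have "\<dots> \<le> (- 1 / 100) * r"
    using r r0 unfolding r_def[symmetric] by (intro mult_right_mono) (auto simp: field_simps)
  finally show ?thesis by (simp add: r_def)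
qed

text \<open>The squared radius is pulled to 1/2 from both sides, and then high loss makes
  \<open>m2\<close> small. From above the speed is at least 1/200. From below it is proportional to
  the squared radius, since the origin is stationary; this is why the initial norm is kept above
  1/R. Both phases fit into time 200 R^2.\<close>

lemma enters_saddle_region:
  assumes R: "2 \<le> R" and \<alpha>: "\<And>k. 0 < \<alpha> k" "\<And>k. \<alpha> k * (bndc R)\<^sup>2 \<le> 1 / 1000"
    and x: "x \<in> V" "norm x \<le> R" "1 / R \<le> norm x"
    and high: "\<And>k. 749 / 2000 \<le> F (grad_steps g \<alpha> x k)"
    and late: "200 * R\<^sup>2 \<le> sum \<alpha> {..<k}"
  defines "y \<equiv> grad_steps g \<alpha> x k"
  shows "y \<bullet> y \<le> 52 / 100" "m2 y \<le> 16 / 10000"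
proof -
  define z where "z = grad_steps g \<alpha> x"
  define r where "r k = z k \<bullet> z k" for k
  have zV: "z k \<in> V" for k unfolding z_def by (rule grad_steps_V[OF x(1)])
  have zS: "z (Suc k) = z k - \<alpha> k *\<^sub>R g (z k)" for k by (simp add: z_def)
  have zR: "norm (z k) \<le> R" for k unfolding z_def by (rule grad_steps_ball[OF R \<alpha> x(1,2)])
  have zF: "749 / 2000 \<le> F (z k)" for k unfolding z_def by (rule high)
  have R2: "4 \<le> R\<^sup>2" using power_mono[OF R, of 2] by simp
  have rS: "r (Suc k) = r k - 2 * (\<alpha> k * (z k \<bullet> g (z k))) + (\<alpha> k)\<^sup>2 * (norm (g (z k)))\<^sup>2" for k
    unfolding r_def zS inner_step by simp
  have q: "(\<alpha> k)\<^sup>2 * (norm (g (z k)))\<^sup>2 \<le> \<alpha> k * (1 / 1000)" for k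
    using quad_small[OF zV zR _ \<alpha>(2)] \<alpha>(1)[of k] by simp
  have \<alpha>s: "\<alpha> k \<le> 1 / 10000000" for k using step_small(3)[OF R _ \<alpha>(2)] \<alpha>(1)[of k] by simp
  have change: "\<bar>\<alpha> k * (z k \<bullet> g (z k))\<bar> \<le> 1 / 1000" for k
  proof -
    have "\<bar>z k \<bullet> g (z k)\<bar> \<le> norm (z k) * norm (g (z k))" by (rule Cauchy_Schwarz_ineq2)
    also have "\<dots> \<le> R * bndc R" using zR bnd_g[OF zV zR] R by (intro mult_mono) auto
    finally have "\<alpha> k * \<bar>z k \<bullet> g (z k)\<bar> \<le> \<alpha> k * (R * bndc R)" using \<alpha>(1)[of k] by (intro mult_left_mono) auto
    moreover have "\<alpha> k * (R * bndc R) \<le> 1 / 1000" using step_small(4)[OF R _ \<alpha>(2)] \<alpha>(1)[of k] by simp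
    ultimately have "\<alpha> k * \<bar>z k \<bullet> g (z k)\<bar> \<le> 1 / 1000" by linarith
    then show ?thesis using \<alpha>(1)[of k] by (simp add: abs_mult)
  qed
  have up: "r k - 1 / 2 \<le> 2 / 100"
  proof (rule drift_into[where \<alpha> = \<alpha> and \<mu> = "1 / 200" and M = "R\<^sup>2" and c = "1 / 100"])
    show "r 0 - 1 / 2 \<le> R\<^sup>2"
      using power_mono[OF zR[of 0], of 2] by (simp add: r_def power2_norm_eq_inner)
    show "r (Suc k) - 1 / 2 \<le> r k - 1 / 2 - 1 / 200 * \<alpha> k" if "1 / 100 \<le> r k - 1 / 2" for k
    proof -
      have "1 / 200 \<le> z k \<bullet> g (z k)" using radius_shrinks[OF zV zF] that unfolding r_def by simp
      then have "\<alpha> k * (1 / 200) \<le> \<alpha> k * (z k \<bullet> g (z k))" using \<alpha>(1)[of k] by (intro mult_left_mono) auto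
      then show ?thesis using q[of k] \<alpha>(1)[of k] unfolding rS by linarith
    qed
    show "r (Suc k) - 1 / 2 \<le> 2 / 100" if "r k - 1 / 2 < 1 / 100" for k
      using change[of k] q[of k] \<alpha>s[of k] that unfolding rS by simp
    show "(R\<^sup>2 - 2 / 100) / (1 / 200) \<le> sum \<alpha> {..<k}" using late by simp
  qed (use \<alpha>(1) in auto)
  have grow: "r k + \<alpha> k * (r k / 50) \<le> r (Suc k)" if "r k \<le> 49 / 100" for k
  proof -
    have "z k \<bullet> g (z k) \<le> - (r k) / 100" using radius_grows[OF zV] that unfolding r_def by simp
    then have "\<alpha> k * (z k \<bullet> g (z k)) \<le> \<alpha> k * (- (r k) / 100)" using \<alpha>(1)[of k] by (intro mult_left_mono) auto
    moreover have "0 \<le> (\<alpha> k)\<^sup>2 * (norm (g (z k)))\<^sup>2" by simp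
    moreover have "\<alpha> k * (- (r k) / 100) = - (\<alpha> k * r k / 100)" "\<alpha> k * (r k / 50) = \<alpha> k * r k / 50" by auto
    ultimately show ?thesis unfolding rS by linarith
  qed
  have jump: "r k - 2 / 1000 \<le> r (Suc k)" for k
  proof -
    have "0 \<le> (\<alpha> k)\<^sup>2 * (norm (g (z k)))\<^sup>2" by simp
    then show ?thesis using change[of k] unfolding rS by linarith
  qed
  \<comment> \<open>Up to 49/100 the squared radius grows, and above it one step loses at most
    2/1000, so it never falls below its initial lower bound. That bound becomes the growth rate in
    \<open>low\<close>.\<close>
  have rlow: "1 / R\<^sup>2 \<le> r k" for k
  proof (induction k)
    case 0
    have "(1 / R)\<^sup>2 \<le> (norm x)\<^sup>2" using x(3) R by (intro power_mono) auto
    then show ?case by (simp add: r_def z_def power2_norm_eq_inner power_divide)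
  next
    case (Suc k)
    have "1 / R\<^sup>2 \<le> 1 / 4" using R2 by (simp add: divide_simps)
    moreover have "0 \<le> \<alpha> k * (r k / 50)" using \<alpha>(1)[of k] by (simp add: r_def)
    ultimately show ?case using Suc grow[of k] jump[of k] by (cases "r k \<le> 49 / 100") auto
  qed
  have low: "1 / 2 - r k \<le> 2 / 100"
  proof (rule drift_into[where \<alpha> = \<alpha> and \<mu> = "1 / (50 * R\<^sup>2)" and M = "1 / 2" and c = "1 / 100"])
    show "1 / 2 - r (Suc k) \<le> 1 / 2 - r k - 1 / (50 * R\<^sup>2) * \<alpha> k" if "1 / 100 \<le> 1 / 2 - r k" for k
    proof -
      have "\<alpha> k / 50 * (1 / R\<^sup>2) \<le> \<alpha> k / 50 * r k"
        using rlow[of k] \<alpha>(1)[of k] by (intro mult_left_mono) auto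
      then show ?thesis using grow[of k] that by (simp add: field_simps)
    qed
    show "1 / 2 - r (Suc k) \<le> 2 / 100" if "1 / 2 - r k < 1 / 100" for k
      using jump[of k] that by simp
    have eq: "(1 / 2 - 2 / 100) / (1 / (50 * R\<^sup>2)) = 24 * R\<^sup>2" by simp
    show "(1 / 2 - 2 / 100) / (1 / (50 * R\<^sup>2)) \<le> sum \<alpha> {..<k}"
      unfolding eq using late R2 by linarith
  qed (use \<alpha>(1) R2 in \<open>auto simp: r_def\<close>)
  show "y \<bullet> y \<le> 52 / 100" using up by (simp add: y_def r_def z_def)
  have "m2 y \<le> (r k - 1 / 2)\<^sup>2 + 1 / 1000 + (r k + 1)\<^sup>2 / 20000"
    using high_value_m2[OF zV zF, of k] by (simp add: y_def r_def z_def)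
  moreover have "\<bar>r k - 1 / 2\<bar> \<le> 2 / 100" using up low unfolding abs_le_iff by linarith
  then have "\<bar>r k - 1 / 2\<bar>\<^sup>2 \<le> (2 / 100)\<^sup>2" by (rule power_mono) simp
  moreover have "(r k + 1)\<^sup>2 \<le> (152 / 100)\<^sup>2" using up by (intro power_mono) (auto simp: r_def add_nonneg_nonneg)
  ultimately show "m2 y \<le> 16 / 10000" by (simp add: power2_eq_square)
qed

end

section \<open>Expansion in the saddle region\<close>

definition separated :: "real \<Rightarrow> 'a::real_normed_vector set \<Rightarrow> bool" where
  "separated r P \<longleftrightarrow> (\<forall>x\<in>P. \<forall>y\<in>P. x \<noteq> y \<longrightarrow> r \<le> norm (x - y))"

lemma norm_le_of_inner_le:
  fixes x :: "'a::real_inner"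
  assumes "x \<bullet> x \<le> b * b" "0 \<le> b"
  shows "norm x \<le> b"
proof (rule power2_le_imp_le)
  show "(norm x)\<^sup>2 \<le> b\<^sup>2"
    using assms(1) unfolding power2_norm_eq_inner power2_eq_square[of b] .
qed (rule assms(2))

lemma inner_le_of_norm_le:
  fixes x :: "'a::real_inner"
  assumes "norm x \<le> b"
  shows "x \<bullet> x \<le> b * b"
  using power_mono[OF assms norm_ge_zero, of 2] unfolding power2_norm_eq_inner power2_eq_square[of b] .

context orthonormal_pair
begin

text \<open>The scalar coefficients at x and y are written as mean plus and minus half-difference,
  which expands differences of \<open>g0\<close> exactly. No linearisation error appears, so the
  points need not be close to each other.\<close>

lemma inner_g0_diff:
  fixes x y :: 'a
  defines "d \<equiv> x - y" and "\<Delta> \<equiv> x \<bullet> x - y \<bullet> y" and "\<mu> \<equiv> m2 x - m2 y" and "q \<equiv> x \<bullet> x + y \<bullet> y"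
  shows "pl d \<bullet> (g0 x - g0 y) = (q - 2) * m2 d + \<Delta> * \<mu>"
    and "ql d \<bullet> (g0 x - g0 y) = (q - 1) * w2 d + \<Delta> * (\<Delta> - \<mu>)"
proof -
  have comb: "(s + t) *\<^sub>R u - (s - t) *\<^sub>R v = s *\<^sub>R (u - v) + t *\<^sub>R (u + v)" for s t :: real and u v :: 'a
    by (simp add: algebra_simps)
  have "pl (g0 z) = (2 * (z \<bullet> z) - 1) *\<^sub>R pl z - 1 *\<^sub>R pl z" for z
    by (simp add: g0_def pl_simps pl_idem)
  then have "pl (g0 z) = (2 * (z \<bullet> z) - 2) *\<^sub>R pl z" for z
    unfolding scaleR_left_diff_distrib[symmetric] by simp
  then have pg: "pl (g0 x - g0 y) = (q - 2) *\<^sub>R pl d + \<Delta> *\<^sub>R pl (x + y)"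
    using comb[of "q - 2" \<Delta> "pl x" "pl y"] by (simp add: q_def \<Delta>_def d_def pl_simps)
  have "ql (pl z) = 0" for z by (simp add: ql_def pl_idem)
  then have "ql (g0 z) = (2 * (z \<bullet> z) - 1) *\<^sub>R ql z" for z
    by (simp add: g0_def ql_simps)
  then have qg: "ql (g0 x - g0 y) = (q - 1) *\<^sub>R ql d + \<Delta> *\<^sub>R ql (x + y)"
    using comb[of "q - 1" \<Delta> "ql x" "ql y"] by (simp add: q_def \<Delta>_def d_def ql_simps)
  have "pl d \<bullet> pl (x + y) = \<mu>"
    by (simp add: d_def \<mu>_def m2_pl pl_simps inner_simps inner_commute)
  moreover have "pl d \<bullet> (g0 x - g0 y) = pl d \<bullet> pl (g0 x - g0 y)" by (rule inner_pl(2))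
  ultimately show "pl d \<bullet> (g0 x - g0 y) = (q - 2) * m2 d + \<Delta> * \<mu>"
    unfolding pg by (simp add: inner_add_right m2_pl)
  have "ql d \<bullet> ql (x + y) = w2 x - w2 y"
    by (simp add: d_def w2_ql ql_simps inner_simps inner_commute)
  then have "ql d \<bullet> ql (x + y) = \<Delta> - \<mu>" by (simp add: \<Delta>_def \<mu>_def w2_def)
  moreover have "ql d \<bullet> (g0 x - g0 y) = ql d \<bullet> ql (g0 x - g0 y)" by (rule inner_ql(2))
  ultimately show "ql d \<bullet> (g0 x - g0 y) = (q - 1) * w2 d + \<Delta> * (\<Delta> - \<mu>)"
    unfolding qg by (simp add: inner_add_right w2_ql)
qed

end

context perturbed_landscape
begin

text \<open>The Hessian of \<open>F0\<close> on the range of \<^term>\<open>ql\<close> exceeds the one on the range of \<^term>\<open>pl\<close>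
  by at least 1 even away from the saddles, so the gap governs differences of arbitrary
  points of the region below, not only of nearby ones.\<close>

lemma cone_step:
  assumes xy: "x \<in> V" "y \<in> V" "x \<bullet> x \<le> 53 / 100" "y \<bullet> y \<le> 53 / 100" "m2 x \<le> 1 / 400" "m2 y \<le> 1 / 400"
    and a: "0 \<le> a" "a \<le> 1 / 1000000"
    and cone: "w2 (x - y) \<le> m2 (x - y)"
  defines "d' \<equiv> (x - a *\<^sub>R g x) - (y - a *\<^sub>R g y)"
  shows "w2 d' \<le> m2 d'" "(1 + a) * m2 (x - y) \<le> m2 d'"
proof -
  define d G H where "d = x - y" and "G = g x - g y" and "H = (g x - g0 x) - (g y - g0 y)"
  define U W u where "U = m2 d" and "W = w2 d" and "u = norm (pl d)"
  define \<Delta> \<mu> q where "\<Delta> = x \<bullet> x - y \<bullet> y" and "\<mu> = m2 x - m2 y" and "q = x \<bullet> x + y \<bullet> y"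
  have u: "0 \<le> u" "u * u = U" by (simp_all add: u_def U_def m2_pl dot_square_norm power2_eq_square)
  have WU: "0 \<le> W" "W \<le> U" using cone w2_nonneg by (auto simp: W_def U_def d_def)
  have U0: "0 \<le> U" using WU by linarith
  have "norm (ql d) \<le> u"
    using WU u by (intro norm_le_of_inner_le) (auto simp: W_def w2_ql)
  have "d \<bullet> d = U + W" by (simp add: U_def W_def w2_def)
  then have nd: "norm d \<le> 3 / 2 * u" using WU u by (intro norm_le_of_inner_le) (auto simp: algebra_simps)
  have nx: "norm x \<le> 73 / 100" "norm y \<le> 73 / 100"
    using xy(3,4) norm_le_of_inner_le[of x "73 / 100"] norm_le_of_inner_le[of y "73 / 100"] by simp_all
  have npx: "norm (pl x) \<le> 1 / 20" "norm (pl y) \<le> 1 / 20"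
    using xy(5,6) norm_le_of_inner_le[of "pl x" "1 / 20"] norm_le_of_inner_le[of "pl y" "1 / 20"]
    by (simp_all add: m2_pl)
  have \<mu>: "\<bar>\<mu>\<bar> \<le> u * (1 / 10)"
  proof -
    have "\<mu> = pl d \<bullet> pl (x + y)"
      by (simp add: d_def \<mu>_def m2_pl pl_simps inner_simps inner_commute)
    then have "\<bar>\<mu>\<bar> \<le> u * norm (pl (x + y))" using Cauchy_Schwarz_ineq2 by (simp add: u_def)
    also have "norm (pl (x + y)) \<le> 1 / 10"
      using npx norm_triangle_ineq[of "pl x" "pl y"] by (simp add: pl_simps)
    finally show ?thesis using u(1) by (simp add: mult_left_mono)
  qed
  have \<Delta>: "\<bar>\<Delta>\<bar> \<le> 219 / 100 * u"
  proof -
    have "\<Delta> = (x + y) \<bullet> d" by (simp add: d_def \<Delta>_def inner_simps inner_commute)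
    then have "\<bar>\<Delta>\<bar> \<le> norm (x + y) * norm d" using Cauchy_Schwarz_ineq2 by simp
    also have "\<dots> \<le> 146 / 100 * (3 / 2 * u)"
      using nd nx norm_triangle_ineq[of x y] by (intro mult_mono) auto
    finally show ?thesis by simp
  qed
  have "\<bar>\<Delta>\<bar> * \<bar>\<mu>\<bar> \<le> (219 / 100 * u) * (u * (1 / 10))"
    using \<mu> \<Delta> u(1) by (intro mult_mono) auto
  then have \<Delta>\<mu>: "\<bar>\<Delta> * \<mu>\<bar> \<le> 219 / 1000 * U" unfolding u(2)[symmetric] abs_mult by simp
  have "\<bar>\<mu>\<bar> * \<bar>\<mu>\<bar> \<le> (u * (1 / 10)) * (u * (1 / 10))" using \<mu> by (intro mult_mono) auto
  then have \<mu>\<mu>: "\<mu> * \<mu> \<le> U / 100" unfolding u(2)[symmetric] by simp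
  \<comment> \<open>\<Delta> itself is not small, but its square enters with the favourable sign.
    Completing the square leaves \<mu>^2 / 4, and \<mu> is small because both points are nearly
    orthogonal to the complex line.\<close>
  have \<Delta>\<Delta>: "- (\<Delta> * (\<Delta> - \<mu>)) \<le> U / 400"
  proof -
    have "0 \<le> (2 * \<Delta> - \<mu>)\<^sup>2" by simp
    then show ?thesis using \<mu>\<mu> by (simp add: power2_eq_square algebra_simps)
  qed
  have nH: "norm H \<le> 1 / 2000 * u"
  proof -
    have "norm H \<le> (3 * (73 / 100)\<^sup>2 + 1) / 10000 * norm d"
      unfolding H_def d_def by (rule pert_g[OF xy(1,2) nx])
    also have "\<dots> \<le> 3 / 10000 * (3 / 2 * u)" using nd by (intro mult_mono) (auto simp: power_divide)
    finally show ?thesis using u by simp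
  qed
  have "norm G \<le> lipc (73 / 100) * norm d" unfolding G_def d_def by (rule lip_g[OF xy(1,2) nx])
  also have "\<dots> \<le> 16 * (3 / 2 * u)" using nd by (intro mult_mono) (auto simp: power_divide lipc_def)
  finally have nG: "norm G \<le> 24 * u" by simp
  have GH: "G = (g0 x - g0 y) + H" by (simp add: G_def H_def)
  have "\<bar>pl d \<bullet> H\<bar> \<le> u * (1 / 2000 * u)"
    using Cauchy_Schwarz_ineq2[of "pl d" H] mult_left_mono[OF nH u(1)] by (simp add: u_def)
  then have pH: "\<bar>pl d \<bullet> H\<bar> \<le> U / 2000" unfolding u(2)[symmetric] by simp
  have "\<bar>ql d \<bullet> H\<bar> \<le> u * (1 / 2000 * u)"
    using Cauchy_Schwarz_ineq2[of "ql d" H] mult_mono[OF \<open>norm (ql d) \<le> u\<close> nH u(1)] by simp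
  then have qH: "\<bar>ql d \<bullet> H\<bar> \<le> U / 2000" unfolding u(2)[symmetric] by simp
  have q: "0 \<le> q" "q \<le> 106 / 100" using xy(3,4) by (auto simp: q_def)
  have pG: "pl d \<bullet> G \<le> (q - 2) * U + 2195 / 10000 * U"
    using \<Delta>\<mu> pH inner_g0_diff(1)[of x y, folded d_def \<Delta>_def \<mu>_def q_def, folded U_def]
    unfolding GH inner_add_right abs_le_iff by linarith
  have qG: "(q - 1) * W - 3 / 1000 * U \<le> ql d \<bullet> G"
    using \<Delta>\<Delta> qH inner_g0_diff(2)[of x y, folded d_def \<Delta>_def \<mu>_def q_def, folded W_def]
    unfolding GH inner_add_right abs_le_iff by linarith
  have d': "d' = d - a *\<^sub>R G" by (simp add: d'_def d_def G_def algebra_simps)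
  have "m2 d' = U - 2 * a * (pl d \<bullet> pl G) + a * a * (pl G \<bullet> pl G)"
    unfolding d' m2_pl U_def pl_simps by (simp add: inner_simps inner_commute algebra_simps)
  then have "m2 d' = U - 2 * a * (pl d \<bullet> G) + a * a * (pl G \<bullet> pl G)"
    using inner_pl(2)[of d G] by simp
  moreover have "0 \<le> a * a * (pl G \<bullet> pl G)" using a by simp
  moreover have "a * (pl d \<bullet> G) \<le> a * ((q - 2) * U + 2195 / 10000 * U)" using pG a(1) by (rule mult_left_mono)
  ultimately have m2': "U - 2 * (a * ((q - 2) * U + 2195 / 10000 * U)) \<le> m2 d'" by linarith
  have "w2 d' = W - 2 * a * (ql d \<bullet> ql G) + a * a * (ql G \<bullet> ql G)"
    unfolding d' w2_ql W_def ql_simps by (simp add: inner_simps inner_commute algebra_simps)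
  then have "w2 d' = W - 2 * a * (ql d \<bullet> G) + a * a * (ql G \<bullet> ql G)"
    using inner_ql(2)[of d G] by simp
  moreover have "a * a * (ql G \<bullet> ql G) \<le> a * (1 / 1000000) * (576 * U)"
  proof -
    have "norm (ql G) \<le> 24 * u" using norm_ql_le[of G] nG by linarith
    then have "ql G \<bullet> ql G \<le> (24 * u) * (24 * u)" by (rule inner_le_of_norm_le)
    also have "\<dots> = 576 * U" unfolding u(2)[symmetric] by simp
    finally show ?thesis using a by (intro mult_mono mult_left_mono) auto
  qed
  moreover have "a * ((q - 1) * W - 3 / 1000 * U) \<le> a * (ql d \<bullet> G)" using qG a(1) by (rule mult_left_mono)
  ultimately have w2': "w2 d' \<le> W - 2 * (a * ((q - 1) * W - 3 / 1000 * U)) + 576 / 1000000 * (a * U)"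
    by linarith
  have "0 \<le> a * U * (3805 / 10000)" using a U0 by simp
  have "- 1 / 1000000 \<le> a * (1 - q)"
  proof -
    have "a * (q - 1) \<le> a * 1" using a q by (intro mult_left_mono) auto
    then show ?thesis using a(2) by (simp add: algebra_simps)
  qed
  \<comment> \<open>The common part of the two rates preserves the order of U and W. The unit gap
    between q - 2 and q - 1 leaves the surplus 2 a U, which pays for all error terms.\<close>
  then have "0 \<le> (U - W) * (1 + 2 * (a * (1 - q)))" using WU by (intro mult_nonneg_nonneg) auto
  moreover have "0 \<le> a * U" using a U0 by simp
  ultimately show "w2 d' \<le> m2 d'" using w2' m2' by (simp add: algebra_simps)
  have "0 \<le> a * U * (106 / 100 - q)" using a U0 q by simp
  then show "(1 + a) * m2 (x - y) \<le> m2 d'"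
    using m2' \<open>0 \<le> a * U\<close> unfolding d_def[symmetric] U_def[symmetric] by (simp add: algebra_simps)
qed

text \<open>The growth of \<open>m2\<close> is used only in the linear form 1 + h l. As both points
  stay in a bounded region, a stay of time 5/r^2 forces the initial \<open>m2\<close> below r^2 / 2,
  and in the cone the squared distance is at most twice \<open>m2\<close>.\<close>

lemma cone_growth:
  assumes x: "\<And>l. x l \<in> V" "\<And>l. x (Suc l) = x l - h *\<^sub>R g (x l)"
    and y: "\<And>l. y l \<in> V" "\<And>l. y (Suc l) = y l - h *\<^sub>R g (y l)"
    and region: "\<And>l. l \<le> n \<Longrightarrow> x l \<bullet> x l \<le> 53 / 100 \<and> y l \<bullet> y l \<le> 53 / 100 \<and> m2 (x l) \<le> 1 / 400 \<and> m2 (y l) \<le> 1 / 400"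
    and h: "0 \<le> h" "h \<le> 1 / 1000000"
    and cone: "w2 (x 0 - y 0) \<le> m2 (x 0 - y 0)"
    and n: "5 / r\<^sup>2 \<le> h * real n" and "0 < r"
  shows "norm (x 0 - y 0) < r"
proof -
  define U where "U l = m2 (x l - y l)" for l
  have "l \<le> n \<Longrightarrow> w2 (x l - y l) \<le> U l \<and> U 0 * (1 + h * real l) \<le> U l" for l
  proof (induction l)
    case 0
    then show ?case using cone by (simp add: U_def)
  next
    case (Suc l)
    have IH: "w2 (x l - y l) \<le> m2 (x l - y l)" "U 0 * (1 + h * real l) \<le> U l"
      using Suc by (auto simp: U_def)
    have R: "x l \<bullet> x l \<le> 53 / 100" "y l \<bullet> y l \<le> 53 / 100" "m2 (x l) \<le> 1 / 400" "m2 (y l) \<le> 1 / 400"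
      using region[of l] Suc.prems by auto
    have S: "w2 (x (Suc l) - y (Suc l)) \<le> U (Suc l)" "(1 + h) * U l \<le> U (Suc l)"
      using cone_step[OF x(1) y(1) R h IH(1)] unfolding U_def x(2) y(2) by auto
    have U0: "0 \<le> U 0" by (simp add: U_def m2_nonneg)
    have "U 0 * 1 \<le> U 0 * (1 + h * real l)" using U0 h by (intro mult_left_mono) auto
    then have "U 0 \<le> U l" using IH(2) by simp
    then have "h * U 0 \<le> h * U l" using h(1) by (rule mult_left_mono)
    then have "U 0 * (1 + h * real (Suc l)) \<le> U (Suc l)"
      using IH(2) S(2) by (simp add: algebra_simps)
    then show ?case using S(1) by simp
  qed
  then have growth: "U 0 * (1 + h * real n) \<le> U n" by simp
  have "norm (x n) \<le> 73 / 100" "norm (y n) \<le> 73 / 100"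
    using region[of n] norm_le_of_inner_le[of "x n" "73 / 100"] norm_le_of_inner_le[of "y n" "73 / 100"]
    by simp_all
  then have "norm (x n - y n) \<le> 146 / 100" using norm_triangle_ineq4[of "x n" "y n"] by linarith
  then have "(x n - y n) \<bullet> (x n - y n) \<le> 146 / 100 * (146 / 100)" by (rule inner_le_of_norm_le)
  then have "U n \<le> 22 / 10" using m2_le[of "x n - y n"] by (simp add: U_def)
  moreover have "U 0 * (5 / r\<^sup>2) \<le> U 0 * (1 + h * real n)"
    using n by (intro mult_left_mono) (auto simp: U_def m2_nonneg)
  ultimately have "U 0 * (5 / r\<^sup>2) \<le> 22 / 10" using growth by linarith
  then have "U 0 * 5 \<le> 22 / 10 * r\<^sup>2" using \<open>0 < r\<close> by (simp add: field_simps)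
  moreover have "0 < r\<^sup>2" using \<open>0 < r\<close> by simp
  ultimately have "2 * U 0 < r\<^sup>2" by linarith
  moreover have "(x 0 - y 0) \<bullet> (x 0 - y 0) \<le> 2 * U 0" using cone by (simp add: U_def w2_def)
  ultimately have "(norm (x 0 - y 0))\<^sup>2 < r\<^sup>2" by (simp add: power2_norm_eq_inner)
  then show ?thesis using \<open>0 < r\<close> by (simp add: power_less_imp_less_base)
qed

text \<open>The failure of the claimed convergence at the point x. Quantifying over every bound
  \<eta> is what later allows h to be chosen as small as the scale r demands.\<close>

definition stuck :: "'a \<Rightarrow> bool" where
  "stuck x \<longleftrightarrow> (\<forall>\<eta>>0. \<exists>\<alpha>. (\<forall>k. 0 < \<alpha> k \<and> \<alpha> k \<le> \<eta>) \<and> \<not> summable \<alpha> \<and>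
     \<not> (\<exists>z\<in>V. F z = 0 \<and> grad_steps g \<alpha> x \<longlonglongrightarrow> z))"

lemma not_stuck:
  "\<not> stuck x \<longleftrightarrow> (\<exists>\<eta>>0. \<forall>\<alpha>. (\<forall>k. 0 < \<alpha> k \<and> \<alpha> k \<le> \<eta>) \<longrightarrow> \<not> summable \<alpha> \<longrightarrow>
    (\<exists>z\<in>V. F z = 0 \<and> grad_steps g \<alpha> x \<longlonglongrightarrow> z))"
proof -
  have "(\<not> (\<forall>\<eta>>0. \<exists>\<alpha>. A \<eta> \<alpha> \<and> B \<alpha> \<and> \<not> C \<alpha>)) \<longleftrightarrow> (\<exists>\<eta>>0. \<forall>\<alpha>. A \<eta> \<alpha> \<longrightarrow> B \<alpha> \<longrightarrow> C \<alpha>)"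
    for A :: "real \<Rightarrow> (nat \<Rightarrow> real) \<Rightarrow> bool" and B C by blast
  then show ?thesis unfolding stuck_def .
qed

text \<open>A step can shrink distances at most by the factor 1 - h L, which is at least exp (- 2 h
  L) as h L is at most 1/2. The bound depends only on the elapsed time h l, hence is uniform in
  h.\<close>

lemma const_steps_expand:
  assumes "2 \<le> R" "0 < h" "h * (bndc R)\<^sup>2 \<le> 1 / 1000" "x \<in> V" "norm x \<le> R" "y \<in> V" "norm y \<le> R"
  shows "exp (- 2 * lipc R * h * real l) * norm (x - y)
    \<le> norm (grad_steps g (\<lambda>_. h) x l - grad_steps g (\<lambda>_. h) y l)"
proof (induction l)
  case (Suc l)
  define u v where "u = grad_steps g (\<lambda>_. h) x l" and "v = grad_steps g (\<lambda>_. h) y l"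
  define b where "b = h * lipc R"
  have b: "0 \<le> b" "b \<le> 1 / 2"
    using step_small(2)[OF assms(1) _ assms(3)] assms(2) by (auto simp: b_def lipc_def)
  have "norm u \<le> R" "norm v \<le> R"
    using grad_steps_ball[OF assms(1), of "\<lambda>_. h"] assms unfolding u_def v_def by auto
  then have "norm (g u - g v) \<le> lipc R * norm (u - v)"
    unfolding u_def v_def by (intro lip_g grad_steps_V assms)
  then have "h * norm (g u - g v) \<le> b * norm (u - v)"
    using mult_left_mono[of _ _ h] assms(2) unfolding b_def by (simp add: mult.assoc)
  moreover have eq: "(u - h *\<^sub>R g u) - (v - h *\<^sub>R g v) = (u - v) - h *\<^sub>R (g u - g v)" by (simp add: algebra_simps)
  have "norm (u - v) - h * norm (g u - g v) \<le> norm ((u - v) - h *\<^sub>R (g u - g v))"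
    using norm_triangle_ineq2[of "u - v" "h *\<^sub>R (g u - g v)"] assms(2) by simp
  ultimately have step: "(1 - b) * norm (u - v) \<le> norm ((u - h *\<^sub>R g u) - (v - h *\<^sub>R g v))"
    unfolding eq left_diff_distrib mult_1 by linarith
  have "exp (- 2 * b) \<le> 1 - b"
  proof -
    have "0 \<le> b * (1 - 2 * b)" using b by simp
    then have "1 \<le> (1 - b) * (1 + 2 * b)" by (simp add: algebra_simps)
    also have "\<dots> \<le> (1 - b) * exp (2 * b)"
      using b exp_ge_add_one_self[of "2 * b"] by (intro mult_left_mono) auto
    finally show ?thesis by (simp add: exp_minus field_simps)
  qed
  have "exp (- 2 * lipc R * h * real (Suc l)) * norm (x - y)
     = exp (- 2 * b) * (exp (- 2 * lipc R * h * real l) * norm (x - y))"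
  proof -
    have e: "- 2 * lipc R * h * real (Suc l) = - 2 * b + - 2 * lipc R * h * real l"
      by (simp add: b_def algebra_simps)
    show ?thesis unfolding e exp_add by (simp only: mult.assoc)
  qed
  also have "\<dots> \<le> (1 - b) * norm (u - v)"
    using Suc \<open>exp (- 2 * b) \<le> 1 - b\<close> b(2) unfolding u_def v_def by (intro mult_mono) auto
  finally show ?case using step by (simp add: u_def v_def)
qed simp

text \<open>A bad step sequence with steps at most h keeps the loss high, so it is in the saddle
  region from time 200 R^2 on. Constant steps follow it up to 1/1000, which widens 52/100 to 53/100
  and 16/10000 to 1/400.\<close>

lemma stuck_const_steps_region:
  assumes R: "2 \<le> R" and h: "0 < h" "h * (bndc R)\<^sup>2 \<le> 1 / 1000"
    and x: "x \<in> V" "norm x \<le> R" "1 / R \<le> norm x" "stuck x"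
    and l: "200 * R\<^sup>2 \<le> real l * h" "h * bndc R * exp (3 * lipc R * h * real l) \<le> 1 / 1000"
  defines "y \<equiv> grad_steps g (\<lambda>_. h) x l"
  shows "y \<bullet> y \<le> 53 / 100" "m2 y \<le> 1 / 400"
proof -
  obtain \<alpha> where *: "(\<forall>k. 0 < \<alpha> k \<and> \<alpha> k \<le> h) \<and> \<not> summable \<alpha> \<and>
      \<not> (\<exists>z\<in>V. F z = 0 \<and> grad_steps g \<alpha> x \<longlonglongrightarrow> z)"
    using x(4)[unfolded stuck_def, rule_format, OF h(1)] by (rule exE)
  have \<alpha>: "\<And>k. 0 < \<alpha> k" "\<And>k. \<alpha> k \<le> h" "\<not> summable \<alpha>"
    and nc: "\<not> (\<exists>z\<in>V. F z = 0 \<and> grad_steps g \<alpha> x \<longlonglongrightarrow> z)"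
    using * by simp_all
  have \<alpha>B: "\<alpha> k * (bndc R)\<^sup>2 \<le> 1 / 1000" for k
    using mult_right_mono[OF \<alpha>(2)[of k], of "(bndc R)\<^sup>2"] h(2) by simp
  have high: "749 / 2000 \<le> F (grad_steps g \<alpha> x k)" for k
    using converges_from_low_value[OF R \<alpha>(1) \<alpha>B \<alpha>(3) x(1,2), of k] nc by force
  have "\<exists>k. real l * h \<le> sum \<alpha> {..<k} \<and>
      norm (grad_steps g \<alpha> x k - grad_steps g (\<lambda>_. h) x l) \<le> h * bndc R * exp (3 * lipc R * h * real l)"
  proof (rule tracking[where K = "{u \<in> V. norm u \<le> R}"])
    show "0 \<le> lipc R" "0 \<le> bndc R" using R by (auto simp: lipc_def bndc_def)
  qed (use \<alpha> \<alpha>B h R x in \<open>auto intro!: grad_steps_V grad_steps_ball lip_g bnd_g\<close>)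
  then obtain k where k: "real l * h \<le> sum \<alpha> {..<k}" "norm (grad_steps g \<alpha> x k - y) \<le> 1 / 1000"
    using l(2) unfolding y_def by (metis order_trans)
  define z where "z = grad_steps g \<alpha> x k"
  have z: "z \<bullet> z \<le> 52 / 100" "m2 z \<le> 16 / 10000"
    using enters_saddle_region[OF R \<alpha>(1) \<alpha>B x(1-3) high] l(1) k(1) unfolding z_def
    by (auto intro: order_trans)
  have "norm z \<le> 722 / 1000" using z(1) by (intro norm_le_of_inner_le) auto
  then have "norm y \<le> 723 / 1000"
    using k(2) norm_triangle_sub[of y z] by (simp add: z_def norm_minus_commute)
  then have "y \<bullet> y \<le> 723 / 1000 * (723 / 1000)" by (rule inner_le_of_norm_le)
  then show "y \<bullet> y \<le> 53 / 100" by simp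
  have "norm (pl z) \<le> 4 / 100" using z(2) by (intro norm_le_of_inner_le) (auto simp: m2_pl)
  moreover have "norm (pl z - pl y) \<le> 1 / 1000"
    using k(2) norm_pl_le[of "z - y"] by (simp add: z_def pl_simps)
  ultimately have "norm (pl y) \<le> 5 / 100"
    using norm_triangle_sub[of "pl y" "pl z"] by (simp add: norm_minus_commute)
  then have "pl y \<bullet> pl y \<le> 5 / 100 * (5 / 100)" by (rule inner_le_of_norm_le)
  then show "m2 y \<le> 1 / 400" by (simp add: m2_pl)
qed

text \<open>The map runs constant steps until time about 200 R^2. Two images in the cone of each
  other would separate during the further time 5/r^2, although both orbits stay in the region; so
  they are closer than r. Although the map depends on r, the constant c does not: it accounts for
  shrinking up to the entrance only.\<close>

lemma stuck_image_outside_cone: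
  assumes R: "2 \<le> R"
  defines "A \<equiv> {x \<in> V. norm x \<le> R \<and> 1 / R \<le> norm x \<and> stuck x}"
  shows "\<exists>c>0. \<forall>r>0. \<exists>\<Psi>. \<forall>x\<in>A. \<Psi> x \<in> V \<and> norm (\<Psi> x) \<le> 1 \<and>
    (\<forall>y\<in>A. c * norm (x - y) \<le> norm (\<Psi> x - \<Psi> y) \<and>
      (norm (\<Psi> x - \<Psi> y) < r \<or> m2 (\<Psi> x - \<Psi> y) < w2 (\<Psi> x - \<Psi> y)))"
proof (intro exI[of _ "exp (- 2 * lipc R * (200 * R\<^sup>2 + 1))"] conjI allI impI)
  fix r :: real assume r: "0 < r"
  define T S B L where "T = 200 * R\<^sup>2" and "S = 5 / r\<^sup>2" and "B = bndc R" and "L = lipc R"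
  have S: "0 \<le> S" "0 \<le> T" by (auto simp: S_def T_def)
  have B: "100 \<le> B" "0 \<le> L" using bndc_ge(1)[OF R] by (auto simp: B_def L_def lipc_def)
  define E where "E = exp (3 * L * (T + S + 2))"
  have E: "1 \<le> E" using B S unfolding E_def by simp
  \<comment> \<open>The square of \<open>B\<close> secures the step condition and \<open>E\<close>
    the tracking error up to time T + S + 2, where the 2 absorbs rounding \<open>T\<close> and
    \<open>S\<close> up to whole steps.\<close>
  define h where "h = 1 / (1000000 * B\<^sup>2 * E)"
  have BB: "B * 1 \<le> B * B" using B by (intro mult_left_mono) auto
  have h0: "0 < h" using B E by (simp add: h_def)
  have hB2: "h * B\<^sup>2 \<le> 1 / 1000"
    using B E by (simp add: h_def divide_simps)
  have hE: "h * B * E \<le> 1 / 1000"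
    using B E BB by (simp add: h_def divide_simps power2_eq_square)
  have h1: "h \<le> 1 / 1000000"
    using step_small(3)[OF R _ hB2[unfolded B_def]] h0 B E BB
    by (simp add: h_def divide_simps power2_eq_square)
  define l0 n where "l0 = nat \<lceil>T / h\<rceil>" and "n = nat \<lceil>S / h\<rceil>"
  have ceil: "t / h \<le> real (nat \<lceil>t / h\<rceil>) \<and> real (nat \<lceil>t / h\<rceil>) \<le> t / h + 1" if "0 \<le> t" for t
    using that h0 ceiling_correct[of "t / h"] by (auto simp: of_nat_nat)
  have l0: "T \<le> real l0 * h" "real l0 * h \<le> T + 1" "S \<le> h * real n" "h * real n \<le> S + 1"
    using ceil[OF S(2)] ceil[OF S(1)] h0 h1 unfolding l0_def n_def by (auto simp: field_simps)
  let ?y = "grad_steps g (\<lambda>_. h)"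
  have region: "?y x l \<bullet> ?y x l \<le> 53 / 100 \<and> m2 (?y x l) \<le> 1 / 400"
    if "x \<in> A" "l0 \<le> l" "l \<le> l0 + n" for x l
  proof -
    have "real l0 * h \<le> real l * h" "real l * h \<le> real (l0 + n) * h"
      using that h0 by (auto intro!: mult_right_mono simp del: of_nat_add)
    then have t: "T \<le> real l * h" "h * real l \<le> T + S + 2" using l0 by (auto simp: algebra_simps)
    have "3 * L * (h * real l) \<le> 3 * L * (T + S + 2)" using t B by (intro mult_left_mono) auto
    then have "h * B * exp (3 * L * h * real l) \<le> h * B * E"
      unfolding E_def using h0 B by (intro mult_left_mono) (auto simp: mult.assoc)
    then have e: "h * bndc R * exp (3 * lipc R * h * real l) \<le> 1 / 1000"
      using hE by (simp add: B_def L_def)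
    show ?thesis
      using that(1) stuck_const_steps_region[OF R h0 hB2[unfolded B_def] _ _ _ _ t(1)[unfolded T_def] e]
      by (auto simp: A_def)
  qed
  have expand: "exp (- 2 * lipc R * (200 * R\<^sup>2 + 1)) * norm (x - y) \<le> norm (?y x l0 - ?y y l0)"
    if "x \<in> A" "y \<in> A" for x y
  proof -
    have "L * (h * real l0) \<le> L * (T + 1)" using l0 B by (intro mult_left_mono) (auto simp: mult.commute)
    then have "exp (- 2 * L * (T + 1)) \<le> exp (- 2 * L * h * real l0)" by (simp add: algebra_simps)
    then have "exp (- 2 * L * (T + 1)) * norm (x - y) \<le> exp (- 2 * L * h * real l0) * norm (x - y)"
      by (rule mult_right_mono) simp
    also have "\<dots> \<le> norm (?y x l0 - ?y y l0)"
      unfolding L_def using that by (intro const_steps_expand[OF R h0 hB2[unfolded B_def]]) (auto simp: A_def)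
    finally show ?thesis by (simp add: L_def T_def)
  qed
  have close: "norm (?y x l0 - ?y y l0) < r"
    if "x \<in> A" "y \<in> A" "w2 (?y x l0 - ?y y l0) \<le> m2 (?y x l0 - ?y y l0)" for x y
  proof -
    have "norm (?y x (l0 + 0) - ?y y (l0 + 0)) < r"
    proof (rule cone_growth[where x = "\<lambda>l. ?y x (l0 + l)" and y = "\<lambda>l. ?y y (l0 + l)" and h = h and n = n])
      show "5 / r\<^sup>2 \<le> h * real n" using l0 by (simp add: S_def)
    qed (use that region[OF that(1)] region[OF that(2)] h0 h1 r in \<open>auto simp: A_def intro: grad_steps_V\<close>)
    then show ?thesis by simp
  qed
  show "\<exists>\<Psi>. \<forall>x\<in>A. \<Psi> x \<in> V \<and> norm (\<Psi> x) \<le> 1 \<and>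
      (\<forall>y\<in>A. exp (- 2 * lipc R * (200 * R\<^sup>2 + 1)) * norm (x - y) \<le> norm (\<Psi> x - \<Psi> y) \<and>
        (norm (\<Psi> x - \<Psi> y) < r \<or> m2 (\<Psi> x - \<Psi> y) < w2 (\<Psi> x - \<Psi> y)))"
  proof (intro exI[of _ "\<lambda>x. ?y x l0"] ballI conjI)
    fix x assume x: "x \<in> A"
    then show "?y x l0 \<in> V" by (auto simp: A_def intro: grad_steps_V)
    show "norm (?y x l0) \<le> 1" using region[OF x, of l0] by (intro norm_le_of_inner_le) auto
    fix y assume y: "y \<in> A"
    show "exp (- 2 * lipc R * (200 * R\<^sup>2 + 1)) * norm (x - y) \<le> norm (?y x l0 - ?y y l0)"
      by (rule expand[OF x y])
    show "norm (?y x l0 - ?y y l0) < r \<or> m2 (?y x l0 - ?y y l0) < w2 (?y x l0 - ?y y l0)"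
      using close[OF x y] by linarith
  qed
qed simp

text \<open>Outside the cone around \<^term>\<open>e\<close>, the translates of a separated set along \<^term>\<open>e\<close> stay
  separated from each other; this gains one dimension.\<close>

lemma stuck_separated_shift:
  assumes R: "2 \<le> R"
  defines "A \<equiv> {x \<in> V. norm x \<le> R \<and> 1 / R \<le> norm x \<and> stuck x}"
  shows "\<exists>c>0. \<forall>r>0. \<forall>P K. finite P \<longrightarrow> P \<subseteq> A \<longrightarrow> separated r P \<longrightarrow> 2 * c * r * real K \<le> 1 \<longrightarrow>
    (\<exists>Q\<subseteq>V. finite Q \<and> card Q = card P * K \<and> (\<forall>x\<in>Q. norm x \<le> 2) \<and> separated (c * r) Q)"
proof -
  obtain c where c: "0 < c" and \<Psi>ex: "\<And>r. 0 < r \<Longrightarrow> \<exists>\<Psi>. \<forall>x\<in>A. \<Psi> x \<in> V \<and> norm (\<Psi> x) \<le> 1 \<and>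
      (\<forall>y\<in>A. c * norm (x - y) \<le> norm (\<Psi> x - \<Psi> y) \<and>
      (norm (\<Psi> x - \<Psi> y) < r \<or> m2 (\<Psi> x - \<Psi> y) < w2 (\<Psi> x - \<Psi> y)))"
    using stuck_image_outside_cone[OF R] unfolding A_def by blast
  show ?thesis
  proof (intro exI[of _ c] conjI allI impI)
    fix r :: real and P K
    assume r: "0 < r" and P: "finite P" "P \<subseteq> A" "separated r P" and K: "2 * c * r * real K \<le> 1"
    have cr: "0 < c * r" using c r by simp
    obtain \<Psi> where \<Psi>: "\<And>x. x \<in> A \<Longrightarrow> \<Psi> x \<in> V" "\<And>x. x \<in> A \<Longrightarrow> norm (\<Psi> x) \<le> 1"
        "\<And>x y. x \<in> A \<Longrightarrow> y \<in> A \<Longrightarrow> c * norm (x - y) \<le> norm (\<Psi> x - \<Psi> y)"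
        "\<And>x y. x \<in> A \<Longrightarrow> y \<in> A \<Longrightarrow> norm (\<Psi> x - \<Psi> y) < c * r \<or> m2 (\<Psi> x - \<Psi> y) < w2 (\<Psi> x - \<Psi> y)"
      using \<Psi>ex[OF cr] by blast
    \<comment> \<open>The spacing 2 c r is twice the separation to be shown: outside the cone a
      shift by s still leaves a distance of |s| / sqrt 2.\<close>
    define f where "f = (\<lambda>(x, k). \<Psi> x + (2 * c * r * real k) *\<^sub>R e)"
    have far: "c * r \<le> norm (f (x, k) - f (y, j))"
      if "x \<in> P" "y \<in> P" "(x, k) \<noteq> (y, j)" for x y k j
    proof -
      define d s where "d = \<Psi> x - \<Psi> y" and "s = 2 * c * r * (real k - real j)"
      have fd: "f (x, k) - f (y, j) = d + s *\<^sub>R e" by (simp add: f_def d_def s_def algebra_simps)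
      have s: "2 * c * r \<le> \<bar>s\<bar>" if "k \<noteq> j"
      proof -
        have "2 * c * r * 1 \<le> 2 * c * r * \<bar>real k - real j\<bar>"
          using that c r by (intro mult_left_mono) auto
        then show ?thesis using c r by (simp add: s_def abs_mult)
      qed
      show ?thesis
      proof (cases "x = y")
        case True
        then have "k \<noteq> j" using that by simp
        then show ?thesis unfolding fd using s cr True by (simp add: d_def norm_eq_sqrt_inner[of e] e1)
      next
        case False
        then have "r \<le> norm (x - y)" using P(3) that unfolding separated_def by blast
        then have "c * r \<le> c * norm (x - y)" using c by (intro mult_left_mono) auto
        then have d: "c * r \<le> norm d" using \<Psi>(3)[of x y] P(2) that unfolding d_def by force
        show ?thesis
        proof (cases "k = j")
          case True
          then show ?thesis unfolding fd using d by (simp add: s_def)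
        next
          case False
          \<comment> \<open>The images are already at least c r apart, so the alternative of being
            closer than c r is excluded.\<close>
          have "m2 d < w2 d" using \<Psi>(4)[of x y] P(2) that d unfolding d_def by force
          then have w: "(d \<bullet> e)\<^sup>2 \<le> w2 d" unfolding m2_def by (smt (verit) zero_le_power2)
          have "(d + s *\<^sub>R e) \<bullet> (d + s *\<^sub>R e) = d \<bullet> d + 2 * s * (d \<bullet> e) + s * s"
            by (simp add: inner_simps inner_commute e1 algebra_simps)
          also have "d \<bullet> d = w2 d + (d \<bullet> e)\<^sup>2 + (d \<bullet> e')\<^sup>2" by (simp add: w2_def m2_def)
          finally have "2 * (d \<bullet> e)\<^sup>2 + 2 * s * (d \<bullet> e) + s * s \<le> (d + s *\<^sub>R e) \<bullet> (d + s *\<^sub>R e)"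
            using w zero_le_power2[of "d \<bullet> e'"] by linarith
          \<comment> \<open>Completing the square: the shift along e can cancel the e-component of
            d, but then the orthogonal part, which is at least as large, remains.\<close>
          moreover have "2 * (d \<bullet> e)\<^sup>2 + 2 * s * (d \<bullet> e) + s * s = (2 * (d \<bullet> e) + s)\<^sup>2 / 2 + s\<^sup>2 / 2"
            by (simp add: power2_eq_square field_simps)
          ultimately have "s\<^sup>2 / 2 \<le> (d + s *\<^sub>R e) \<bullet> (d + s *\<^sub>R e)"
            using zero_le_power2[of "2 * (d \<bullet> e) + s"] by linarith
          moreover have "(2 * c * r)\<^sup>2 \<le> s\<^sup>2"
            using power_mono[OF s[OF False], of 2] c r by simp
          moreover have "(2 * c * r)\<^sup>2 = 4 * (c * r)\<^sup>2" by (simp add: power_mult_distrib)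
          ultimately have "(c * r)\<^sup>2 \<le> (norm (d + s *\<^sub>R e))\<^sup>2"
            unfolding power2_norm_eq_inner using zero_le_power2[of "c * r"] by linarith
          then show ?thesis unfolding fd by (rule power2_le_imp_le) simp
        qed
      qed
    qed
    define Q where "Q = f ` (P \<times> {..<K})"
    have inj: "inj_on f (P \<times> {..<K})"
    proof (rule inj_onI)
      fix p q assume pq: "p \<in> P \<times> {..<K}" "q \<in> P \<times> {..<K}" "f p = f q"
      show "p = q"
      proof (rule ccontr)
        assume "p \<noteq> q"
        then have "c * r \<le> norm (f p - f q)" using far[of "fst p" "fst q" "snd p" "snd q"] pq by auto
        then show False using pq(3) cr by simp
      qed
    qed
    show "\<exists>Q\<subseteq>V. finite Q \<and> card Q = card P * K \<and> (\<forall>x\<in>Q. norm x \<le> 2) \<and> separated (c * r) Q"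
    proof (intro exI[of _ Q] conjI ballI)
      show "Q \<subseteq> V" unfolding Q_def f_def using \<Psi>(1) P(2) subV eV
        by (auto intro!: subspace_add subspace_scale)
      show "finite Q" using P(1) by (simp add: Q_def)
      show "card Q = card P * K" unfolding Q_def using inj by (simp add: card_image card_cartesian_product)
      show "separated (c * r) Q" unfolding separated_def Q_def by (auto intro!: far)
      fix z assume "z \<in> Q"
      then obtain x k where z: "x \<in> P" "k < K" "z = \<Psi> x + (2 * c * r * real k) *\<^sub>R e"
        by (auto simp: Q_def f_def)
      have "2 * c * r * real k \<le> 2 * c * r * real K" using z(2) c r by (intro mult_left_mono) auto
      then have "2 * c * r * real k \<le> 1" using K by linarith
      then have "norm ((2 * c * r * real k) *\<^sub>R e) \<le> 1"
        using c r by (simp add: norm_eq_sqrt_inner[of e] e1)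
      then show "norm z \<le> 2"
        using norm_triangle_ineq[of "\<Psi> x" "(2 * c * r * real k) *\<^sub>R e"] \<Psi>(2)[of x] z(1,3) P(2) by force
    qed
  qed (rule c)
qed

end

section \<open>Finitely supported sequences\<close>

text \<open>The dimension is a bound variable of the theorem, so it cannot be a type; the spaces
  \<open>R^d\<close> for all \<open>d\<close> live together in the finitely supported sequences.\<close>

typedef fvec = "{f :: nat \<Rightarrow> real. finite {i. f i \<noteq> 0}}"
  morphisms nth_fvec mk_fvec
  by (rule exI[of _ "\<lambda>_. 0"]) simp

setup_lifting type_definition_fvec

instantiation fvec :: real_vector
begin

lift_definition zero_fvec :: fvec is "\<lambda>_. 0" by simp

lift_definition plus_fvec :: "fvec \<Rightarrow> fvec \<Rightarrow> fvec" is "\<lambda>f g i. f i + g i"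
  subgoal for f g by (rule finite_subset[of _ "{i. f i \<noteq> 0} \<union> {i. g i \<noteq> 0}"]) auto
  done

lift_definition minus_fvec :: "fvec \<Rightarrow> fvec \<Rightarrow> fvec" is "\<lambda>f g i. f i - g i"
  subgoal for f g by (rule finite_subset[of _ "{i. f i \<noteq> 0} \<union> {i. g i \<noteq> 0}"]) auto
  done

lift_definition uminus_fvec :: "fvec \<Rightarrow> fvec" is "\<lambda>f i. - f i" by simp

lift_definition scaleR_fvec :: "real \<Rightarrow> fvec \<Rightarrow> fvec" is "\<lambda>c f i. c * f i"
  subgoal for c f by (rule finite_subset[of _ "{i. f i \<noteq> 0}"]) auto
  done

instance
  by standard (transfer; simp add: algebra_simps fun_eq_iff)+

end

lemma nth_fvec_simps [simp]:
  "nth_fvec 0 i = 0" "nth_fvec (x + y) i = nth_fvec x i + nth_fvec y i"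
  "nth_fvec (x - y) i = nth_fvec x i - nth_fvec y i" "nth_fvec (- x) i = - nth_fvec x i"
  "nth_fvec (c *\<^sub>R x) i = c * nth_fvec x i"
  by (transfer; simp)+

lemma finite_support_fvec: "finite {i. nth_fvec x i \<noteq> 0}"
  by transfer simp

lemma fvec_eqI: "(\<And>i. nth_fvec x i = nth_fvec y i) \<Longrightarrow> x = y"
  by transfer auto

definition dot_fvec :: "fvec \<Rightarrow> fvec \<Rightarrow> real" where
  "dot_fvec x y = (\<Sum>i | nth_fvec x i \<noteq> 0. nth_fvec x i * nth_fvec y i)"

lemma dot_fvec_superset:
  assumes "finite S" "{i. nth_fvec x i \<noteq> 0} \<subseteq> S"
  shows "dot_fvec x y = (\<Sum>i\<in>S. nth_fvec x i * nth_fvec y i)"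
  unfolding dot_fvec_def by (rule sum.mono_neutral_left) (use assms in auto)

instantiation fvec :: real_inner
begin

definition inner_fvec :: "fvec \<Rightarrow> fvec \<Rightarrow> real" where "inner_fvec = dot_fvec"
definition norm_fvec :: "fvec \<Rightarrow> real" where "norm_fvec x = sqrt (dot_fvec x x)"
definition dist_fvec :: "fvec \<Rightarrow> fvec \<Rightarrow> real" where "dist_fvec x y = norm (x - y)"
definition sgn_fvec :: "fvec \<Rightarrow> fvec" where "sgn_fvec x = x /\<^sub>R norm x"
definition uniformity_fvec :: "(fvec \<times> fvec) filter" where
  "uniformity_fvec = (INF e\<in>{0<..}. principal {(x, y). dist x y < e})"
definition open_fvec :: "fvec set \<Rightarrow> bool" where
  "open_fvec U \<longleftrightarrow> (\<forall>x\<in>U. \<forall>\<^sub>F (x', y) in uniformity. x' = x \<longrightarrow> y \<in> U)"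

instance
proof
  fix x y z :: fvec and r :: real
  let ?S = "{i. nth_fvec x i \<noteq> 0} \<union> {i. nth_fvec y i \<noteq> 0}"
  have fin: "finite ?S" by (simp add: finite_support_fvec)
  have dx: "dot_fvec x z = (\<Sum>i\<in>?S. nth_fvec x i * nth_fvec z i)" for z
    by (rule dot_fvec_superset[OF fin]) auto
  have dy: "dot_fvec y z = (\<Sum>i\<in>?S. nth_fvec y i * nth_fvec z i)" for z
    by (rule dot_fvec_superset[OF fin]) auto
  show "x \<bullet> y = y \<bullet> x"
    unfolding inner_fvec_def dx dy by (simp add: mult.commute)
  have "dot_fvec (x + y) z = (\<Sum>i\<in>?S. nth_fvec (x + y) i * nth_fvec z i)"
    by (rule dot_fvec_superset[OF fin]) auto
  then show "(x + y) \<bullet> z = x \<bullet> z + y \<bullet> z"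
    unfolding inner_fvec_def dx dy by (simp add: algebra_simps sum.distrib)
  have "dot_fvec (r *\<^sub>R x) y = (\<Sum>i\<in>?S. nth_fvec (r *\<^sub>R x) i * nth_fvec y i)"
    by (rule dot_fvec_superset[OF fin]) auto
  then show "(r *\<^sub>R x) \<bullet> y = r * (x \<bullet> y)"
    unfolding inner_fvec_def dx by (simp add: sum_distrib_left mult.assoc)
  show "0 \<le> x \<bullet> x"
    unfolding inner_fvec_def dot_fvec_def by (rule sum_nonneg) simp
  show "(x \<bullet> x = 0) = (x = 0)"
  proof
    assume "x \<bullet> x = 0"
    then have "\<forall>i\<in>{i. nth_fvec x i \<noteq> 0}. nth_fvec x i * nth_fvec x i = 0"
      unfolding inner_fvec_def dot_fvec_def
      by (subst (asm) sum_nonneg_eq_0_iff) (auto simp: finite_support_fvec)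
    then show "x = 0" by (intro fvec_eqI) auto
  qed (simp add: inner_fvec_def dot_fvec_def)
  show "norm x = sqrt (x \<bullet> x)" by (simp add: norm_fvec_def inner_fvec_def)
qed (simp_all add: dist_fvec_def sgn_fvec_def uniformity_fvec_def open_fvec_def)

end

definition fspace :: "nat \<Rightarrow> fvec set" where "fspace d = {x. \<forall>i\<ge>d. nth_fvec x i = 0}"

definition fvec_of :: "nat \<Rightarrow> (nat \<Rightarrow> real) \<Rightarrow> fvec" where
  "fvec_of d u = mk_fvec (\<lambda>i. if i < d then u i else 0)"

lemma nth_fvec_of [simp]: "nth_fvec (fvec_of d u) i = (if i < d then u i else 0)"
  unfolding fvec_of_def by (subst mk_fvec_inverse) auto

lemma fvec_of_in_fspace [simp]: "fvec_of d u \<in> fspace d"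
  by (simp add: fspace_def)

lemma fvec_of_nth: "x \<in> fspace d \<Longrightarrow> fvec_of d (nth_fvec x) = x"
  by (rule fvec_eqI) (auto simp: fspace_def)

lemma subspace_fspace: "subspace (fspace d)"
  by (simp add: subspace_def fspace_def)

lemma inner_fspace: "x \<in> fspace d \<Longrightarrow> x \<bullet> y = (\<Sum>i<d. nth_fvec x i * nth_fvec y i)"
  unfolding inner_fvec_def
  by (rule dot_fvec_superset) (auto simp: fspace_def not_le[symmetric])

lemma norm_fspace: "x \<in> fspace d \<Longrightarrow> norm x = sqrt (\<Sum>i<d. (nth_fvec x i)\<^sup>2)"
  using inner_fspace[of x d x] unfolding norm_eq_sqrt_inner by (simp add: power2_eq_square)

lemma abs_nth_fvec_le: "\<bar>nth_fvec x i\<bar> \<le> norm x"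
proof -
  have "dot_fvec x x = (\<Sum>j\<in>insert i {j. nth_fvec x j \<noteq> 0}. nth_fvec x j * nth_fvec x j)"
    by (rule dot_fvec_superset) (auto simp: finite_support_fvec)
  moreover have "nth_fvec x i * nth_fvec x i \<le> (\<Sum>j\<in>insert i {j. nth_fvec x j \<noteq> 0}. nth_fvec x j * nth_fvec x j)"
    by (rule member_le_sum) (auto simp: finite_support_fvec)
  ultimately have "(nth_fvec x i)\<^sup>2 \<le> (norm x)\<^sup>2"
    unfolding power2_norm_eq_inner inner_fvec_def power2_eq_square[of "nth_fvec x i"] by simp
  then show ?thesis using abs_le_square_iff[of "nth_fvec x i" "norm x"] by simp
qed

section \<open>Convergence, completeness and packing in coordinates\<close>

lemma tendsto_nth_fvec:
  assumes "X \<longlonglongrightarrow> x"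
  shows "(\<lambda>k. nth_fvec (X k) i) \<longlonglongrightarrow> nth_fvec x i"
proof -
  have lim: "(\<lambda>k. norm (X k - x)) \<longlonglongrightarrow> 0"
    using assms by (intro tendsto_norm_zero LIM_zero)
  have "\<forall>k. norm (nth_fvec (X k) i - nth_fvec x i) \<le> norm (X k - x)"
    using abs_nth_fvec_le[of "X _ - x" i] by simp
  then have "(\<lambda>k. nth_fvec (X k) i - nth_fvec x i) \<longlonglongrightarrow> 0"
    by (intro Lim_null_comparison[OF always_eventually lim])
  then show ?thesis by (rule LIM_zero_cancel)
qed

lemma tendsto_fspaceI:
  assumes "\<And>k. X k \<in> fspace d" "x \<in> fspace d"
    and "\<And>i. i < d \<Longrightarrow> (\<lambda>k. nth_fvec (X k) i) \<longlonglongrightarrow> nth_fvec x i"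
  shows "X \<longlonglongrightarrow> x"
proof -
  have "norm (X k - x) = sqrt (\<Sum>i<d. (nth_fvec (X k) i - nth_fvec x i)\<^sup>2)" for k
    using norm_fspace[OF subspace_diff[OF subspace_fspace assms(1,2)]] by simp
  moreover have "(\<lambda>k. sqrt (\<Sum>i<d. (nth_fvec (X k) i - nth_fvec x i)\<^sup>2))
      \<longlonglongrightarrow> sqrt (\<Sum>i<d. (nth_fvec x i - nth_fvec x i)\<^sup>2)"
    by (intro tendsto_intros assms(3)) auto
  ultimately have "(\<lambda>k. norm (X k - x)) \<longlonglongrightarrow> 0" by simp
  then have "(\<lambda>k. X k - x) \<longlonglongrightarrow> 0" by (rule tendsto_norm_zero_cancel)
  then show ?thesis by (rule LIM_zero_cancel)
qed

lemma complete_fspace: "complete (fspace d)"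
  unfolding complete_def
proof (intro allI impI)
  fix X :: "nat \<Rightarrow> fvec" assume X: "(\<forall>k. X k \<in> fspace d) \<and> Cauchy X"
  have "Cauchy (\<lambda>k. nth_fvec (X k) i)" for i
    unfolding Cauchy_def
  proof (intro allI impI)
    fix \<epsilon> :: real assume "0 < \<epsilon>"
    then obtain M where "\<And>m n. M \<le> m \<Longrightarrow> M \<le> n \<Longrightarrow> dist (X m) (X n) < \<epsilon>"
      using X unfolding Cauchy_def by blast
    moreover have "dist (nth_fvec (X m) i) (nth_fvec (X n) i) \<le> dist (X m) (X n)" for m n
      using abs_nth_fvec_le[of "X m - X n" i] by (simp add: dist_norm)
    ultimately show "\<exists>M. \<forall>m\<ge>M. \<forall>n\<ge>M. dist (nth_fvec (X m) i) (nth_fvec (X n) i) < \<epsilon>"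
      by (meson le_less_trans)
  qed
  then have "convergent (\<lambda>k. nth_fvec (X k) i)" for i by (rule real_Cauchy_convergent)
  then have lim: "(\<lambda>k. nth_fvec (X k) i) \<longlonglongrightarrow> lim (\<lambda>k. nth_fvec (X k) i)" for i
    by (simp add: convergent_LIMSEQ_iff)
  define x where "x = fvec_of d (\<lambda>i. lim (\<lambda>k. nth_fvec (X k) i))"
  have "X \<longlonglongrightarrow> x"
    by (rule tendsto_fspaceI) (use X lim in \<open>auto simp: x_def\<close>)
  then show "\<exists>l\<in>fspace d. X \<longlonglongrightarrow> l" by (intro bexI[of _ x]) (auto simp: x_def)
qed

text \<open>A grid cell of side s / (d + 1) has diameter below s, so it holds at most one point. The
  summand 3 in the constant pays for rounding the number of cells per axis, using s <= 1.\<close>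

lemma separated_card_bound:
  assumes M: "0 < M"
  shows "\<exists>C>0. \<forall>s Q. 0 < s \<longrightarrow> s \<le> 1 \<longrightarrow> finite Q \<longrightarrow> Q \<subseteq> fspace d \<longrightarrow> (\<forall>x\<in>Q. norm x \<le> M) \<longrightarrow>
    separated s Q \<longrightarrow> real (card Q) \<le> (C / s) ^ d"
proof (intro exI[of _ "2 * M * (real d + 1) + 3"] conjI allI impI)
  fix s :: real and Q
  assume s: "0 < s" "s \<le> 1" and Q: "finite Q" "Q \<subseteq> fspace d" "\<forall>x\<in>Q. norm x \<le> M" "separated s Q"
  define b where "b = s / (real d + 1)"
  define N where "N = \<lceil>M / b\<rceil>"
  have b: "0 < b" using s by (simp add: b_def)
  define cell where "cell x = restrict (\<lambda>i. \<lfloor>nth_fvec x i / b\<rfloor>) {..<d}" for x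
  have "inj_on cell Q"
  proof (rule inj_onI, rule ccontr)
    fix x y assume xy: "x \<in> Q" "y \<in> Q" "cell x = cell y" "x \<noteq> y"
    have "(nth_fvec (x - y) i)\<^sup>2 \<le> b\<^sup>2" if "i < d" for i
    proof -
      have "\<lfloor>nth_fvec x i / b\<rfloor> = \<lfloor>nth_fvec y i / b\<rfloor>"
        using fun_cong[OF xy(3), of i] that by (simp add: cell_def)
      then have "\<bar>nth_fvec x i / b - nth_fvec y i / b\<bar> \<le> 1" by linarith
      then have "\<bar>nth_fvec x i - nth_fvec y i\<bar> \<le> b"
        using b by (simp add: diff_divide_distrib[symmetric] abs_divide)
      then show ?thesis using power_mono[of "\<bar>nth_fvec x i - nth_fvec y i\<bar>" b 2] by simp
    qed
    then have "(\<Sum>i<d. (nth_fvec (x - y) i)\<^sup>2) \<le> (\<Sum>i<d. b\<^sup>2)" by (intro sum_mono) auto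
    moreover have "x - y \<in> fspace d" using xy Q(2) by (intro subspace_diff[OF subspace_fspace]) auto
    ultimately have "(norm (x - y))\<^sup>2 \<le> real d * b\<^sup>2" by (simp add: norm_fspace sum_nonneg)
    moreover have "s\<^sup>2 \<le> (norm (x - y))\<^sup>2"
      using Q(4) xy s unfolding separated_def by (intro power_mono) auto
    moreover have "s\<^sup>2 = (real d + 1)\<^sup>2 * b\<^sup>2" by (simp add: b_def power_divide)
    moreover have "real d < (real d + 1)\<^sup>2"
      by (simp add: power2_eq_square algebra_simps add_pos_nonneg)
    then have "real d * b\<^sup>2 < (real d + 1)\<^sup>2 * b\<^sup>2" using b by (intro mult_strict_right_mono) auto
    ultimately show False by linarith
  qed
  moreover have "cell ` Q \<subseteq> PiE {..<d} (\<lambda>_. {- N..N})"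
  proof (rule image_subsetI)
    fix x assume x: "x \<in> Q"
    show "cell x \<in> PiE {..<d} (\<lambda>_. {- N..N})"
    proof (rule PiE_I)
      fix i assume "i \<in> {..<d}"
      have "\<bar>nth_fvec x i\<bar> \<le> M" using abs_nth_fvec_le[of x i] Q(3) x by force
      then have "nth_fvec x i / b \<le> M / b" "- (M / b) \<le> nth_fvec x i / b"
        using b by (auto simp: divide_right_mono minus_divide_left simp del: minus_divide_left[symmetric])
      then have "\<lfloor>nth_fvec x i / b\<rfloor> \<in> {- N..N}"
        unfolding N_def by (auto intro: order_trans[OF floor_mono floor_le_ceiling]
          simp: le_floor_iff) linarith
      then show "cell x i \<in> {- N..N}" using \<open>i \<in> {..<d}\<close> by (simp add: cell_def)
    qed (simp add: cell_def)
  qed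
  ultimately have "card Q \<le> card (PiE {..<d} (\<lambda>_. {- N..N}))"
    by (intro card_inj_on_le) (auto intro: finite_PiE)
  also have "\<dots> = nat (2 * N + 1) ^ d" by (simp add: card_PiE algebra_simps)
  finally have "real (card Q) \<le> real (nat (2 * N + 1)) ^ d"
    using of_nat_mono by fastforce
  also have "\<dots> \<le> ((2 * M * (real d + 1) + 3) / s) ^ d"
  proof (rule power_mono)
    have "0 < M / b" using M b by simp
    then have "real (nat (2 * N + 1)) = 2 * real_of_int N + 1" by (simp add: N_def)
    also have "\<dots> \<le> 2 * (M / b + 1) + 1"
      using of_int_ceiling_le_add_one[of "M / b"] unfolding N_def by (intro add_right_mono mult_left_mono) auto
    also have "\<dots> = (2 * M * (real d + 1) + 3 * s) / s" using s by (simp add: b_def field_simps)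
    also have "\<dots> \<le> (2 * M * (real d + 1) + 3) / s" using s by (intro divide_right_mono) auto
    finally show "real (nat (2 * N + 1)) \<le> (2 * M * (real d + 1) + 3) / s" .
  qed simp
  finally show "real (card Q) \<le> ((2 * M * (real d + 1) + 3) / s) ^ d" .
qed (use M in \<open>auto intro: add_nonneg_pos\<close>)

text \<open>In a separated set of largest cardinality every point of \<open>A\<close> is within r of
  some member, as otherwise it could be added. So packing bounds become covering bounds.\<close>

lemma maximal_separated:
  fixes A :: "'a::real_normed_vector set"
  assumes "\<And>P. finite P \<Longrightarrow> P \<subseteq> A \<Longrightarrow> separated r P \<Longrightarrow> card P \<le> N" and "0 < r"
  shows "\<exists>P. finite P \<and> P \<subseteq> A \<and> separated r P \<and> (\<forall>x\<in>A. \<exists>p\<in>P. norm (x - p) < r)"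
proof -
  define good where "good P \<longleftrightarrow> finite P \<and> P \<subseteq> A \<and> separated r P" for P
  have "good {}" by (simp add: good_def separated_def)
  moreover have "\<forall>P. good P \<longrightarrow> card P < Suc N" using assms(1) by (auto simp: good_def less_Suc_eq_le)
  ultimately have "\<exists>P. good P \<and> (\<forall>P'. good P' \<longrightarrow> card P' \<le> card P)"
    by (rule ex_has_greatest_nat)
  then obtain P where P: "good P" "\<And>P'. good P' \<Longrightarrow> card P' \<le> card P" by (elim exE conjE) simp
  have "\<exists>p\<in>P. norm (x - p) < r" if "x \<in> A" for x
  proof (rule ccontr)
    assume "\<not> ?thesis"
    then have far: "\<And>p. p \<in> P \<Longrightarrow> r \<le> norm (x - p)" by (simp add: not_less)
    then have "x \<notin> P" using \<open>0 < r\<close> by force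
    moreover have "good (insert x P)"
      using P(1) far that unfolding good_def separated_def by (auto simp: norm_minus_commute)
    ultimately show False using P(2)[of "insert x P"] P(1) by (simp add: good_def)
  qed
  then show ?thesis using P(1) by (intro exI[of _ P]) (simp add: good_def)
qed

text \<open>Vanishing lower Minkowski content in dimension d: finitely many balls of one common
  radius, which may be any suitable one for each \<epsilon>. Countable unions are therefore formed
  only after passing to null sets.\<close>

definition thin :: "nat \<Rightarrow> 'a::real_normed_vector set \<Rightarrow> bool" where
  "thin d A \<longleftrightarrow> (\<forall>\<epsilon>>0. \<exists>P r. finite P \<and> 0 < r \<and> (\<forall>x\<in>A. \<exists>p\<in>P. norm (x - p) < r) \<and> real (card P) * r ^ d < \<epsilon>)"

text \<open>A separated set P in an annulus yields card P times about 1/r separated translates. The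
  packing bound for these, of order r^(-d), gives card P * r^d <= D r, which tends to 0; a maximal P
  also covers.\<close>

lemma thin_stuck:
  assumes "perturbed_landscape (fspace d) e e' F g" and R: "2 \<le> R"
  shows "thin d {x \<in> fspace d. norm x \<le> R \<and> 1 / R \<le> norm x \<and>
    perturbed_landscape.stuck (fspace d) F g x}"
  (is "thin d ?A")
proof -
  interpret perturbed_landscape "fspace d" e e' F g by fact
  from stuck_separated_shift[OF R] obtain c where c: "0 < c" and shift: "\<forall>r>0. \<forall>P K. finite P \<longrightarrow> P \<subseteq> ?A \<longrightarrow>
      separated r P \<longrightarrow> 2 * c * r * real K \<le> 1 \<longrightarrow>
      (\<exists>Q\<subseteq>fspace d. finite Q \<and> card Q = card P * K \<and> (\<forall>x\<in>Q. norm x \<le> 2) \<and> separated (c * r) Q)"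
    by (elim exE conjE) (rule that)
  obtain C where C: "0 < C" and pack: "\<And>s Q. 0 < s \<Longrightarrow> s \<le> 1 \<Longrightarrow> finite Q \<Longrightarrow> Q \<subseteq> fspace d \<Longrightarrow>
      (\<And>x. x \<in> Q \<Longrightarrow> norm x \<le> 2) \<Longrightarrow> separated s Q \<Longrightarrow> real (card Q) \<le> (C / s) ^ d"
    using separated_card_bound[of 2 d] by auto
  show ?thesis unfolding thin_def
  proof (intro allI impI)
    fix \<epsilon> :: real assume \<epsilon>: "0 < \<epsilon>"
    define D where "D = (C / c) ^ d * (4 * c)"
    have D: "0 < D" using C c by (simp add: D_def)
    define r where "r = min (1 / (4 * c)) (\<epsilon> / (2 * D))"
    have r: "0 < r" "r \<le> 1 / (4 * c)" "r \<le> \<epsilon> / (2 * D)" using c \<epsilon> D by (auto simp: r_def)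
    have cr: "0 < c * r" "c * r \<le> 1 / 4" using r c by (auto simp: field_simps)
    \<comment> \<open>The largest number of translates that keeps the total shift at most 1. Since
      1/(2 c r) is at least 2, rounding down loses at most half.\<close>
    define K where "K = nat \<lfloor>1 / (2 * c * r)\<rfloor>"
    have q: "2 \<le> 1 / (2 * c * r)" using cr by (simp add: field_simps)
    have "0 \<le> \<lfloor>1 / (2 * c * r)\<rfloor>" using q by linarith
    then have "real K = real_of_int \<lfloor>1 / (2 * c * r)\<rfloor>" unfolding K_def by (rule of_nat_nat)
    then have K: "real K \<le> 1 / (2 * c * r)" "1 / (2 * c * r) - 1 \<le> real K" by linarith+
    have K1: "2 * c * r * real K \<le> 1" using K(1) cr by (simp add: field_simps)
    have "1 / (4 * c * r) = 1 / (2 * c * r) / 2" by simp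
    then have K2: "1 / (4 * c * r) \<le> real K" using K(2) q by linarith
    have bound: "real (card P) * r ^ d \<le> D * r" if P: "finite P" "P \<subseteq> ?A" "separated r P" for P
    proof -
      obtain Q where Q: "Q \<subseteq> fspace d" "finite Q" "card Q = card P * K" "\<forall>x\<in>Q. norm x \<le> 2" "separated (c * r) Q"
        using shift[rule_format, OF r(1) P K1] by (elim exE conjE) (rule that)
      have "real (card P) * (1 / (4 * c * r)) \<le> real (card P) * real K" using K2 by (intro mult_left_mono) auto
      also have "\<dots> \<le> (C / (c * r)) ^ d" using pack[OF cr(1) _ Q(2,1) _ Q(5)] Q(3,4) cr by simp
      finally have "real (card P) \<le> (C / (c * r)) ^ d * (4 * c * r)" using cr by (simp add: field_simps)
      then have "real (card P) * r ^ d \<le> ((C / (c * r)) ^ d * (4 * c * r)) * r ^ d"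
        using r by (intro mult_right_mono) auto
      also have "\<dots> = (C / (c * r) * r) ^ d * (4 * c) * r"
        by (simp only: power_mult_distrib mult_ac)
      also have "C / (c * r) * r = C / c" using r c by simp
      also have "(C / c) ^ d * (4 * c) * r = D * r" by (simp add: D_def)
      finally show ?thesis .
    qed
    have card: "card P \<le> nat \<lceil>D * r / r ^ d\<rceil>" if "finite P" "P \<subseteq> ?A" "separated r P" for P
    proof -
      have "real (card P) \<le> D * r / r ^ d" using bound[OF that] r by (simp add: field_simps)
      then show ?thesis by linarith
    qed
    obtain P where *: "finite P \<and> P \<subseteq> ?A \<and> separated r P \<and> (\<forall>x\<in>?A. \<exists>p\<in>P. norm (x - p) < r)"
      using maximal_separated[OF card r(1)] by (rule exE)
    note P = *[THEN conjunct1] *[THEN conjunct2, THEN conjunct1]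
      *[THEN conjunct2, THEN conjunct2, THEN conjunct1] *[THEN conjunct2, THEN conjunct2, THEN conjunct2]
    have "D * r \<le> \<epsilon> / 2" using r(3) D by (simp add: field_simps)
    then have "real (card P) * r ^ d < \<epsilon>" using bound[OF P(1-3)] \<epsilon> by linarith
    then show "\<exists>P r. finite P \<and> 0 < r \<and> (\<forall>x\<in>?A. \<exists>p\<in>P. norm (x - p) < r) \<and> real (card P) * r ^ d < \<epsilon>"
      by (intro exI[of _ P] exI[of _ r] conjI P(1,4) r(1))
  qed
qed

section \<open>Null sets\<close>

text \<open>\<open>A\<close> is not known to be measurable, so it is enclosed in a measurable
  intersection of finite unions of cubes. The factor \<rho> undoes the normalisation of the
  signal.\<close>

lemma thin_null:
  assumes A: "thin d A" "A \<subseteq> fspace d" and \<rho>: "0 < \<rho>"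
  shows "AE u in PiM {..<d} (\<lambda>_. lborel). (1 / \<rho>) *\<^sub>R fvec_of d u \<notin> A"
proof -
  interpret product_sigma_finite "\<lambda>_::nat. lborel :: real measure" ..
  let ?M = "PiM {..<d} (\<lambda>_::nat. lborel :: real measure)"
  define cube where "cube p r = PiE {..<d} (\<lambda>i. {\<rho> * (nth_fvec p i - r)..\<rho> * (nth_fvec p i + r)})" for p r
  have cube_sets: "cube p r \<in> sets ?M" for p r
    unfolding cube_def by (rule sets_PiM_I_finite) auto
  have cube_measure: "emeasure ?M (cube p r) = ennreal ((2 * \<rho> * r) ^ d)" if "0 < r" for p r
  proof -
    have "emeasure ?M (cube p r) = (\<Prod>i<d. emeasure lborel {\<rho> * (nth_fvec p i - r)..\<rho> * (nth_fvec p i + r)})"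
      unfolding cube_def by (rule emeasure_PiM) auto
    also have "\<dots> = (\<Prod>i<d. ennreal (2 * \<rho> * r))"
    proof (rule prod.cong)
      fix i
      have "\<rho> * (nth_fvec p i - r) \<le> \<rho> * (nth_fvec p i + r)" using \<rho> that by (intro mult_left_mono) auto
      then show "emeasure lborel {\<rho> * (nth_fvec p i - r)..\<rho> * (nth_fvec p i + r)} = ennreal (2 * \<rho> * r)"
        by (simp add: algebra_simps)
    qed simp
    also have "\<dots> = ennreal ((2 * \<rho> * r) ^ d)" using \<rho> that by (simp add: ennreal_power)
    finally show ?thesis .
  qed
  have "\<exists>P r. finite P \<and> 0 < r \<and> (\<forall>x\<in>A. \<exists>p\<in>P. norm (x - p) < r) \<and> real (card P) * r ^ d < 1 / real (Suc n)" for n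
    using A(1)[unfolded thin_def, rule_format, of "1 / real (Suc n)"] by simp
  then obtain P r where P: "\<And>n. finite (P n)" "\<And>n. 0 < r n" "\<And>n x. x \<in> A \<Longrightarrow> \<exists>p\<in>P n. norm (x - p) < r n"
      "\<And>n. real (card (P n)) * r n ^ d < 1 / real (Suc n)"
    by metis
  define U where "U n = (\<Union>p\<in>P n. cube p (r n))" for n
  have U_sets: "U n \<in> sets ?M" for n
    unfolding U_def using P(1) cube_sets by (intro sets.finite_UN) auto
  have U_measure: "emeasure ?M (U n) \<le> ennreal ((2 * \<rho>) ^ d * (1 / real (Suc n)))" for n
  proof -
    have "emeasure ?M (U n) \<le> (\<Sum>p\<in>P n. emeasure ?M (cube p (r n)))"
      unfolding U_def by (rule emeasure_subadditive_finite) (use P(1) cube_sets in auto)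
    also have "\<dots> = ennreal (real (card (P n)) * (2 * \<rho> * r n) ^ d)"
      using cube_measure[OF P(2)] \<rho> P(2)[of n] by (simp add: ennreal_mult ennreal_of_nat_eq_real_of_nat)
    also have "real (card (P n)) * (2 * \<rho> * r n) ^ d = (2 * \<rho>) ^ d * (real (card (P n)) * r n ^ d)"
      by (simp add: power_mult_distrib)
    also have "ennreal \<dots> \<le> ennreal ((2 * \<rho>) ^ d * (1 / real (Suc n)))"
      using P(4)[of n] \<rho> by (intro ennreal_leI mult_left_mono) auto
    finally show ?thesis .
  qed
  define N where "N = (\<Inter>n. U n)"
  have N_sets: "N \<in> sets ?M" unfolding N_def using U_sets by (intro sets.countable_INT) auto
  have "emeasure ?M N \<le> 0"
  proof (rule LIMSEQ_le_const)
    have "(\<lambda>n. (2 * \<rho>) ^ d * (1 / real (Suc n))) \<longlonglongrightarrow> (2 * \<rho>) ^ d * 0"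
      by (intro tendsto_mult tendsto_const) (use LIMSEQ_inverse_real_of_nat in \<open>simp add: inverse_eq_divide\<close>)
    then show "(\<lambda>n. ennreal ((2 * \<rho>) ^ d * (1 / real (Suc n)))) \<longlonglongrightarrow> 0"
      using tendsto_ennrealI[of "\<lambda>n. (2 * \<rho>) ^ d * (1 / real (Suc n))" 0] by simp
    show "\<exists>N'. \<forall>n\<ge>N'. emeasure ?M N \<le> ennreal ((2 * \<rho>) ^ d * (1 / real (Suc n)))"
    proof (intro exI allI impI)
      fix n
      have "emeasure ?M N \<le> emeasure ?M (U n)" 
        using U_sets[of n] by (intro emeasure_mono) (auto simp: N_def)
      then show "emeasure ?M N \<le> ennreal ((2 * \<rho>) ^ d * (1 / real (Suc n)))" using U_measure by (rule order_trans)
    qed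
  qed
  then have "emeasure ?M N = 0" by simp
  moreover have "{u \<in> space ?M. \<not> (1 / \<rho>) *\<^sub>R fvec_of d u \<notin> A} \<subseteq> N"
  proof
    fix u assume u: "u \<in> {u \<in> space ?M. \<not> (1 / \<rho>) *\<^sub>R fvec_of d u \<notin> A}"
    define x where "x = (1 / \<rho>) *\<^sub>R fvec_of d u"
    have x: "x \<in> A" "u \<in> extensional {..<d}"
      using u unfolding x_def space_PiM by (simp_all add: PiE_iff)
    show "u \<in> N" unfolding N_def
    proof (rule INT_I)
      fix n
      obtain p where p: "p \<in> P n" "norm (x - p) < r n" using P(3)[OF x(1)] by blast
      have "u \<in> cube p (r n)" unfolding cube_def
      proof (rule PiE_I)
        fix i assume i: "i \<in> {..<d}"
        have "\<bar>nth_fvec x i - nth_fvec p i\<bar> < r n"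
          using abs_nth_fvec_le[of "x - p" i] p(2) by simp
        then have "nth_fvec p i - r n \<le> nth_fvec x i" "nth_fvec x i \<le> nth_fvec p i + r n"
          unfolding abs_less_iff by linarith+
        then have "\<rho> * (nth_fvec p i - r n) \<le> \<rho> * nth_fvec x i" "\<rho> * nth_fvec x i \<le> \<rho> * (nth_fvec p i + r n)"
          using \<rho> by (auto intro: mult_left_mono)
        moreover have "\<rho> * nth_fvec x i = u i" using i \<rho> by (simp add: x_def)
        ultimately show "u i \<in> {\<rho> * (nth_fvec p i - r n)..\<rho> * (nth_fvec p i + r n)}" by simp
      qed (use x(2) in \<open>simp add: extensional_def\<close>)
      then show "u \<in> U n" using p(1) by (auto simp: U_def)
    qed
  qed
  ultimately show ?thesis using N_sets by (intro AE_I) auto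
qed

text \<open>The annuli exhaust everything except the origin, which is stationary and has to be
  discarded separately.\<close>

lemma thin_zero:
  assumes "1 \<le> d"
  shows "thin d {0 :: fvec}"
  unfolding thin_def
proof (intro allI impI)
  fix \<epsilon> :: real assume \<epsilon>: "0 < \<epsilon>"
  define r where "r = min (1 / 2) (\<epsilon> / 2)"
  have r: "0 < r" "r \<le> 1" "r < \<epsilon>" using \<epsilon> by (auto simp: r_def)
  have "r ^ d \<le> r ^ 1" using r assms by (intro power_decreasing) auto
  then have "real (card {0 :: fvec}) * r ^ d < \<epsilon>" using r by simp
  then show "\<exists>P r. finite P \<and> 0 < r \<and> (\<forall>x\<in>{0 :: fvec}. \<exists>p\<in>P. norm (x - p) < r) \<and> real (card P) * r ^ d < \<epsilon>"
    using r(1) by (intro exI[of _ "{0}"] exI[of _ r]) simp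
qed

lemma AE_not_stuck:
  assumes "perturbed_landscape (fspace d) e e' F g" and "1 \<le> d" "0 < \<rho>"
  shows "AE u in PiM {..<d} (\<lambda>_. lborel).
    \<not> perturbed_landscape.stuck (fspace d) F g ((1 / \<rho>) *\<^sub>R fvec_of d u)"
proof -
  interpret perturbed_landscape "fspace d" e e' F g by fact
  \<comment> \<open>Annuli with R = n + 2, so that R >= 2 holds for every n.\<close>
  define A where "A n = {x \<in> fspace d. norm x \<le> real n + 2 \<and> 1 / (real n + 2) \<le> norm x \<and> stuck x}" for n :: nat
  have "AE u in PiM {..<d} (\<lambda>_. lborel). \<forall>n. (1 / \<rho>) *\<^sub>R fvec_of d u \<notin> A n"
    unfolding AE_all_countable A_def
    using thin_stuck[OF assms(1)] assms(3) by (intro allI thin_null) auto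
  moreover have "AE u in PiM {..<d} (\<lambda>_. lborel). (1 / \<rho>) *\<^sub>R fvec_of d u \<notin> {0}"
    using assms subspace_0[OF subspace_fspace] by (intro thin_null thin_zero) auto
  ultimately show ?thesis
  proof eventually_elim
    case (elim u)
    define x where "x = (1 / \<rho>) *\<^sub>R fvec_of d u"
    have xV: "x \<in> fspace d" unfolding x_def by (intro subspace_scale[OF subspace_fspace]) simp
    have x0: "0 < norm x" using elim(2) by (simp add: x_def)
    obtain n where n: "max (norm x) (1 / norm x) \<le> real n" using real_arch_simple by blast
    have "1 \<le> real n * norm x" using n x0 by (simp add: field_simps)
    then have "1 \<le> (real n + 2) * norm x" using x0 unfolding distrib_right by linarith
    then have "1 / (real n + 2) \<le> norm x" by (simp add: field_simps)
    then have "\<not> stuck x" using elim(1) xV n unfolding A_def x_def[symmetric] by force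
    then show ?case by (simp add: x_def)
  qed
qed

section \<open>From tensors to the perturbed loss\<close>

text \<open>\<open>J\<close> is multiplication by the imaginary unit. Moving it from the measurement
  vectors to the arguments expresses loss and gradient by the tensor T of the vectors
  \<open>b i\<close> alone, applied to x, e and their images under \<open>J\<close>; this is why a
  bound on T suffices. \<open>e\<close> is not yet normalised, so the zero signal is
  included.\<close>

locale tensor_data =
  fixes V :: "'a::real_inner set" and J :: "'a \<Rightarrow> 'a" and b b' :: "nat \<Rightarrow> 'a" and m :: nat and c :: real and e :: 'a
  assumes subV: "subspace V" and complV: "complete V"
    and linJ: "linear J" and JV: "x \<in> V \<Longrightarrow> J x \<in> V"
    and J_inner: "\<lbrakk>x \<in> V; y \<in> V\<rbrakk> \<Longrightarrow> J x \<bullet> J y = x \<bullet> y" and JJ: "x \<in> V \<Longrightarrow> J (J x) = - x"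
    and bV: "b i \<in> V" "b' i \<in> V" and b'J: "x \<in> V \<Longrightarrow> b' i \<bullet> x = b i \<bullet> J x"
    and c: "0 < c" and e_in_V: "e \<in> V"
    and tens: "\<lbrakk>u1 \<in> V; u2 \<in> V; u3 \<in> V; u4 \<in> V\<rbrakk> \<Longrightarrow>
      \<bar>(\<Sum>i<m. (b i \<bullet> u1) * (b i \<bullet> u2) * (b i \<bullet> u3) * (b i \<bullet> u4)) / c
        - ((u1 \<bullet> u2) * (u3 \<bullet> u4) + (u1 \<bullet> u3) * (u2 \<bullet> u4) + (u1 \<bullet> u4) * (u2 \<bullet> u3))\<bar>
      \<le> 1 / 10000 * (norm u1 * norm u2 * norm u3 * norm u4)"
begin

text \<open>\<open>\<tau>\<close>, \<open>sy\<close> and \<open>err\<close> are T, S and T - S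
  contracted with four vectors.\<close>

definition \<tau> where "\<tau> u1 u2 u3 u4 = (\<Sum>i<m. (b i \<bullet> u1) * (b i \<bullet> u2) * (b i \<bullet> u3) * (b i \<bullet> u4)) / c"
definition sy :: "'a \<Rightarrow> 'a \<Rightarrow> 'a \<Rightarrow> 'a \<Rightarrow> real" where
  "sy u1 u2 u3 u4 = (u1 \<bullet> u2) * (u3 \<bullet> u4) + (u1 \<bullet> u3) * (u2 \<bullet> u4) + (u1 \<bullet> u4) * (u2 \<bullet> u3)"
definition err where "err u1 u2 u3 u4 = \<tau> u1 u2 u3 u4 - sy u1 u2 u3 u4"

definition qf where "qf i x = (b i \<bullet> x)\<^sup>2 + (b' i \<bullet> x)\<^sup>2"
definition F where "F x = (\<Sum>i<m. (qf i x - qf i e)\<^sup>2) / (16 * c)"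
definition g where
  "g x = (1 / (4 * c)) *\<^sub>R (\<Sum>i<m. (qf i x - qf i e) *\<^sub>R ((b i \<bullet> x) *\<^sub>R b i + (b' i \<bullet> x) *\<^sub>R b' i))"

lemma norm_J: "x \<in> V \<Longrightarrow> norm (J x) = norm x"
  by (simp add: norm_eq_sqrt_inner J_inner)

lemma J_skew: "\<lbrakk>x \<in> V; y \<in> V\<rbrakk> \<Longrightarrow> x \<bullet> J y = - (J x \<bullet> y)"
  using J_inner[of x "J y"] JV[of y] JJ[of y] by simp

lemma J_self: "x \<in> V \<Longrightarrow> x \<bullet> J x = 0" "x \<in> V \<Longrightarrow> J x \<bullet> x = 0"
  using J_skew[of x x] inner_commute[of x "J x"] by auto

lemma err_bound:
  assumes "u1 \<in> V" "u2 \<in> V" "u3 \<in> V" "u4 \<in> V"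
    and "norm u1 \<le> c1" "norm u2 \<le> c2" "norm u3 \<le> c3" "norm u4 \<le> c4"
  shows "\<bar>err u1 u2 u3 u4\<bar> \<le> 1 / 10000 * (c1 * c2 * c3 * c4)"
proof -
  have "0 \<le> c1" "0 \<le> c2" "0 \<le> c3" using assms(5-7) norm_ge_zero order_trans by blast+
  then have "norm u1 * norm u2 * norm u3 * norm u4 \<le> c1 * c2 * c3 * c4"
    using assms(5-8) by (intro mult_mono mult_nonneg_nonneg norm_ge_zero)
  then show ?thesis using tens[OF assms(1-4)] unfolding err_def \<tau>_def sy_def by linarith
qed

lemma err_diff:
  "err (x - y) u2 u3 u4 = err x u2 u3 u4 - err y u2 u3 u4"
  "err u1 (x - y) u3 u4 = err u1 x u3 u4 - err u1 y u3 u4"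
  "err u1 u2 (x - y) u4 = err u1 u2 x u4 - err u1 u2 y u4"
  by (simp_all add: err_def \<tau>_def sy_def inner_diff_left inner_diff_right left_diff_distrib right_diff_distrib
      sum_subtractf diff_divide_distrib)

text \<open>Telescoping, with one argument replaced at a time: three terms, each with one difference
  and two vectors of norm at most R.\<close>

lemma err_cubic_diff:
  assumes V: "x1 \<in> V" "x2 \<in> V" "x3 \<in> V" "y1 \<in> V" "y2 \<in> V" "y3 \<in> V" "w \<in> V"
    and x: "norm x1 \<le> R" "norm x2 \<le> R" "norm x3 \<le> R" and y: "norm y1 \<le> R" "norm y2 \<le> R" "norm y3 \<le> R"
    and d: "norm (x1 - y1) \<le> D" "norm (x2 - y2) \<le> D" "norm (x3 - y3) \<le> D" and w: "norm w \<le> N"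
  shows "\<bar>err x1 x2 x3 w - err y1 y2 y3 w\<bar> \<le> 3 / 10000 * (R\<^sup>2 * D * N)"
proof -
  define B where "B = R\<^sup>2 * D * N"
  have "err x1 x2 x3 w - err y1 y2 y3 w = err (x1 - y1) x2 x3 w + err y1 (x2 - y2) x3 w + err y1 y2 (x3 - y3) w"
    by (simp add: err_diff)
  moreover have "\<bar>err (x1 - y1) x2 x3 w\<bar> \<le> 1 / 10000 * (D * R * R * N)"
    by (rule err_bound) (use assms subspace_diff[OF subV] in auto)
  then have "\<bar>err (x1 - y1) x2 x3 w\<bar> \<le> 1 / 10000 * B" unfolding B_def by (simp only: power2_eq_square mult_ac)
  moreover have "\<bar>err y1 (x2 - y2) x3 w\<bar> \<le> 1 / 10000 * (R * D * R * N)"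
    by (rule err_bound) (use assms subspace_diff[OF subV] in auto)
  then have "\<bar>err y1 (x2 - y2) x3 w\<bar> \<le> 1 / 10000 * B" unfolding B_def by (simp only: power2_eq_square mult_ac)
  moreover have "\<bar>err y1 y2 (x3 - y3) w\<bar> \<le> 1 / 10000 * (R * R * D * N)"
    by (rule err_bound) (use assms subspace_diff[OF subV] in auto)
  then have "\<bar>err y1 y2 (x3 - y3) w\<bar> \<le> 1 / 10000 * B" unfolding B_def by (simp only: power2_eq_square mult_ac)
  ultimately have "\<bar>err x1 x2 x3 w - err y1 y2 y3 w\<bar> \<le> 3 / 10000 * B" unfolding abs_le_iff by linarith
  then show ?thesis by (simp add: B_def)
qed

lemma inner_g:
  assumes "x \<in> V" "v \<in> V"
  shows "4 * (g x \<bullet> v) = \<tau> x x x v + \<tau> x x (J x) (J v) + \<tau> (J x) (J x) x v + \<tau> (J x) (J x) (J x) (J v)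
    - (\<tau> e e x v + \<tau> e e (J x) (J v) + \<tau> (J e) (J e) x v + \<tau> (J e) (J e) (J x) (J v))"
proof -
  have "4 * (g x \<bullet> v) = (\<Sum>i<m. (qf i x - qf i e) * ((b i \<bullet> x) * (b i \<bullet> v) + (b i \<bullet> J x) * (b i \<bullet> J v))) / c"
    using assms by (simp add: g_def inner_sum_left inner_add_left b'J)
  also have "(\<Sum>i<m. (qf i x - qf i e) * ((b i \<bullet> x) * (b i \<bullet> v) + (b i \<bullet> J x) * (b i \<bullet> J v)))
    = (\<Sum>i<m. (b i \<bullet> x) * (b i \<bullet> x) * (b i \<bullet> x) * (b i \<bullet> v) + (b i \<bullet> x) * (b i \<bullet> x) * (b i \<bullet> J x) * (b i \<bullet> J v)
      + (b i \<bullet> J x) * (b i \<bullet> J x) * (b i \<bullet> x) * (b i \<bullet> v) + (b i \<bullet> J x) * (b i \<bullet> J x) * (b i \<bullet> J x) * (b i \<bullet> J v)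
      - ((b i \<bullet> e) * (b i \<bullet> e) * (b i \<bullet> x) * (b i \<bullet> v) + (b i \<bullet> e) * (b i \<bullet> e) * (b i \<bullet> J x) * (b i \<bullet> J v)
      + (b i \<bullet> J e) * (b i \<bullet> J e) * (b i \<bullet> x) * (b i \<bullet> v) + (b i \<bullet> J e) * (b i \<bullet> J e) * (b i \<bullet> J x) * (b i \<bullet> J v)))"
    by (rule sum.cong) (use assms e_in_V in \<open>simp_all add: qf_def b'J power2_eq_square algebra_simps\<close>)
  finally show ?thesis
    by (simp add: \<tau>_def sum.distrib sum_subtractf add_divide_distrib diff_divide_distrib)
qed

lemma F_eq:
  assumes "x \<in> V"
  shows "16 * F x = \<tau> x x x x + 2 * \<tau> x x (J x) (J x) + \<tau> (J x) (J x) (J x) (J x)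
    - 2 * (\<tau> x x e e + \<tau> x x (J e) (J e) + \<tau> (J x) (J x) e e + \<tau> (J x) (J x) (J e) (J e))
    + \<tau> e e e e + 2 * \<tau> e e (J e) (J e) + \<tau> (J e) (J e) (J e) (J e)"
proof -
  have "(\<Sum>i<m. (qf i x - qf i e)\<^sup>2)
    = (\<Sum>i<m. (b i \<bullet> x) * (b i \<bullet> x) * (b i \<bullet> x) * (b i \<bullet> x) + 2 * ((b i \<bullet> x) * (b i \<bullet> x) * (b i \<bullet> J x) * (b i \<bullet> J x))
      + (b i \<bullet> J x) * (b i \<bullet> J x) * (b i \<bullet> J x) * (b i \<bullet> J x)
      - 2 * ((b i \<bullet> x) * (b i \<bullet> x) * (b i \<bullet> e) * (b i \<bullet> e) + (b i \<bullet> x) * (b i \<bullet> x) * (b i \<bullet> J e) * (b i \<bullet> J e)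
      + (b i \<bullet> J x) * (b i \<bullet> J x) * (b i \<bullet> e) * (b i \<bullet> e) + (b i \<bullet> J x) * (b i \<bullet> J x) * (b i \<bullet> J e) * (b i \<bullet> J e))
      + (b i \<bullet> e) * (b i \<bullet> e) * (b i \<bullet> e) * (b i \<bullet> e) + 2 * ((b i \<bullet> e) * (b i \<bullet> e) * (b i \<bullet> J e) * (b i \<bullet> J e))
      + (b i \<bullet> J e) * (b i \<bullet> J e) * (b i \<bullet> J e) * (b i \<bullet> J e))"
    by (rule sum.cong) (use assms e_in_V in \<open>simp_all add: qf_def b'J power2_eq_square algebra_simps\<close>)
  moreover have "16 * F x = (\<Sum>i<m. (qf i x - qf i e)\<^sup>2) / c" by (simp add: F_def)
  ultimately show ?thesis
    by (simp add: \<tau>_def sum.distrib sum_subtractf sum_distrib_left[symmetric] add_divide_distrib diff_divide_distrib)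
qed

lemma g_V: "g x \<in> V"
  unfolding g_def using subV bV by (intro subspace_scale subspace_sum subspace_add)

lemma g_at_zero: "g 0 = 0"
  by (simp add: g_def)

lemma F_nonneg: "0 \<le> F x"
  unfolding F_def using c by (intro divide_nonneg_pos sum_nonneg) auto

lemma deriv_F: "((\<lambda>t. F (x + t *\<^sub>R v)) has_real_derivative (g (x + t *\<^sub>R v) \<bullet> v)) (at t)"
proof -
  have "(\<lambda>t. F (x + t *\<^sub>R v)) = (\<lambda>t. (\<Sum>i<m. ((b i \<bullet> x + t * (b i \<bullet> v))\<^sup>2 + (b' i \<bullet> x + t * (b' i \<bullet> v))\<^sup>2 - qf i e)\<^sup>2) / (16 * c))"
    by (simp add: F_def qf_def inner_add_right)
  moreover have "((\<lambda>t. (\<Sum>i<m. ((b i \<bullet> x + t * (b i \<bullet> v))\<^sup>2 + (b' i \<bullet> x + t * (b' i \<bullet> v))\<^sup>2 - qf i e)\<^sup>2) / (16 * c))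
    has_real_derivative ((\<Sum>i<m. 2 * ((b i \<bullet> x + t * (b i \<bullet> v))\<^sup>2 + (b' i \<bullet> x + t * (b' i \<bullet> v))\<^sup>2 - qf i e)
      * (2 * (b i \<bullet> x + t * (b i \<bullet> v)) * (b i \<bullet> v) + 2 * (b' i \<bullet> x + t * (b' i \<bullet> v)) * (b' i \<bullet> v))) / (16 * c))) (at t)"
    by (auto intro!: DERIV_cdivide DERIV_sum derivative_eq_intros simp: algebra_simps)
  moreover have "(\<Sum>i<m. 2 * ((b i \<bullet> x + t * (b i \<bullet> v))\<^sup>2 + (b' i \<bullet> x + t * (b' i \<bullet> v))\<^sup>2 - qf i e)
      * (2 * (b i \<bullet> x + t * (b i \<bullet> v)) * (b i \<bullet> v) + 2 * (b' i \<bullet> x + t * (b' i \<bullet> v)) * (b' i \<bullet> v))) / (16 * c)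
    = g (x + t *\<^sub>R v) \<bullet> v"
  proof -
    have "(\<Sum>i<m. 2 * ((b i \<bullet> x + t * (b i \<bullet> v))\<^sup>2 + (b' i \<bullet> x + t * (b' i \<bullet> v))\<^sup>2 - qf i e)
      * (2 * (b i \<bullet> x + t * (b i \<bullet> v)) * (b i \<bullet> v) + 2 * (b' i \<bullet> x + t * (b' i \<bullet> v)) * (b' i \<bullet> v)))
     = 4 * (\<Sum>i<m. (qf i (x + t *\<^sub>R v) - qf i e) * ((b i \<bullet> (x + t *\<^sub>R v)) * (b i \<bullet> v) + (b' i \<bullet> (x + t *\<^sub>R v)) * (b' i \<bullet> v)))"
      unfolding sum_distrib_left by (rule sum.cong) (simp_all add: qf_def inner_add_right algebra_simps)
    then show ?thesis by (simp add: g_def inner_sum_left inner_add_left)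
  qed
  ultimately show ?thesis by simp
qed

text \<open>Intensities do not see a global phase, and k + i s is a unit complex number.\<close>

lemma qf_circle:
  assumes "k\<^sup>2 + s\<^sup>2 = 1"
  shows "qf i (k *\<^sub>R e + s *\<^sub>R J e) = qf i e"
proof -
  have "b' i \<bullet> J e = - (b i \<bullet> e)" using b'J[OF JV[OF e_in_V]] JJ[OF e_in_V] by simp
  then have "qf i (k *\<^sub>R e + s *\<^sub>R J e) = (k\<^sup>2 + s\<^sup>2) * qf i e"
    using b'J[OF e_in_V, of i] by (simp add: qf_def inner_add_right power2_eq_square algebra_simps)
  then show ?thesis using assms by simp
qed

lemma perturbed_landscape:
  assumes e1: "e \<bullet> e = 1"
  shows "perturbed_landscape V e (J e) F g"
proof -
  interpret orthonormal_pair V e "J e"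
    by unfold_locales (use subV e_in_V JV e1 J_inner J_self in auto)
  have ne: "norm e = 1" "norm (J e) = 1" using e1 norm_J[OF e_in_V] by (simp_all add: norm_eq_sqrt_inner)
  have K: "J y \<bullet> e = - (y \<bullet> J e)" "e \<bullet> J y = - (y \<bullet> J e)" "J e \<bullet> J y = y \<bullet> e" "J y \<bullet> J e = y \<bullet> e"
    "e \<bullet> y = y \<bullet> e" "J e \<bullet> y = y \<bullet> J e" "J y \<bullet> J y = y \<bullet> y" "y \<bullet> J y = 0" "J y \<bullet> y = 0" if "y \<in> V" for y
    using J_skew[OF that e_in_V] J_inner[OF that e_in_V] J_inner[OF e_in_V that] J_inner[OF that that] J_self[OF that]
      inner_commute[of e "J y"] inner_commute[of e y] inner_commute[of "J e" y] by simp_all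
  \<comment> \<open>Putting S in place of T in the formula for the gradient gives exactly
    \<open>g0\<close>, so the deviation is the same combination of contractions of T - S.\<close>
  have h: "4 * ((g x - g0 x) \<bullet> v) = err x x x v + err x x (J x) (J v) + err (J x) (J x) x v + err (J x) (J x) (J x) (J v)
    - (err e e x v + err e e (J x) (J v) + err (J e) (J e) x v + err (J e) (J e) (J x) (J v))"
    if "x \<in> V" "v \<in> V" for x v
  proof -
    have "g0 x \<bullet> v = (sy x x x v + sy x x (J x) (J v) + sy (J x) (J x) x v + sy (J x) (J x) (J x) (J v)
      - (sy e e x v + sy e e (J x) (J v) + sy (J e) (J e) x v + sy (J e) (J e) (J x) (J v))) / 4"
      unfolding sy_def g0_def pl_def inner_diff_left inner_add_left inner_scaleR_left
      by (simp add: K[OF that(1)] K[OF that(2)] J_inner[OF that] J_inner[OF e_in_V e_in_V] e1 algebra_simps)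
    then show ?thesis unfolding inner_diff_left right_diff_distrib inner_g[OF that] err_def by simp
  qed
  show ?thesis
  proof unfold_locales
    show "complete V" by (rule complV)
    show "g x \<in> V" for x by (rule g_V)
    show "g 0 = 0" by (rule g_at_zero)
    show "0 \<le> F x" for x by (rule F_nonneg)
    show "((\<lambda>t. F (x + t *\<^sub>R v)) has_real_derivative (g (x + t *\<^sub>R v) \<bullet> v)) (at t)" for x v t by (rule deriv_F)
    show "F (k *\<^sub>R e + s *\<^sub>R J e) = 0" if "k\<^sup>2 + s\<^sup>2 = 1" for k s by (simp add: F_def qf_circle[OF that])
    show "g (k *\<^sub>R e + s *\<^sub>R J e) = 0" if "k\<^sup>2 + s\<^sup>2 = 1" for k s by (simp add: g_def qf_circle[OF that])
  next
    fix x y :: 'a and R :: real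
    assume xy: "x \<in> V" "y \<in> V" "norm x \<le> R" "norm y \<le> R"
    \<comment> \<open>The norm is obtained by duality: the difference is tested against itself, and
      one factor N cancels at the end.\<close>
    define v where "v = (g x - g0 x) - (g y - g0 y)"
    define D N where "D = norm (x - y)" and "N = norm v"
    have g0V: "g0 z \<in> V" if "z \<in> V" for z
      unfolding g0_def using that subV pl_V by (intro subspace_diff subspace_scale)
    have vV: "v \<in> V" unfolding v_def using g0V g_V xy(1,2) subV by (intro subspace_diff)
    have J: "J x \<in> V" "J y \<in> V" "J v \<in> V" "J e \<in> V" "norm (J x) \<le> R" "norm (J y) \<le> R" "norm (J v) = N"
      "norm (J x - J y) = D"
      using xy vV e_in_V norm_J[OF vV] norm_J[OF xy(1)] norm_J[OF xy(2)] norm_J[OF subspace_diff[OF subV xy(1,2)]]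
      unfolding linear_diff[OF linJ, of x y] N_def D_def by (simp_all add: JV)
    have nD: "norm (x - y) \<le> D" "norm v \<le> N" "norm (J x - J y) \<le> D" "norm (J v) \<le> N"
      using J by (simp_all add: D_def N_def)
    have cub: "\<bar>err x x x v - err y y y v\<bar> \<le> 3 / 10000 * (R\<^sup>2 * D * N)"
      "\<bar>err x x (J x) (J v) - err y y (J y) (J v)\<bar> \<le> 3 / 10000 * (R\<^sup>2 * D * N)"
      "\<bar>err (J x) (J x) x v - err (J y) (J y) y v\<bar> \<le> 3 / 10000 * (R\<^sup>2 * D * N)"
      "\<bar>err (J x) (J x) (J x) (J v) - err (J y) (J y) (J y) (J v)\<bar> \<le> 3 / 10000 * (R\<^sup>2 * D * N)"
      by (rule err_cubic_diff; fact)+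
    have lin: "\<bar>err p q x v - err p q y v\<bar> \<le> 1 / 10000 * (D * N)"
      "\<bar>err p q (J x) (J v) - err p q (J y) (J v)\<bar> \<le> 1 / 10000 * (D * N)"
      if "p \<in> V" "q \<in> V" "norm p = 1" "norm q = 1" for p q
      using err_bound[OF that(1,2) subspace_diff[OF subV xy(1,2)] vV _ _ nD(1,2), of 1 1]
        err_bound[OF that(1,2) subspace_diff[OF subV J(1,2)] J(3) _ _ nD(3,4), of 1 1] that(3,4)
      by (simp_all add: err_diff)
    note lin' = lin[OF e_in_V e_in_V ne(1) ne(1)] lin[OF J(4) J(4) ne(2) ne(2)]
    have "v \<bullet> v \<le> (3 * R\<^sup>2 + 1) / 10000 * D * N"
    proof -
      have "4 * (v \<bullet> v) = 4 * ((g x - g0 x) \<bullet> v) - 4 * ((g y - g0 y) \<bullet> v)" by (simp add: v_def inner_diff_left)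
      then have "4 * (v \<bullet> v) \<le> 12 / 10000 * (R\<^sup>2 * D * N) + 4 / 10000 * (D * N)"
        unfolding h[OF xy(1) vV] h[OF xy(2) vV] using cub lin' unfolding abs_le_iff by linarith
      then show ?thesis by (simp add: field_simps)
    qed
    then have "N * N \<le> (3 * R\<^sup>2 + 1) / 10000 * D * N" by (simp add: N_def dot_square_norm power2_eq_square)
    moreover have "0 \<le> (3 * R\<^sup>2 + 1) / 10000 * D" by (simp add: D_def)
    ultimately have "N \<le> (3 * R\<^sup>2 + 1) / 10000 * D"
      by (cases "N = 0") (auto simp: N_def mult_le_cancel_right)
    then show "norm ((g x - g0 x) - (g y - g0 y)) \<le> (3 * R\<^sup>2 + 1) / 10000 * norm (x - y)"
      by (simp add: N_def D_def v_def)
  next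
    fix x assume x: "x \<in> V"
    define r where "r = norm x"
    have J: "J x \<in> V" "J e \<in> V" "norm (J x) \<le> r" "norm x \<le> r" "norm e \<le> 1" "norm (J e) \<le> 1"
      using x e_in_V JV norm_J ne by (auto simp: r_def)
    have r: "x \<bullet> x = r\<^sup>2" by (simp add: r_def power2_norm_eq_inner)
    have F0': "16 * F0 x = sy x x x x + 2 * sy x x (J x) (J x) + sy (J x) (J x) (J x) (J x)
      - 2 * (sy x x e e + sy x x (J e) (J e) + sy (J x) (J x) e e + sy (J x) (J x) (J e) (J e))
      + sy e e e e + 2 * sy e e (J e) (J e) + sy (J e) (J e) (J e) (J e)"
      unfolding sy_def F0_def m2_def
      by (simp add: K[OF x] K(8,9)[OF e_in_V] J_inner[OF e_in_V e_in_V] e1 power2_eq_square field_simps)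
    have Fd: "16 * F x - 16 * F0 x = err x x x x + 2 * err x x (J x) (J x) + err (J x) (J x) (J x) (J x)
      - 2 * err x x e e - 2 * err x x (J e) (J e) - 2 * err (J x) (J x) e e - 2 * err (J x) (J x) (J e) (J e)
      + err e e e e + 2 * err e e (J e) (J e) + err (J e) (J e) (J e) (J e)"
      unfolding F_eq[OF x] F0' err_def by simp
    define A4 A2 where "A4 = r * r * r * r" and "A2 = r * r"
    have q: "\<bar>err p p p' p'\<bar> \<le> 1 / 10000 * A4"
      if "p \<in> V" "p' \<in> V" "norm p \<le> r" "norm p' \<le> r" for p p'
      unfolding A4_def using that by (intro err_bound)
    have m: "\<bar>err p p p' p'\<bar> \<le> 1 / 10000 * A2"
      if "p \<in> V" "p' \<in> V" "norm p \<le> r" "norm p' \<le> 1" for p p'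
      using err_bound[OF that(1,1,2,2,3,3,4,4)] by (simp add: A2_def)
    have z: "\<bar>err p p p' p'\<bar> \<le> 1 / 10000"
      if "p \<in> V" "p' \<in> V" "norm p \<le> 1" "norm p' \<le> 1" for p p'
      using err_bound[OF that(1,1,2,2,3,3,4,4)] by simp
    \<comment> \<open>The absolute coefficients in \<open>Fd\<close> add up to 4, 8 and 4 for the
      quartic, quadratic and constant terms; the divisor is 16 * 10000.\<close>
    have "\<bar>F x - F0 x\<bar> \<le> 1 / 40000 * A4 + 1 / 20000 * A2 + 1 / 40000"
      using Fd q[OF x x J(4,4)] q[OF x J(1) J(4,3)] q[OF J(1,1) J(3,3)]
        m[OF x e_in_V J(4,5)] m[OF x J(2) J(4,6)] m[OF J(1) e_in_V J(3,5)] m[OF J(1,2) J(3,6)]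
        z[OF e_in_V e_in_V J(5,5)] z[OF e_in_V J(2) J(5,6)] z[OF J(2,2) J(6,6)]
      unfolding abs_le_iff by linarith
    also have "\<dots> = (x \<bullet> x + 1)\<^sup>2 / 40000" unfolding r A4_def A2_def by (simp add: power2_eq_square field_simps)
    finally show "\<bar>F x - F0 x\<bar> \<le> (x \<bullet> x + 1)\<^sup>2 / 40000" .
  qed
qed

text \<open>Without a signal the gradient for S is 2 |x|^2 x, and T - S changes it by a relative
  amount only. It vanishes to third order at the minimiser, so no linear contraction is available
  there.\<close>

lemma zero_signal_gradient:
  assumes e0: "e = 0" and x: "x \<in> V"
  shows "norm x ^ 4 \<le> x \<bullet> g x" "norm (g x) \<le> 3 * norm x ^ 3"
proof -
  define r where "r = norm x"
  have J: "J x \<in> V" "norm (J x) = r" "J 0 = 0" using x JV norm_J linear_0[OF linJ] by (auto simp: r_def)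
  have xx: "x \<bullet> x = r\<^sup>2" by (simp add: r_def power2_norm_eq_inner)
  have gv: "\<bar>g x \<bullet> v - 2 * r\<^sup>2 * (x \<bullet> v)\<bar> \<le> 1 / 10000 * (r ^ 3 * norm v)" if v: "v \<in> V" for v
  proof -
    have Jv: "J v \<in> V" "norm (J v) = norm v" using v JV norm_J by auto
    have "4 * (g x \<bullet> v) = \<tau> x x x v + \<tau> x x (J x) (J v) + \<tau> (J x) (J x) x v + \<tau> (J x) (J x) (J x) (J v)"
      unfolding inner_g[OF x v] using e0 J(3) by (simp add: \<tau>_def)
    moreover have "8 * r\<^sup>2 * (x \<bullet> v) = sy x x x v + sy x x (J x) (J v) + sy (J x) (J x) x v + sy (J x) (J x) (J x) (J v)"
      unfolding sy_def xx[symmetric]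
      by (simp add: J_inner[OF x x] J_inner[OF x v] J_self[OF x] algebra_simps)
    ultimately have eq: "4 * (g x \<bullet> v - 2 * r\<^sup>2 * (x \<bullet> v))
        = err x x x v + err x x (J x) (J v) + err (J x) (J x) x v + err (J x) (J x) (J x) (J v)"
      unfolding err_def by simp
    have E: "\<bar>err p p q w\<bar> \<le> 1 / 10000 * (r * r * r * norm v)"
      if "p \<in> V" "q \<in> V" "w \<in> V" "norm p = r" "norm q = r" "norm w = norm v" for p q w
      using that by (intro err_bound) auto
    have nx: "norm x = r" by (simp add: r_def)
    define B X where "B = r * r * r * norm v" and "X = g x \<bullet> v - 2 * r\<^sup>2 * (x \<bullet> v)"
    have "\<bar>X\<bar> \<le> 1 / 10000 * B"
      using eq E[OF x x v nx nx refl] E[OF x J(1) Jv(1) nx J(2) Jv(2)] E[OF J(1) x v J(2) nx refl]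
        E[OF J(1,1) Jv(1) J(2,2) Jv(2)]
      unfolding abs_le_iff B_def[symmetric] X_def[symmetric] by linarith
    then show ?thesis by (simp add: B_def X_def power3_eq_cube)
  qed
  have r0: "0 \<le> r" by (simp add: r_def)
  have p4: "r ^ 3 * norm x = r ^ 4" "r\<^sup>2 * r\<^sup>2 = r ^ 4" by (simp_all add: r_def eval_nat_numeral)
  have "0 \<le> r ^ 4" by simp
  then show "norm x ^ 4 \<le> x \<bullet> g x"
    using gv[OF x] p4 unfolding xx inner_commute[of x "g x"] r_def[symmetric] abs_le_iff by simp
  show "norm (g x) \<le> 3 * norm x ^ 3"
  proof -
    define N where "N = norm (g x)"
    have "2 * r\<^sup>2 * (x \<bullet> g x) \<le> 2 * r\<^sup>2 * (r * N)"
      unfolding N_def r_def by (intro mult_left_mono norm_cauchy_schwarz) auto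
    also have "\<dots> = 2 * (r ^ 3 * N)" by (simp add: eval_nat_numeral)
    finally have "g x \<bullet> g x \<le> 2 * (r ^ 3 * N) + 1 / 10000 * (r ^ 3 * N)"
      using gv[OF g_V[of x]] unfolding abs_le_iff N_def by (simp add: inner_commute)
    moreover have "0 \<le> r ^ 3 * N" using r0 by (simp add: N_def)
    ultimately have "N * N \<le> 3 * r ^ 3 * N" by (simp add: N_def dot_square_norm power2_eq_square)
    then have "N \<le> 3 * r ^ 3" using r0 by (cases "N = 0") (auto simp: N_def mult_le_cancel_right)
    then show ?thesis by (simp add: N_def r_def)
  qed
qed

text \<open>The squared norm loses at least the step size times |x|^4, hence cannot stay away from
  0. The factor 9 R^2 in the step condition comes from squaring the gradient bound 3 |x|^3.\<close>

lemma zero_signal_converges: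
  assumes e0: "e = 0" and x: "x \<in> V" "norm x \<le> R" and R: "0 < R"
    and \<alpha>: "\<And>k. 0 < \<alpha> k" "\<And>k. \<alpha> k * (9 * R\<^sup>2) \<le> 1" "\<not> summable \<alpha>"
  shows "grad_steps g \<alpha> x \<longlonglongrightarrow> 0"
proof -
  define y where "y = grad_steps g \<alpha> x"
  define r where "r k = norm (y k)" for k
  have yV: "y k \<in> V" for k
    unfolding y_def by (induction k) (auto intro!: x subspace_diff[OF subV] subspace_scale[OF subV] g_V)
  have step: "(r (Suc k))\<^sup>2 \<le> (r k)\<^sup>2 - \<alpha> k * r k ^ 4" if "r k \<le> R" for k
  proof -
    note G = zero_signal_gradient[OF e0 yV[of k], folded r_def]
    have "(r (Suc k))\<^sup>2 = (r k)\<^sup>2 - 2 * (\<alpha> k * (y k \<bullet> g (y k))) + (\<alpha> k)\<^sup>2 * (norm (g (y k)))\<^sup>2"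
      unfolding r_def power2_norm_eq_inner y_def
      by (simp add: inner_diff_left inner_diff_right inner_commute power2_eq_square algebra_simps)
    moreover have "\<alpha> k * r k ^ 4 \<le> \<alpha> k * (y k \<bullet> g (y k))"
      using G(1) \<alpha>(1)[of k] by (intro mult_left_mono) auto
    moreover have "(\<alpha> k)\<^sup>2 * (norm (g (y k)))\<^sup>2 \<le> \<alpha> k * r k ^ 4"
    proof -
      have "(norm (g (y k)))\<^sup>2 \<le> (3 * r k ^ 3)\<^sup>2" using G(2) by (intro power_mono) auto
      also have "\<dots> = 9 * (r k)\<^sup>2 * r k ^ 4" by (simp add: eval_nat_numeral)
      also have "\<dots> \<le> 9 * R\<^sup>2 * r k ^ 4"
        using that by (intro mult_right_mono mult_left_mono power_mono) (auto simp: r_def)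
      finally have "\<alpha> k * (\<alpha> k * (norm (g (y k)))\<^sup>2) \<le> \<alpha> k * (\<alpha> k * (9 * R\<^sup>2 * r k ^ 4))"
        using \<alpha>(1)[of k] by (intro mult_left_mono) auto
      also have "\<dots> = \<alpha> k * ((\<alpha> k * (9 * R\<^sup>2)) * r k ^ 4)" by simp
      also have "\<dots> \<le> \<alpha> k * (1 * r k ^ 4)"
        using \<alpha>(1,2)[of k] by (intro mult_left_mono mult_right_mono) (auto simp: r_def)
      finally show ?thesis by (simp add: power2_eq_square mult.assoc)
    qed
    ultimately show ?thesis by linarith
  qed
  have pos: "0 \<le> \<alpha> k * r k ^ 4" for k using \<alpha>(1)[of k] by (simp add: r_def)
  have mono: "r (Suc k) \<le> r k" if "r k \<le> R" for k
  proof (rule power2_le_imp_le)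
    show "(r (Suc k))\<^sup>2 \<le> (r k)\<^sup>2" using step[OF that] pos[of k] by linarith
    show "0 \<le> r k" by (simp add: r_def)
  qed
  have rR: "r k \<le> R" for k
  proof (induction k)
    case 0
    then show ?case using x(2) by (simp add: r_def y_def)
  next
    case (Suc k)
    then show ?case using mono[of k] by linarith
  qed
  have dec: "k \<le> l \<Longrightarrow> r l \<le> r k" for k l by (rule lift_Suc_antimono_le) (use mono rR in auto)
  have "r \<longlonglongrightarrow> 0"
  proof (rule LIMSEQ_I)
    fix \<epsilon> :: real assume \<epsilon>: "0 < \<epsilon>"
    have "\<exists>k. r k < \<epsilon>"
    proof (rule ccontr)
      assume "\<not> ?thesis"
      then have big: "\<epsilon> \<le> r k" for k by (simp add: not_less)
      have "(r (Suc k))\<^sup>2 \<le> (r k)\<^sup>2 - \<epsilon> ^ 4 * \<alpha> k" for k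
      proof -
        have "\<alpha> k * \<epsilon> ^ 4 \<le> \<alpha> k * r k ^ 4"
          using big[of k] \<epsilon> \<alpha>(1)[of k] by (intro mult_left_mono power_mono) auto
        then show ?thesis using step[OF rR, of k] by (simp add: mult.commute)
      qed
      then show False
        using no_perpetual_drift[OF \<alpha>(1,3), of "\<epsilon> ^ 4" 0 "\<lambda>k. (r k)\<^sup>2" 0] \<epsilon> by simp
    qed
    then obtain K where "r K < \<epsilon>" by blast
    then show "\<exists>K. \<forall>k\<ge>K. norm (r k - 0) < \<epsilon>"
      using dec by (intro exI[of _ K]) (auto simp: r_def intro: le_less_trans)
  qed
  then have "(\<lambda>k. norm (y k)) \<longlonglongrightarrow> 0" unfolding r_def .
  then show ?thesis unfolding y_def by (rule tendsto_norm_zero_cancel)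
qed

end

section \<open>Gradient descent for phase retrieval\<close>

lemma tens_apply_add:
  "tens_apply d (\<lambda>i j k l. R i j k l + S i j k l) u1 u2 u3 u4 = tens_apply d R u1 u2 u3 u4 + tens_apply d S u1 u2 u3 u4"
  by (simp add: tens_apply_def distrib_right sum.distrib)

lemma tens_apply_diff:
  "tens_apply d (\<lambda>i j k l. R i j k l - S i j k l) u1 u2 u3 u4 = tens_apply d R u1 u2 u3 u4 - tens_apply d S u1 u2 u3 u4"
  by (simp add: tens_apply_def left_diff_distrib sum_subtractf)

lemma tens_apply_cmult:
  "tens_apply d (\<lambda>i j k l. x * R i j k l) u1 u2 u3 u4 = x * tens_apply d R u1 u2 u3 u4"
  by (simp add: tens_apply_def sum_distrib_left mult.assoc)

lemma tens_apply_sum: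
  "tens_apply d (\<lambda>i j k l. \<Sum>q<(m::nat). R q i j k l) u1 u2 u3 u4 = (\<Sum>q<m. tens_apply d (R q) u1 u2 u3 u4)"
proof (induction m)
  case 0
  then show ?case by (simp add: tens_apply_def)
qed (simp add: tens_apply_add)

lemma tens_apply_rank_one:
  "tens_apply d (\<lambda>i j k l. p i * p j * p k * p l) u1 u2 u3 u4 =
    (\<Sum>i<d. p i * u1 i) * (\<Sum>i<d. p i * u2 i) * (\<Sum>i<d. p i * u3 i) * (\<Sum>i<d. p i * u4 i)"
proof -
  have "tens_apply d (\<lambda>i j k l. p i * p j * p k * p l) u1 u2 u3 u4
    = (\<Sum>i<d. \<Sum>j<d. \<Sum>k<d. \<Sum>l<d. (p i * u1 i) * ((p j * u2 j) * ((p k * u3 k) * (p l * u4 l))))"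
    by (simp add: tens_apply_def mult_ac)
  also have "\<dots> = (\<Sum>i<d. p i * u1 i) * ((\<Sum>i<d. p i * u2 i) * ((\<Sum>i<d. p i * u3 i) * (\<Sum>i<d. p i * u4 i)))"
    by (simp only: sum_distrib_left[symmetric] sum_distrib_right[symmetric])
  finally show ?thesis by (simp add: mult.assoc)
qed

lemma tens_apply_tensS:
  "tens_apply d tensS u1 u2 u3 u4 =
    (\<Sum>i<d. u1 i * u2 i) * (\<Sum>i<d. u3 i * u4 i) + (\<Sum>i<d. u1 i * u3 i) * (\<Sum>i<d. u2 i * u4 i)
    + (\<Sum>i<d. u1 i * u4 i) * (\<Sum>i<d. u2 i * u3 i)"
proof -
  have pick: "(\<Sum>l<d. (if P \<and> k = l then 1 else 0) * c l) = (if P then c k else (0::real))"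
    if "k < d" for k P c
  proof -
    have "(\<Sum>l<d. (if P \<and> k = l then 1 else 0) * c l) = (\<Sum>l<d. if l = k then (if P then c k else 0) else 0)"
      by (rule sum.cong) auto
    then show ?thesis using that by simp
  qed
  have *: "(\<Sum>j<d. if i = j then c j else 0) = (c i :: real)" if "i < d" for i c
    using that by (simp add: sum.delta')
  have "tens_apply d (\<lambda>i1 i2 i3 i4. if i1 = i2 \<and> i3 = i4 then 1 else 0) u1 u2 u3 u4
      = (\<Sum>i1<d. \<Sum>i2<d. \<Sum>i3<d. if i1 = i2 then u1 i1 * (u2 i2 * (u3 i3 * u4 i3)) else 0)"
    unfolding tens_apply_def mult.assoc by (intro sum.cong refl pick) auto
  also have "\<dots> = (\<Sum>i1<d. \<Sum>i2<d. if i1 = i2 then u1 i1 * (u2 i2 * (\<Sum>i3<d. u3 i3 * u4 i3)) else 0)"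
    by (intro sum.cong refl) (simp add: sum_distrib_left)
  also have "\<dots> = (\<Sum>i1<d. u1 i1 * (u2 i1 * (\<Sum>i3<d. u3 i3 * u4 i3)))"
    by (intro sum.cong refl *) auto
  also have "\<dots> = (\<Sum>i<d. u1 i * u2 i) * (\<Sum>i<d. u3 i * u4 i)"
    by (simp add: sum_distrib_right mult.assoc)
  finally have 1: "tens_apply d (\<lambda>i1 i2 i3 i4. if i1 = i2 \<and> i3 = i4 then 1 else 0) u1 u2 u3 u4
      = (\<Sum>i<d. u1 i * u2 i) * (\<Sum>i<d. u3 i * u4 i)" .
  have "tens_apply d (\<lambda>i1 i2 i3 i4. if i1 = i3 \<and> i2 = i4 then 1 else 0) u1 u2 u3 u4
      = (\<Sum>i1<d. \<Sum>i2<d. \<Sum>i3<d. if i1 = i3 then u1 i1 * (u2 i2 * (u3 i3 * u4 i2)) else 0)"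
    unfolding tens_apply_def mult.assoc by (intro sum.cong refl pick) auto
  also have "\<dots> = (\<Sum>i1<d. \<Sum>i2<d. u1 i1 * (u2 i2 * (u3 i1 * u4 i2)))"
    by (intro sum.cong refl *) auto
  also have "\<dots> = (\<Sum>i<d. u1 i * u3 i) * (\<Sum>i<d. u2 i * u4 i)"
    by (simp add: sum_product mult_ac)
  finally have 2: "tens_apply d (\<lambda>i1 i2 i3 i4. if i1 = i3 \<and> i2 = i4 then 1 else 0) u1 u2 u3 u4
      = (\<Sum>i<d. u1 i * u3 i) * (\<Sum>i<d. u2 i * u4 i)" .
  \<comment> \<open>The conjuncts are swapped so that the equation for the innermost index comes
    last, as \<open>pick\<close> requires.\<close>
  have "tens_apply d (\<lambda>i1 i2 i3 i4. if i1 = i4 \<and> i2 = i3 then 1 else 0) u1 u2 u3 u4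
      = tens_apply d (\<lambda>i1 i2 i3 i4. if i2 = i3 \<and> i1 = i4 then 1 else 0) u1 u2 u3 u4"
    by (simp add: conj_commute)
  also have "\<dots> = (\<Sum>i1<d. \<Sum>i2<d. \<Sum>i3<d. if i2 = i3 then u1 i1 * (u2 i2 * (u3 i3 * u4 i1)) else 0)"
    unfolding tens_apply_def mult.assoc by (intro sum.cong refl pick) auto
  also have "\<dots> = (\<Sum>i1<d. \<Sum>i2<d. u1 i1 * (u2 i2 * (u3 i2 * u4 i1)))"
    by (intro sum.cong refl *) auto
  also have "\<dots> = (\<Sum>i<d. u1 i * u4 i) * (\<Sum>i<d. u2 i * u3 i)"
    by (simp add: sum_product mult_ac)
  finally have 3: "tens_apply d (\<lambda>i1 i2 i3 i4. if i1 = i4 \<and> i2 = i3 then 1 else 0) u1 u2 u3 u4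
      = (\<Sum>i<d. u1 i * u4 i) * (\<Sum>i<d. u2 i * u3 i)" .
  show ?thesis unfolding tensS_def tens_apply_add 1 2 3 ..
qed

section \<open>The operator norm as a bound on contractions\<close>

lemma rnorm_nonneg: "0 \<le> rnorm d u"
  by (simp add: rnorm_def sum_nonneg)

lemma abs_le_rnorm:
  assumes "i < d"
  shows "\<bar>u i\<bar> \<le> rnorm d u"
proof -
  have "(u i)\<^sup>2 \<le> (\<Sum>j<d. (u j)\<^sup>2)" by (rule member_le_sum) (use assms in auto)
  then show ?thesis unfolding rnorm_def by (rule real_le_rsqrt[of "\<bar>u i\<bar>", simplified])
qed

lemma rnorm_cmult: "rnorm d (\<lambda>i. k * u i) = \<bar>k\<bar> * rnorm d u"
  by (simp add: rnorm_def power_mult_distrib sum_distrib_left[symmetric] real_sqrt_mult)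

text \<open>A crude bound with two uses: it makes the set in the operator norm bounded above, so
  that its supremum is meaningful, and it settles vectors of norm zero.\<close>

lemma tens_apply_abs_le:
  "\<bar>tens_apply d R u1 u2 u3 u4\<bar> \<le> (\<Sum>i<d. \<Sum>j<d. \<Sum>k<d. \<Sum>l<d. \<bar>R i j k l\<bar>)
     * (rnorm d u1 * rnorm d u2 * rnorm d u3 * rnorm d u4)"
  unfolding tens_apply_def sum_distrib_right
proof (intro order_trans[OF sum_abs] sum_mono)
  fix i j k l assume "i \<in> {..<d}" "j \<in> {..<d}" "k \<in> {..<d}" "l \<in> {..<d}"
  then have "\<bar>u1 i\<bar> * \<bar>u2 j\<bar> * \<bar>u3 k\<bar> * \<bar>u4 l\<bar> \<le> rnorm d u1 * rnorm d u2 * rnorm d u3 * rnorm d u4"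
    by (intro mult_mono mult_nonneg_nonneg abs_le_rnorm rnorm_nonneg) auto
  then have "\<bar>R i j k l\<bar> * (\<bar>u1 i\<bar> * \<bar>u2 j\<bar> * \<bar>u3 k\<bar> * \<bar>u4 l\<bar>) \<le> \<bar>R i j k l\<bar> * (rnorm d u1 * rnorm d u2 * rnorm d u3 * rnorm d u4)"
    by (rule mult_left_mono) simp
  then show "\<bar>R i j k l * u1 i * u2 j * u3 k * u4 l\<bar> \<le> \<bar>R i j k l\<bar> * (rnorm d u1 * rnorm d u2 * rnorm d u3 * rnorm d u4)"
    by (simp add: abs_mult mult.assoc)
qed

text \<open>Only the product of the four norms is normalised in the operator norm, so scaling the
  first vector alone suffices, and a sign in the same factor yields the absolute value.\<close>

lemma tens_apply_le_opnorm:
  assumes op: "tens_opnorm d R \<le> \<delta>"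
  shows "\<bar>tens_apply d R u1 u2 u3 u4\<bar> \<le> \<delta> * (rnorm d u1 * rnorm d u2 * rnorm d u3 * rnorm d u4)"
proof -
  define S where "S = {tens_apply d R u1 u2 u3 u4 | u1 u2 u3 u4. rnorm d u1 * rnorm d u2 * rnorm d u3 * rnorm d u4 = 1}"
  define p where "p = rnorm d u1 * rnorm d u2 * rnorm d u3 * rnorm d u4"
  have p0: "0 \<le> p" by (simp add: p_def rnorm_nonneg)
  have bdd: "bdd_above S"
  proof (rule bdd_aboveI)
    fix z assume "z \<in> S"
    then obtain v1 v2 v3 v4 where v: "z = tens_apply d R v1 v2 v3 v4" "rnorm d v1 * rnorm d v2 * rnorm d v3 * rnorm d v4 = 1"
      by (auto simp: S_def)
    then show "z \<le> (\<Sum>i<d. \<Sum>j<d. \<Sum>k<d. \<Sum>l<d. \<bar>R i j k l\<bar>)"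
      using tens_apply_abs_le[of d R v1 v2 v3 v4] by simp
  qed
  show ?thesis
  proof (cases "p = 0")
    case True
    then show ?thesis using tens_apply_abs_le[of d R u1 u2 u3 u4] unfolding p_def[symmetric] by simp
  next
    case False
    then have p: "0 < p" using p0 by simp
    have "s * tens_apply d R u1 u2 u3 u4 \<le> \<delta> * p" if s: "\<bar>s\<bar> = 1" for s
    proof -
      have "tens_apply d R (\<lambda>i. (s / p) * u1 i) u2 u3 u4 = (s / p) * tens_apply d R u1 u2 u3 u4"
        by (simp add: tens_apply_def sum_distrib_left mult_ac)
      moreover have "tens_apply d R (\<lambda>i. (s / p) * u1 i) u2 u3 u4 \<in> S"
      proof -
        have "rnorm d (\<lambda>i. (s / p) * u1 i) * rnorm d u2 * rnorm d u3 * rnorm d u4 = \<bar>s / p\<bar> * p"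
          unfolding rnorm_cmult p_def by simp
        also have "\<dots> = 1" using p s by (simp add: abs_divide)
        finally show ?thesis unfolding S_def by blast
      qed
      ultimately have "(s / p) * tens_apply d R u1 u2 u3 u4 \<le> Sup S"
        using cSup_upper[OF _ bdd] by simp
      also have "\<dots> \<le> \<delta>" using op by (simp add: tens_opnorm_def S_def)
      finally show ?thesis using p by (simp add: field_simps)
    qed
    from this[of 1] this[of "-1"] show ?thesis by (simp add: p_def abs_le_iff)
  qed
qed

text \<open>The matrix M, that is, multiplication by the imaginary unit in real coordinates.\<close>

definition rot :: "nat \<Rightarrow> fvec \<Rightarrow> fvec" where
  "rot n x = fvec_of (2 * n) (\<lambda>i. if i < n then - nth_fvec x (n + i) else nth_fvec x (i - n))"

section \<open>The complex inner product in real coordinates\<close>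

lemma sum_halves: "(\<Sum>i<2 * (n::nat). f i) = (\<Sum>j<n. f j) + (\<Sum>j<n. f (n + j) :: real)"
proof -
  have "(\<Sum>i<n + k. f i) = (\<Sum>j<n. f j) + (\<Sum>j<k. f (n + j))" for k
    by (induction k) (simp_all add: add.assoc)
  from this[of n] show ?thesis by (simp add: mult_2)
qed

lemma linear_rot: "linear (rot n)"
  by (intro linearI fvec_eqI) (auto simp: rot_def)

lemma rot_in: "rot n x \<in> fspace (2 * n)"
  by (simp add: rot_def)

lemma inner_rot:
  assumes "x \<in> fspace (2 * n)"
  shows "x \<bullet> rot n y = (\<Sum>j<n. nth_fvec x (n + j) * nth_fvec y j - nth_fvec x j * nth_fvec y (n + j))"
  unfolding inner_fspace[OF assms] sum_halves by (simp add: rot_def sum_subtractf sum_negf)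

lemma rot_rot_inner:
  assumes "x \<in> fspace (2 * n)" "y \<in> fspace (2 * n)"
  shows "rot n x \<bullet> rot n y = x \<bullet> y"
  unfolding inner_rot[OF rot_in] inner_fspace[OF assms(1)] sum_halves
  by (simp add: rot_def sum.distrib)

lemma rot_rot: "x \<in> fspace (2 * n) \<Longrightarrow> rot n (rot n x) = - x"
  by (intro fvec_eqI) (auto simp: rot_def fspace_def)

text \<open>The inner product is conjugate-linear in its second argument, so its imaginary part is
  the real pairing of the first vector with i times the second.\<close>

lemma cmod_cinner_sq:
  fixes n :: nat and v :: "nat \<Rightarrow> complex" and u :: "nat \<Rightarrow> real"
  defines "b \<equiv> fvec_of (2 * n) (plus_vec n v)" and "U \<equiv> fvec_of (2 * n) u"
  shows "(cmod (cinner n v (to_cplx n u)))\<^sup>2 = (b \<bullet> U)\<^sup>2 + (b \<bullet> rot n U)\<^sup>2"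
proof -
  have bV: "b \<in> fspace (2 * n)" by (simp add: b_def)
  have "Re (cinner n v (to_cplx n u)) = b \<bullet> U"
    unfolding inner_fspace[OF bV] sum_halves
    by (simp add: cinner_def to_cplx_def b_def U_def plus_vec_def sum.distrib)
  moreover have "Im (cinner n v (to_cplx n u)) = b \<bullet> rot n U"
    unfolding inner_rot[OF bV]
    by (simp add: cinner_def to_cplx_def b_def U_def plus_vec_def)
  ultimately show ?thesis by (simp add: cmod_power2)
qed

lemma cinner_plus_vec: "cinner n v (to_cplx n (plus_vec n x)) = cinner n v x"
  unfolding cinner_def by (rule sum.cong) (auto simp: to_cplx_def plus_vec_def complex_eq_iff)

definition meas_vec :: "nat \<Rightarrow> (nat \<Rightarrow> nat \<Rightarrow> complex) \<Rightarrow> nat \<Rightarrow> fvec" where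
  "meas_vec n a i = fvec_of (2 * n) (plus_vec n (a i))"

text \<open>This is the negative of M applied to the measurement vector, because M is skew and has
  to move to the other argument. In loss and gradient the vector occurs in pairs, so the sign
  cancels.\<close>

definition meas_rot :: "nat \<Rightarrow> (nat \<Rightarrow> nat \<Rightarrow> complex) \<Rightarrow> nat \<Rightarrow> fvec" where
  "meas_rot n a i = - rot n (meas_vec n a i)"

lemma tensor_data_phase_retrieval:
  assumes m: "1 \<le> m" and \<sigma>: "0 < \<sigma>" and e: "e \<in> fspace (2 * n)"
    and op: "tens_opnorm (2 * n) (\<lambda>i1 i2 i3 i4. tensT n m a \<sigma> i1 i2 i3 i4 - tensS i1 i2 i3 i4) \<le> 1 / 10000"
  shows "tensor_data (fspace (2 * n)) (rot n) (meas_vec n a) (meas_rot n a) m (real m * \<sigma> ^ 4) e"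
proof (rule tensor_data.intro)
  show "subspace (fspace (2 * n))" by (rule subspace_fspace)
  show "complete (fspace (2 * n))" by (rule complete_fspace)
  show "linear (rot n)" by (rule linear_rot)
  show bV: "meas_vec n a i \<in> fspace (2 * n)" for i by (simp add: meas_vec_def)
  show "meas_rot n a i \<in> fspace (2 * n)" for i
    unfolding meas_rot_def by (rule subspace_neg[OF subspace_fspace rot_in])
  show "meas_rot n a i \<bullet> x = meas_vec n a i \<bullet> rot n x" if "x \<in> fspace (2 * n)" for i x
    using rot_rot_inner[OF bV rot_in, of i x] rot_rot[OF that] by (simp add: meas_rot_def)
  show "0 < real m * \<sigma> ^ 4" using m \<sigma> by simp
  show "e \<in> fspace (2 * n)" by (rule e)
  fix u1 u2 u3 u4 assume u: "u1 \<in> fspace (2 * n)" "u2 \<in> fspace (2 * n)" "u3 \<in> fspace (2 * n)" "u4 \<in> fspace (2 * n)"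
  have nrm: "rnorm (2 * n) (nth_fvec x) = norm x" if "x \<in> fspace (2 * n)" for x
    by (simp add: rnorm_def norm_fspace[OF that])
  have inn: "(\<Sum>i<2 * n. plus_vec n (a q) i * nth_fvec x i) = meas_vec n a q \<bullet> x" for q x
    unfolding inner_fspace[OF bV] by (simp add: meas_vec_def)
  have "tens_apply (2 * n) (tensT n m a \<sigma>) (nth_fvec u1) (nth_fvec u2) (nth_fvec u3) (nth_fvec u4)
     = (\<Sum>i<m. (meas_vec n a i \<bullet> u1) * (meas_vec n a i \<bullet> u2) * (meas_vec n a i \<bullet> u3) * (meas_vec n a i \<bullet> u4)) / (real m * \<sigma> ^ 4)"
    unfolding tensT_def tens_apply_cmult tens_apply_sum tens_apply_rank_one inn by simp
  moreover have "tens_apply (2 * n) tensS (nth_fvec u1) (nth_fvec u2) (nth_fvec u3) (nth_fvec u4)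
     = (u1 \<bullet> u2) * (u3 \<bullet> u4) + (u1 \<bullet> u3) * (u2 \<bullet> u4) + (u1 \<bullet> u4) * (u2 \<bullet> u3)"
    unfolding tens_apply_tensS using u by (simp add: inner_fspace)
  ultimately show "\<bar>(\<Sum>i<m. (meas_vec n a i \<bullet> u1) * (meas_vec n a i \<bullet> u2) * (meas_vec n a i \<bullet> u3) * (meas_vec n a i \<bullet> u4)) / (real m * \<sigma> ^ 4)
      - ((u1 \<bullet> u2) * (u3 \<bullet> u4) + (u1 \<bullet> u3) * (u2 \<bullet> u4) + (u1 \<bullet> u4) * (u2 \<bullet> u3))\<bar>
    \<le> 1 / 10000 * (norm u1 * norm u2 * norm u3 * norm u4)"
    using tens_apply_le_opnorm[OF op, of "nth_fvec u1" "nth_fvec u2" "nth_fvec u3" "nth_fvec u4"] nrm u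
    unfolding tens_apply_diff by simp
qed (use rot_in rot_rot_inner rot_rot in auto)

text \<open>The loss is homogeneous of degree 4 in point and signal jointly, and its gradient of
  degree 3. Dividing by \<rho> therefore conjugates the descent to the normalised one with steps
  multiplied by 16 c \<rho>^2.\<close>

lemma phase_retrieval_scaling:
  fixes n m :: nat and a :: "nat \<Rightarrow> nat \<Rightarrow> complex" and xnat :: "nat \<Rightarrow> complex"
  assumes data: "tensor_data (fspace (2 * n)) (rot n) (meas_vec n a) (meas_rot n a) m c e"
    and \<rho>: "0 < \<rho>" and sig: "fvec_of (2 * n) (plus_vec n xnat) = \<rho> *\<^sub>R e"
  defines "F \<equiv> tensor_data.F (meas_vec n a) (meas_rot n a) m c e" and "g \<equiv> tensor_data.g (meas_vec n a) (meas_rot n a) m c e"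
  shows "pr_loss n m a xnat u = 16 * c * \<rho> ^ 4 * F ((1 / \<rho>) *\<^sub>R fvec_of (2 * n) u)"
    and "fvec_of (2 * n) (gd_iter (pr_loss n m a xnat) \<alpha> u k)
      = \<rho> *\<^sub>R grad_steps g (\<lambda>k. 16 * c * \<rho>\<^sup>2 * \<alpha> k) ((1 / \<rho>) *\<^sub>R fvec_of (2 * n) u) k"
proof -
  interpret tensor_data "fspace (2 * n)" "rot n" "meas_vec n a" "meas_rot n a" m c e
    rewrites "F = tensor_data.F (meas_vec n a) (meas_rot n a) m c e" and "g = tensor_data.g (meas_vec n a) (meas_rot n a) m c e"
    using data by (simp_all add: F_def g_def)
  let ?f = "pr_loss n m a xnat"
  let ?U = "fvec_of (2 * n)"
  have q: "(cmod (cinner n (a i) (to_cplx n u)))\<^sup>2 = \<rho>\<^sup>2 * qf i ((1 / \<rho>) *\<^sub>R ?U u)" for i u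
  proof -
    have "(cmod (cinner n (a i) (to_cplx n u)))\<^sup>2 = qf i (?U u)"
      unfolding cmod_cinner_sq meas_vec_def[symmetric] qf_def b'J[OF fvec_of_in_fspace] ..
    also have "\<dots> = \<rho>\<^sup>2 * qf i ((1 / \<rho>) *\<^sub>R ?U u)"
      using \<rho> by (simp add: qf_def power_divide field_simps)
    finally show ?thesis .
  qed
  have y: "(cmod (cinner n (a i) xnat))\<^sup>2 = \<rho>\<^sup>2 * qf i e" for i
    using q[of i "plus_vec n xnat"] \<rho> unfolding cinner_plus_vec sig by simp
  have loss: "?f u = 16 * c * \<rho> ^ 4 * local.F ((1 / \<rho>) *\<^sub>R ?U u)" for u
  proof -
    have "?f u = (\<Sum>i<m. \<rho> ^ 4 * (qf i ((1 / \<rho>) *\<^sub>R ?U u) - qf i e)\<^sup>2)"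
      unfolding pr_loss_def q y
      by (rule sum.cong) (auto simp: right_diff_distrib[symmetric] power_mult_distrib)
    then show ?thesis using c by (simp add: F_def sum_distrib_left[symmetric])
  qed
  show "?f u = 16 * c * \<rho> ^ 4 * F ((1 / \<rho>) *\<^sub>R ?U u)" unfolding loss by (simp add: assms)
  have grad: "rgrad ?f u j = 16 * c * \<rho> ^ 3 * nth_fvec (local.g ((1 / \<rho>) *\<^sub>R ?U u)) j" if j: "j < 2 * n" for u j
  proof -
    define E where "E = ?U (\<lambda>i. if i = j then 1 else 0)"
    define x where "x = (1 / \<rho>) *\<^sub>R ?U u"
    have "?U (u(j := u j + t)) = ?U u + t *\<^sub>R E" for t
      by (intro fvec_eqI) (auto simp: E_def j)
    then have "(\<lambda>t. ?f (u(j := u j + t))) = (\<lambda>t. 16 * c * \<rho> ^ 4 * local.F (x + t *\<^sub>R ((1 / \<rho>) *\<^sub>R E)))"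
      unfolding loss by (simp add: x_def scaleR_add_right scaleR_scaleR mult.commute)
    moreover have "((\<lambda>t. 16 * c * \<rho> ^ 4 * local.F (x + t *\<^sub>R ((1 / \<rho>) *\<^sub>R E)))
        has_real_derivative 16 * c * \<rho> ^ 4 * (local.g (x + 0 *\<^sub>R ((1 / \<rho>) *\<^sub>R E)) \<bullet> ((1 / \<rho>) *\<^sub>R E))) (at 0)"
      by (intro DERIV_cmult deriv_F)
    ultimately have "rgrad ?f u j = 16 * c * \<rho> ^ 4 * (local.g x \<bullet> ((1 / \<rho>) *\<^sub>R E))"
      unfolding rgrad_def by (simp add: DERIV_imp_deriv)
    also have "\<dots> = 16 * c * \<rho> ^ 3 * (local.g x \<bullet> E)" using \<rho> by (simp add: eval_nat_numeral)
    also have "local.g x \<bullet> E = nth_fvec (local.g x) j"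
    proof -
      have "local.g x \<bullet> E = (\<Sum>i<2 * n. if i = j then nth_fvec (local.g x) j else 0)"
        unfolding inner_fspace[OF g_V] by (rule sum.cong) (auto simp: E_def)
      then show ?thesis using j by simp
    qed
    finally show ?thesis by (simp add: x_def)
  qed
  show "?U (gd_iter ?f \<alpha> u k) = \<rho> *\<^sub>R grad_steps g (\<lambda>k. 16 * c * \<rho>\<^sup>2 * \<alpha> k) ((1 / \<rho>) *\<^sub>R ?U u) k"
  proof (induction k)
    case 0
    then show ?case using \<rho> by simp
  next
    case (Suc k)
    define w where "w = gd_iter ?f \<alpha> u k"
    define y where "y = grad_steps g (\<lambda>k. 16 * c * \<rho>\<^sup>2 * \<alpha> k) ((1 / \<rho>) *\<^sub>R ?U u) k"
    have wy: "(1 / \<rho>) *\<^sub>R ?U w = y" using Suc \<rho> by (simp add: w_def y_def)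
    show ?case
    proof (rule fvec_eqI)
      fix j
      show "nth_fvec (?U (gd_iter ?f \<alpha> u (Suc k))) j
        = nth_fvec (\<rho> *\<^sub>R grad_steps g (\<lambda>k. 16 * c * \<rho>\<^sup>2 * \<alpha> k) ((1 / \<rho>) *\<^sub>R ?U u) (Suc k)) j"
      proof (cases "j < 2 * n")
        case True
        have "\<rho> * nth_fvec y j = w j" using \<rho> True unfolding wy[symmetric] by simp
        have "nth_fvec (?U (gd_iter ?f \<alpha> u (Suc k))) j = w j - \<alpha> k * rgrad ?f w j"
          using True by (simp add: w_def)
        also have "\<dots> = \<rho> * nth_fvec y j - \<alpha> k * (16 * c * \<rho> ^ 3 * nth_fvec (local.g y) j)"
          unfolding grad[OF True] wy \<open>\<rho> * nth_fvec y j = w j\<close> ..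
        also have "\<dots> = nth_fvec (\<rho> *\<^sub>R (y - (16 * c * \<rho>\<^sup>2 * \<alpha> k) *\<^sub>R local.g y)) j"
          by (simp add: power3_eq_cube power2_eq_square algebra_simps)
        finally show ?thesis by (simp add: y_def assms)
      next
        \<comment> \<open>The iterates are functions on all natural numbers; beyond 2 n the
          truncation by \<open>fvec_of\<close> makes both sides zero.\<close>
        case False
        have "y \<in> fspace (2 * n)" unfolding wy[symmetric] by (intro subspace_scale[OF subspace_fspace]) simp
        moreover have "g y \<in> fspace (2 * n)" using g_V by (simp add: assms)
        ultimately show ?thesis using False by (simp add: y_def[symmetric] fspace_def)
      qed
    qed
  qed
qed

text \<open>A zero of the normalised loss is a global minimiser since the loss is a sum of squares.
  The step bound is rescaled by the factor between the two time scales.\<close>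

lemma phase_retrieval_converges:
  fixes n m :: nat and a :: "nat \<Rightarrow> nat \<Rightarrow> complex" and xnat :: "nat \<Rightarrow> complex"
  assumes data: "tensor_data (fspace (2 * n)) (rot n) (meas_vec n a) (meas_rot n a) m c e"
    and \<rho>: "0 < \<rho>" and sig: "fvec_of (2 * n) (plus_vec n xnat) = \<rho> *\<^sub>R e"
  defines "F \<equiv> tensor_data.F (meas_vec n a) (meas_rot n a) m c e" and "g \<equiv> tensor_data.g (meas_vec n a) (meas_rot n a) m c e"
  assumes \<eta>: "0 < \<eta>" and conv: "\<And>\<alpha>. (\<And>k. 0 < \<alpha> k) \<Longrightarrow> (\<And>k. \<alpha> k \<le> \<eta>) \<Longrightarrow> \<not> summable \<alpha> \<Longrightarrow>
      \<exists>z\<in>fspace (2 * n). F z = 0 \<and> grad_steps g \<alpha> ((1 / \<rho>) *\<^sub>R fvec_of (2 * n) u) \<longlonglongrightarrow> z"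
  shows "\<exists>\<alpha>bar > 0. \<forall>\<alpha> :: nat \<Rightarrow> real. (\<forall>k. 0 < \<alpha> k \<and> \<alpha> k \<le> \<alpha>bar) \<longrightarrow> \<not> summable \<alpha> \<longrightarrow>
    (\<exists>xstar :: nat \<Rightarrow> real. (\<forall>v. pr_loss n m a xnat xstar \<le> pr_loss n m a xnat v) \<and>
      (\<forall>j < 2 * n. (\<lambda>k. gd_iter (pr_loss n m a xnat) \<alpha> u k j) \<longlonglongrightarrow> xstar j))"
proof -
  let ?U = "fvec_of (2 * n)"
  note sc = phase_retrieval_scaling[OF data \<rho> sig, folded F_def g_def]
  define C where "C = 16 * c * \<rho>\<^sup>2"
  have C: "0 < C" using tensor_data.c[OF data] \<rho> by (simp add: C_def)
  show ?thesis
  proof (intro exI[of _ "\<eta> / C"] conjI allI impI)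
    fix \<alpha> :: "nat \<Rightarrow> real"
    assume \<alpha>: "\<forall>k. 0 < \<alpha> k \<and> \<alpha> k \<le> \<eta> / C" and ns: "\<not> summable \<alpha>"
    have "\<exists>z\<in>fspace (2 * n). F z = 0 \<and> grad_steps g (\<lambda>k. C * \<alpha> k) ((1 / \<rho>) *\<^sub>R ?U u) \<longlonglongrightarrow> z"
    proof (rule conv)
      show "0 < C * \<alpha> k" for k using \<alpha> C by simp
      show "C * \<alpha> k \<le> \<eta>" for k using \<alpha>[rule_format, of k] C by (simp add: field_simps)
      show "\<not> summable (\<lambda>k. C * \<alpha> k)" using ns C by (simp add: summable_cmult_iff)
    qed
    then obtain z where z: "z \<in> fspace (2 * n)" "F z = 0" "grad_steps g (\<lambda>k. C * \<alpha> k) ((1 / \<rho>) *\<^sub>R ?U u) \<longlonglongrightarrow> z"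
      by blast
    define xs where "xs = nth_fvec (\<rho> *\<^sub>R z)"
    have "\<rho> *\<^sub>R z \<in> fspace (2 * n)" using z(1) by (rule subspace_scale[OF subspace_fspace])
    then have U: "?U xs = \<rho> *\<^sub>R z" unfolding xs_def by (rule fvec_of_nth)
    have "pr_loss n m a xnat xs = 0" unfolding sc(1) U using \<rho> z(2) by simp
    moreover have "0 \<le> pr_loss n m a xnat v" for v unfolding pr_loss_def by (intro sum_nonneg) simp
    ultimately have min: "\<forall>v. pr_loss n m a xnat xs \<le> pr_loss n m a xnat v" by simp
    have "(\<lambda>k. ?U (gd_iter (pr_loss n m a xnat) \<alpha> u k)) \<longlonglongrightarrow> \<rho> *\<^sub>R z"
      unfolding sc(2) C_def[symmetric] by (intro tendsto_scaleR tendsto_const z(3))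
    then have lim: "(\<lambda>k. nth_fvec (?U (gd_iter (pr_loss n m a xnat) \<alpha> u k)) j) \<longlonglongrightarrow> xs j" for j
      unfolding xs_def by (rule tendsto_nth_fvec)
    have "\<forall>j<2 * n. (\<lambda>k. gd_iter (pr_loss n m a xnat) \<alpha> u k j) \<longlonglongrightarrow> xs j"
    proof (intro allI impI)
      fix j assume "j < 2 * n"
      then show "(\<lambda>k. gd_iter (pr_loss n m a xnat) \<alpha> u k j) \<longlonglongrightarrow> xs j" using lim[of j] by simp
    qed
    with min show "\<exists>xstar :: nat \<Rightarrow> real. (\<forall>v. pr_loss n m a xnat xstar \<le> pr_loss n m a xnat v) \<and>
        (\<forall>j < 2 * n. (\<lambda>k. gd_iter (pr_loss n m a xnat) \<alpha> u k j) \<longlonglongrightarrow> xstar j)" by blast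
  qed (use \<eta> C in simp)
qed

theorem theorem2:
  shows "\<exists>\<delta>0 > 0. \<forall>(n::nat) (m::nat) (a :: nat \<Rightarrow> nat \<Rightarrow> complex) (xnat :: nat \<Rightarrow> complex) (\<sigma>::real).
    n \<ge> 1 \<longrightarrow> m \<ge> 1 \<longrightarrow> \<sigma> > 0 \<longrightarrow>
    tens_opnorm (2 * n) (\<lambda>i1 i2 i3 i4. tensT n m a \<sigma> i1 i2 i3 i4 - tensS i1 i2 i3 i4) \<le> \<delta>0 \<longrightarrow>
    (AE x0 in PiM {..<2 * n} (\<lambda>_. lborel).
       \<exists>\<alpha>bar > 0. \<forall>\<alpha> :: nat \<Rightarrow> real.
         (\<forall>k. 0 < \<alpha> k \<and> \<alpha> k \<le> \<alpha>bar) \<longrightarrow> \<not> summable \<alpha> \<longrightarrow>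
         (\<exists>xstar :: nat \<Rightarrow> real.
            (\<forall>v. pr_loss n m a xnat xstar \<le> pr_loss n m a xnat v) \<and>
            (\<forall>j < 2 * n. (\<lambda>k. gd_iter (pr_loss n m a xnat) \<alpha> x0 k j) \<longlonglongrightarrow> xstar j)))"
\<comment> \<open>The tolerance built into \<open>tensor_data\<close>.\<close>
proof (intro exI[of _ "1 / 10000"] conjI allI impI)
  fix n m :: nat and a :: "nat \<Rightarrow> nat \<Rightarrow> complex" and xnat :: "nat \<Rightarrow> complex" and \<sigma> :: real
  assume n: "1 \<le> n" and m: "1 \<le> m" and \<sigma>: "0 < \<sigma>"
    and op: "tens_opnorm (2 * n) (\<lambda>i1 i2 i3 i4. tensT n m a \<sigma> i1 i2 i3 i4 - tensS i1 i2 i3 i4) \<le> 1 / 10000"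
  define c where "c = real m * \<sigma> ^ 4"
  define s where "s = fvec_of (2 * n) (plus_vec n xnat)"
  have sV: "s \<in> fspace (2 * n)" by (simp add: s_def)
  note data = tensor_data_phase_retrieval[OF m \<sigma> _ op, folded c_def]
  note conv = phase_retrieval_converges[of n a m c _ _ xnat, folded s_def]
  show "AE x0 in PiM {..<2 * n} (\<lambda>_. lborel).
       \<exists>\<alpha>bar > 0. \<forall>\<alpha> :: nat \<Rightarrow> real.
         (\<forall>k. 0 < \<alpha> k \<and> \<alpha> k \<le> \<alpha>bar) \<longrightarrow> \<not> summable \<alpha> \<longrightarrow>
         (\<exists>xstar :: nat \<Rightarrow> real.
            (\<forall>v. pr_loss n m a xnat xstar \<le> pr_loss n m a xnat v) \<and>
            (\<forall>j < 2 * n. (\<lambda>k. gd_iter (pr_loss n m a xnat) \<alpha> x0 k j) \<longlonglongrightarrow> xstar j))"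
  \<comment> \<open>The first n entries of the signal may all vanish; then the circle of minimisers
    shrinks to the origin.\<close>
  proof (cases "s = 0")
    case True
    have D: "tensor_data (fspace (2 * n)) (rot n) (meas_vec n a) (meas_rot n a) m c 0"
      by (rule data) (simp add: fspace_def)
    show ?thesis
    proof (rule AE_I2)
      fix u
      define x where "x = fvec_of (2 * n) u"
      define R where "R = norm x + 1"
      have R: "0 < R" by (simp add: R_def add_nonneg_pos)
      show "\<exists>\<alpha>bar > 0. \<forall>\<alpha> :: nat \<Rightarrow> real.
         (\<forall>k. 0 < \<alpha> k \<and> \<alpha> k \<le> \<alpha>bar) \<longrightarrow> \<not> summable \<alpha> \<longrightarrow>
         (\<exists>xstar :: nat \<Rightarrow> real.
            (\<forall>v. pr_loss n m a xnat xstar \<le> pr_loss n m a xnat v) \<and>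
            (\<forall>j < 2 * n. (\<lambda>k. gd_iter (pr_loss n m a xnat) \<alpha> u k j) \<longlonglongrightarrow> xstar j))"
      \<comment> \<open>There is no scale to remove, so \<rho> = 1; R exceeds the norm by 1 to be
        positive even at the origin.\<close>
      proof (rule conv[OF D, of 1 "1 / (9 * R\<^sup>2)"])
        fix \<alpha> :: "nat \<Rightarrow> real"
        assume \<alpha>: "\<And>k. 0 < \<alpha> k" "\<And>k. \<alpha> k \<le> 1 / (9 * R\<^sup>2)" "\<not> summable \<alpha>"
        have "grad_steps (tensor_data.g (meas_vec n a) (meas_rot n a) m c 0) \<alpha> x \<longlonglongrightarrow> 0"
        proof (rule tensor_data.zero_signal_converges[OF D refl _ _ R])
          show "\<alpha> k * (9 * R\<^sup>2) \<le> 1" for k using \<alpha>(2)[of k] R by (simp add: field_simps)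
        qed (use \<alpha> in \<open>auto simp: x_def R_def\<close>)
        moreover have "tensor_data.F (meas_vec n a) (meas_rot n a) m c 0 0 = 0"
          using tensor_data.F_def[OF D] by simp
        ultimately show "\<exists>z\<in>fspace (2 * n). tensor_data.F (meas_vec n a) (meas_rot n a) m c 0 z = 0 \<and>
            grad_steps (tensor_data.g (meas_vec n a) (meas_rot n a) m c 0) \<alpha> ((1 / 1) *\<^sub>R fvec_of (2 * n) u) \<longlonglongrightarrow> z"
          by (intro bexI[of _ 0]) (auto simp: x_def fspace_def)
      qed (use True R in auto)
    qed
  next
    case False
    define \<rho> where "\<rho> = norm s"
    define e where "e = (1 / \<rho>) *\<^sub>R s"
    have \<rho>: "0 < \<rho>" using False by (simp add: \<rho>_def)
    have se: "s = \<rho> *\<^sub>R e" using \<rho> by (simp add: e_def)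
    have ee: "e \<bullet> e = 1" using \<rho> by (simp add: e_def \<rho>_def dot_square_norm power2_eq_square)
    have D: "tensor_data (fspace (2 * n)) (rot n) (meas_vec n a) (meas_rot n a) m c e"
      unfolding e_def by (rule data[OF subspace_scale[OF subspace_fspace sV]])
    note L = tensor_data.perturbed_landscape[OF D ee]
    have "AE u in PiM {..<2 * n} (\<lambda>_. lborel). \<not> perturbed_landscape.stuck (fspace (2 * n))
        (tensor_data.F (meas_vec n a) (meas_rot n a) m c e) (tensor_data.g (meas_vec n a) (meas_rot n a) m c e)
        ((1 / \<rho>) *\<^sub>R fvec_of (2 * n) u)"
      using n by (intro AE_not_stuck[OF L _ \<rho>]) simp
    then show ?thesis
    proof eventually_elim
      case (elim u)
      then obtain \<eta> where \<eta>: "0 < \<eta> \<and> (\<forall>\<alpha>. (\<forall>k. 0 < \<alpha> k \<and> \<alpha> k \<le> \<eta>) \<longrightarrow> \<not> summable \<alpha> \<longrightarrow>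
          (\<exists>z\<in>fspace (2 * n). tensor_data.F (meas_vec n a) (meas_rot n a) m c e z = 0 \<and>
            grad_steps (tensor_data.g (meas_vec n a) (meas_rot n a) m c e) \<alpha> ((1 / \<rho>) *\<^sub>R fvec_of (2 * n) u) \<longlonglongrightarrow> z))"
        unfolding perturbed_landscape.not_stuck[OF L] by (rule exE)
      show ?case
        by (rule conv[OF D \<rho> se \<eta>[THEN conjunct1]], rule \<eta>[THEN conjunct2, rule_format]) simp_all
    qed
  qed
qed simp

end
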